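(* Suppose $X$ is a complete metric structure that admits independent sequences, has locally finite automorphisms and the extension property. Then for every Polish group $H$ which admits a complete left-invariant metric, every group homomorphism from $\mathrm{Aut}(X)$ to $H$ is trivial.
   Context: A metric structure is a tuple $(X,d_X,f_1,f_2,\ldots)$ where $(X,d_X)$ is a separable metric space and each $f_i$ is either a closed subset of $X^n\times\mathbb{R}^m$ (a relation) or a function $X^n\times\mathbb{R}^m\to X^k\times\mathbb{R}^l$ continuous in the $X$-arguments; it is complete if $(X,d_X)$ is complete. $\mathrm{Aut}(X)$ is the group of bijections of $X$ preserving $d_X$ and all $f_i$, with the topology of pointwise convergence. Finitely generated substructures are regarded as enumerated by generators. For tuples $\bar b,\bar a$, $\mathrm{qftp}(\bar b/\bar a)$ is the set of quantifier-free formulas (built from terms using the function symbols including $d_X$, equality and relations) with parameters from $\bar a$ satisfied by $\bar b$; $\mathrm{qftp}(\bar b)=\mathrm{qftp}(\bar b/\emptyset)$; $\bar b\equiv_{\bar a}\bar c$ means $\mathrm{qftp}(\bar b/\bar a)=\mathrm{qftp}(\bar c/\bar a)$. For a quantifier-free type $p$, $p(X)$ is the set of its realizations. Locally finite automorphisms: for every finitely generated substructure $N$ and finitely many partial automorphisms of $N$ (isomorphisms between substructures of $N$) there is a finitely generated substructure $N'\supseteq N$ to which each extends as an automorphism. For finitely generated $B,C$ and finitely generated $A\subseteq B\cap C$, $B\mathop{\perp}_A C$ means: for all automorphisms $\varphi$ of $B$, $\psi$ of $C$ with $A$ closed under both and $\varphi\restriction A=\psi\restriction A$, $\varphi\cup\psi$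 extends to an automorphism of the substructure generated by $B\cup C$. Extension property: for all such $A,B,C$ there is finitely generated $C'$ with $C'\equiv_A C$ and $B\mathop{\perp}_A C'$. For $\bar a\in X^k$ with $p=\mathrm{qftp}(\bar a)$, a set $N\subseteq X^k$ is relatively saturated over $\bar a$ if for every $\bar b\in p(X)$ there is $\bar b'\in N$ with $\mathrm{qftp}(\bar b'/\bar a)=\mathrm{qftp}(\bar b/\bar a)$. A sequence $(\bar a_n)$ in $X^k$ is an independent sequence in $p$ if every $\bar a_n$ realizes $p$ and there are sets $N_n$, each relatively saturated over $\bar a_n$, such that for every sequence $\bar b_n\in N_n$ with $\mathrm{qftp}(\bar b_n)=\mathrm{qftp}(\bar a_n)$ there is $\varphi\in\mathrm{Aut}(X)$ with $\varphi(\bar a_n)=\bar b_n$ for all $n$. $X$ admits independent sequences if for every $k$, every $\bar a\in X^k$ and every sequence $(\bar s_n)$ of finite tuples from $X$ there is an independent sequence $(\bar a_n)$ in $\mathrm{qftp}(\bar a)$ with $\bar a_{n+1}\equiv_{\bar s_n}\bar a_n$ for all $n$. *)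

theory Defs
  imports "HOL-Analysis.Analysis" "HOL-Algebra.Group"
begin

section \<open>Metric structures\<close>

text \<open>
  Tuples are lists. The space X is the universe of a type of class \<open>metric_space\<close> and its metric
  is \<open>dist\<close>. \<open>tuples n\<close> is the set of n-tuples with the product topology, transported to lists.
\<close>

definition tuples :: "nat \<Rightarrow> 'a::topological_space list topology" where
  "tuples n = pullback_topology {xs. length xs = n} (\<lambda>xs. \<lambda>i\<in>{..<n}. xs ! i)
                (product_topology (\<lambda>_. euclidean) {..<n})"

text \<open>
  \<open>Rel n m R\<close> is a relation R on \<open>X^n \<times> \<real>^m\<close>, and \<open>Fun n m k l f\<close> is a function f from
  \<open>X^n \<times> \<real>^m\<close> to \<open>X^k \<times> \<real>^l\<close>; the values of f at tuples of other lengths are irrelevant.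
\<close>

datatype 'a msymbol =
    Rel nat nat "('a list \<times> real list) set"
  | Fun nat nat nat nat "'a list \<times> real list \<Rightarrow> 'a list \<times> real list"

fun wf_symbol :: "'a::metric_space msymbol \<Rightarrow> bool" where
  "wf_symbol (Rel n m R) \<longleftrightarrow> closedin (prod_topology (tuples n) (tuples m)) R"
| "wf_symbol (Fun n m k l f) \<longleftrightarrow>
     (\<forall>rs. length rs = m \<longrightarrow>
        continuous_map (tuples n) (prod_topology (tuples k) (tuples l)) (\<lambda>xs. f (xs, rs)))"

text \<open>
  The structure \<open>(X, d, f 0, f 1, \<dots>)\<close> is given by the sequence of its symbols. A structure with
  finitely many symbols is covered by padding the sequence, e.g. with \<open>Rel 0 0 {}\<close>.
\<close>

type_synonym 'a mstruct = "nat \<Rightarrow> 'a msymbol"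

definition metric_structure :: "'a::metric_space mstruct \<Rightarrow> bool" where
  "metric_structure F \<longleftrightarrow> separable_space (euclidean :: 'a topology) \<and> (\<forall>i. wf_symbol (F i))"

definition complete_metric_structure :: "'a::metric_space mstruct \<Rightarrow> bool" where
  "complete_metric_structure F \<longleftrightarrow> metric_structure F \<and> complete (UNIV :: 'a set)"

section \<open>Substructures, isomorphisms and automorphisms\<close>

fun closed_under_symbol :: "'a msymbol \<Rightarrow> 'a set \<Rightarrow> bool" where
  "closed_under_symbol (Rel n m R) A \<longleftrightarrow> True"
| "closed_under_symbol (Fun n m k l f) A \<longleftrightarrow>
     (\<forall>xs rs. set xs \<subseteq> A \<and> length xs = n \<and> length rs = m \<longrightarrow> set (fst (f (xs, rs))) \<subseteq> A)"

definition substructure :: "'a mstruct \<Rightarrow> 'a set \<Rightarrow> bool" where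
  "substructure F A \<longleftrightarrow> (\<forall>i. closed_under_symbol (F i) A)"

definition gen :: "'a mstruct \<Rightarrow> 'a set \<Rightarrow> 'a set" where
  "gen F A = substructure F hull A"

definition finitely_generated :: "'a mstruct \<Rightarrow> 'a set \<Rightarrow> bool" where
  "finitely_generated F N \<longleftrightarrow> (\<exists>as. N = gen F (set as))"

fun preserves_symbol :: "'a msymbol \<Rightarrow> ('a \<Rightarrow> 'a) \<Rightarrow> 'a set \<Rightarrow> bool" where
  "preserves_symbol (Rel n m R) \<phi> A \<longleftrightarrow>
     (\<forall>xs rs. set xs \<subseteq> A \<and> length xs = n \<and> length rs = m \<longrightarrow>
        ((map \<phi> xs, rs) \<in> R \<longleftrightarrow> (xs, rs) \<in> R))"
| "preserves_symbol (Fun n m k l f) \<phi> A \<longleftrightarrow>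
     (\<forall>xs rs. set xs \<subseteq> A \<and> length xs = n \<and> length rs = m \<longrightarrow>
        f (map \<phi> xs, rs) = (map \<phi> (fst (f (xs, rs))), snd (f (xs, rs))))"

definition isomorphism :: "'a::metric_space mstruct \<Rightarrow> ('a \<Rightarrow> 'a) \<Rightarrow> 'a set \<Rightarrow> 'a set \<Rightarrow> bool" where
  "isomorphism F \<phi> A B \<longleftrightarrow>
     bij_betw \<phi> A B \<and> (\<forall>x\<in>A. \<forall>y\<in>A. dist (\<phi> x) (\<phi> y) = dist x y) \<and>
     (\<forall>i. preserves_symbol (F i) \<phi> A)"

definition Aut :: "'a::metric_space mstruct \<Rightarrow> ('a \<Rightarrow> 'a) monoid" where
  "Aut F = \<lparr>carrier = {\<phi>. isomorphism F \<phi> UNIV UNIV}, mult = (\<circ>), one = id\<rparr>"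

section \<open>Quantifier-free types\<close>

text \<open>
  Terms come in two sorts, X and the reals. In a formula \<open>Var i\<close> stands for the i-th entry of the
  tuple whose type is taken, and \<open>Par a\<close> is a parameter from X. Every real number may fill a real
  argument (\<open>Const\<close>); this is what makes a quantifier-free type determine, e.g., the actual
  distances between the entries of the tuple. \<open>XApp i j\<close> and \<open>RApp i j\<close> are the j-th X-valued and
  the j-th real-valued coordinate of the function symbol i.
\<close>

datatype 'a xterm =
    Var nat
  | Par 'a
  | XApp nat nat "'a xterm list" "'a rterm list"
and 'a rterm =
    Const real
  | Dist "'a xterm" "'a xterm"
  | RApp nat nat "'a xterm list" "'a rterm list"

datatype 'a qf =
    EqX "'a xterm" "'a xterm"
  | EqR "'a rterm" "'a rterm"
  | Atom nat "'a xterm list" "'a rterm list"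
  | Neg "'a qf"
  | Conj "'a qf" "'a qf"

fun apply_symbol :: "'a msymbol \<Rightarrow> 'a list \<times> real list \<Rightarrow> 'a list \<times> real list" where
  "apply_symbol (Fun n m k l f) z = f z"
| "apply_symbol (Rel n m R) z = ([], [])"

fun in_symbol :: "'a msymbol \<Rightarrow> 'a list \<times> real list \<Rightarrow> bool" where
  "in_symbol (Rel n m R) z \<longleftrightarrow> z \<in> R"
| "in_symbol (Fun n m k l f) z \<longleftrightarrow> False"

text \<open>\<open>wf_xterm F v A t\<close>: t respects the arities, its variables are below v, and its parameters
  are in A.\<close>

primrec wf_xterm :: "'a mstruct \<Rightarrow> nat \<Rightarrow> 'a set \<Rightarrow> 'a xterm \<Rightarrow> bool"
  and wf_rterm :: "'a mstruct \<Rightarrow> nat \<Rightarrow> 'a set \<Rightarrow> 'a rterm \<Rightarrow> bool" where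
  "wf_xterm F v A (Var i) \<longleftrightarrow> i < v"
| "wf_xterm F v A (Par a) \<longleftrightarrow> a \<in> A"
| "wf_xterm F v A (XApp i j ts us) \<longleftrightarrow>
     (\<exists>k l f. F i = Fun (length ts) (length us) k l f \<and> j < k) \<and>
     list_all (wf_xterm F v A) ts \<and> list_all (wf_rterm F v A) us"
| "wf_rterm F v A (Const r) \<longleftrightarrow> True"
| "wf_rterm F v A (Dist s t) \<longleftrightarrow> wf_xterm F v A s \<and> wf_xterm F v A t"
| "wf_rterm F v A (RApp i j ts us) \<longleftrightarrow>
     (\<exists>k l f. F i = Fun (length ts) (length us) k l f \<and> j < l) \<and>
     list_all (wf_xterm F v A) ts \<and> list_all (wf_rterm F v A) us"

primrec wf_qf :: "'a mstruct \<Rightarrow> nat \<Rightarrow> 'a set \<Rightarrow> 'a qf \<Rightarrow> bool" where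
  "wf_qf F v A (EqX s t) \<longleftrightarrow> wf_xterm F v A s \<and> wf_xterm F v A t"
| "wf_qf F v A (EqR s t) \<longleftrightarrow> wf_rterm F v A s \<and> wf_rterm F v A t"
| "wf_qf F v A (Atom i ts us) \<longleftrightarrow>
     (\<exists>R. F i = Rel (length ts) (length us) R) \<and>
     list_all (wf_xterm F v A) ts \<and> list_all (wf_rterm F v A) us"
| "wf_qf F v A (Neg p) \<longleftrightarrow> wf_qf F v A p"
| "wf_qf F v A (Conj p q) \<longleftrightarrow> wf_qf F v A p \<and> wf_qf F v A q"

primrec xval :: "'a::metric_space mstruct \<Rightarrow> 'a list \<Rightarrow> 'a xterm \<Rightarrow> 'a"
  and rval :: "'a::metric_space mstruct \<Rightarrow> 'a list \<Rightarrow> 'a rterm \<Rightarrow> real" where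
  "xval F b (Var i) = b ! i"
| "xval F b (Par a) = a"
| "xval F b (XApp i j ts us) =
     fst (apply_symbol (F i) (map (xval F b) ts, map (rval F b) us)) ! j"
| "rval F b (Const r) = r"
| "rval F b (Dist s t) = dist (xval F b s) (xval F b t)"
| "rval F b (RApp i j ts us) =
     snd (apply_symbol (F i) (map (xval F b) ts, map (rval F b) us)) ! j"

primrec sat :: "'a::metric_space mstruct \<Rightarrow> 'a list \<Rightarrow> 'a qf \<Rightarrow> bool" where
  "sat F b (EqX s t) \<longleftrightarrow> xval F b s = xval F b t"
| "sat F b (EqR s t) \<longleftrightarrow> rval F b s = rval F b t"
| "sat F b (Atom i ts us) \<longleftrightarrow> in_symbol (F i) (map (xval F b) ts, map (rval F b) us)"
| "sat F b (Neg p) \<longleftrightarrow> \<not> sat F b p"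
| "sat F b (Conj p q) \<longleftrightarrow> sat F b p \<and> sat F b q"

text \<open>\<open>qftp F b a\<close> is qftp(b/a). Tuples with equal types have equal length, since \<open>EqX (Var i) (Var i)\<close>
  is in the type of b precisely when i is below the length of b.\<close>

definition qftp :: "'a::metric_space mstruct \<Rightarrow> 'a list \<Rightarrow> 'a list \<Rightarrow> 'a qf set" where
  "qftp F b a = {p. wf_qf F (length b) (set a) p \<and> sat F b p}"

definition realizations :: "'a::metric_space mstruct \<Rightarrow> nat \<Rightarrow> 'a qf set \<Rightarrow> 'a list set" where
  "realizations F k p = {b. length b = k \<and> (\<forall>q\<in>p. sat F b q)}"

section \<open>Hypotheses on the structure\<close>

definition locally_finite_automorphisms :: "'a::metric_space mstruct \<Rightarrow> bool" where
  "locally_finite_automorphisms F \<longleftrightarrow>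
     (\<forall>N P. finitely_generated F N \<and> finite P \<and>
        (\<forall>(A, \<phi>)\<in>P. substructure F A \<and> A \<subseteq> N \<and>
           substructure F (\<phi> ` A) \<and> \<phi> ` A \<subseteq> N \<and> isomorphism F \<phi> A (\<phi> ` A)) \<longrightarrow>
        (\<exists>N'. finitely_generated F N' \<and> N \<subseteq> N' \<and>
           (\<forall>(A, \<phi>)\<in>P. \<exists>\<psi>. isomorphism F \<psi> N' N' \<and> (\<forall>x\<in>A. \<psi> x = \<phi> x))))"

text \<open>\<open>indep F B A C\<close>: B and C are independent over A.\<close>

definition indep :: "'a::metric_space mstruct \<Rightarrow> 'a set \<Rightarrow> 'a set \<Rightarrow> 'a set \<Rightarrow> bool" where
  "indep F B A C \<longleftrightarrow>
     (\<forall>\<phi> \<psi>. isomorphism F \<phi> B B \<and> isomorphism F \<psi> C C \<and>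
        \<phi> ` A \<subseteq> A \<and> \<psi> ` A \<subseteq> A \<and> (\<forall>x\<in>A. \<phi> x = \<psi> x) \<longrightarrow>
        (\<exists>\<theta>. isomorphism F \<theta> (gen F (B \<union> C)) (gen F (B \<union> C)) \<and>
           (\<forall>x\<in>B. \<theta> x = \<phi> x) \<and> (\<forall>x\<in>C. \<theta> x = \<psi> x)))"

text \<open>Finitely generated substructures are enumerated by generating tuples, here a, b, c and c'.\<close>

definition extension_property :: "'a::metric_space mstruct \<Rightarrow> bool" where
  "extension_property F \<longleftrightarrow>
     (\<forall>a b c. gen F (set a) \<subseteq> gen F (set b) \<inter> gen F (set c) \<longrightarrow>
        (\<exists>c'. qftp F c' a = qftp F c a \<and>
           indep F (gen F (set b)) (gen F (set a)) (gen F (set c'))))"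

definition relatively_saturated ::
  "'a::metric_space mstruct \<Rightarrow> 'a list \<Rightarrow> 'a list set \<Rightarrow> bool" where
  "relatively_saturated F a N \<longleftrightarrow>
     N \<subseteq> {x. length x = length a} \<and>
     (\<forall>b\<in>realizations F (length a) (qftp F a []). \<exists>b'\<in>N. qftp F b' a = qftp F b a)"

definition independent_sequence ::
  "'a::metric_space mstruct \<Rightarrow> nat \<Rightarrow> 'a qf set \<Rightarrow> (nat \<Rightarrow> 'a list) \<Rightarrow> bool" where
  "independent_sequence F k p a \<longleftrightarrow>
     (\<forall>n. a n \<in> realizations F k p) \<and>
     (\<exists>N. (\<forall>n. relatively_saturated F (a n) (N n)) \<and>
        (\<forall>b. (\<forall>n. b n \<in> N n \<and> qftp F (b n) [] = qftp F (a n) []) \<longrightarrow>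
           (\<exists>\<phi>\<in>carrier (Aut F). \<forall>n. map \<phi> (a n) = b n)))"

definition admits_independent_sequences :: "'a::metric_space mstruct \<Rightarrow> bool" where
  "admits_independent_sequences F \<longleftrightarrow>
     (\<forall>k a s. length a = k \<longrightarrow>
        (\<exists>as. independent_sequence F k (qftp F a []) as \<and>
           (\<forall>n. qftp F (as (Suc n)) (s n) = qftp F (as n) (s n))))"

section \<open>Polish groups\<close>

definition topological_group :: "('h, 'm) monoid_scheme \<Rightarrow> 'h topology \<Rightarrow> bool" where
  "topological_group H T \<longleftrightarrow>
     group H \<and> topspace T = carrier H \<and>
     continuous_map (prod_topology T T) T (\<lambda>(x, y). x \<otimes>\<^bsub>H\<^esub> y) \<and>
     continuous_map T T (\<lambda>x. inv\<^bsub>H\<^esub> x)"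

definition polish_group :: "('h, 'm) monoid_scheme \<Rightarrow> 'h topology \<Rightarrow> bool" where
  "polish_group H T \<longleftrightarrow>
     topological_group H T \<and> separable_space T \<and> completely_metrizable_space T"

definition admits_complete_left_invariant_metric ::
  "('h, 'm) monoid_scheme \<Rightarrow> 'h topology \<Rightarrow> bool" where
  "admits_complete_left_invariant_metric H T \<longleftrightarrow>
     (\<exists>d. Metric_space (carrier H) d \<and> Metric_space.mtopology (carrier H) d = T \<and>
        Metric_space.mcomplete (carrier H) d \<and>
        (\<forall>g\<in>carrier H. \<forall>x\<in>carrier H. \<forall>y\<in>carrier H. d (g \<otimes>\<^bsub>H\<^esub> x) (g \<otimes>\<^bsub>H\<^esub> y) = d x y))"

end

theory Submission
  imports Defs
begin

text \<open>
  Local finiteness and completeness make X homogeneous: an isomorphism between finitely generated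
  substructures is extended along a chain of finitely generated substructures with dense union.
  Around a given automorphism, a Loewenheim-Skolem argument then yields a countable group K of
  automorphisms and a countable directed K-invariant family \<open>\<A>\<close> of finitely generated substructures
  that inherit local finiteness and the extension property. The closure G of K under pointwise limits
  on members of \<open>\<A>\<close> is a non-archimedean Polish group with ample generics.

  Ample generics make h continuous on G. Let \<open>k\<^sub>n W\<close> be countably many translates of
  \<open>W = {g. d (h g) 1 < \<delta>}\<close> covering G. One of them is nonmeager, so \<open>W\<^sup>2\<close> is nonmeager everywhere in
  the stabilizer of some \<open>N\<^sub>0 \<in> \<A>\<close>. For g in that stabilizer one builds generic sequences
  \<open>a\<^sub>n \<in> W\<^sup>2\<close> and \<open>c\<^sub>n \<in> k\<^sub>n g W\<^sup>2 k\<^sub>n\<^sup>-\<^sup>1\<close> together with one \<open>\<theta> \<in> G\<close> conjugating every \<open>a\<^sub>n\<close> to \<open>c\<^sub>n\<close>.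
  Since \<open>\<theta> \<in> k\<^sub>n W\<close> for some n, this puts g into \<open>W\<^sup>6\<close>.

  Finally let t be generic. By saturation there are \<open>f\<^sub>n \<in> K\<close>, with \<open>f\<^sub>n\<^sub>+\<^sub>1\<close> extending the restriction of \<open>f\<^sub>n\<close>
  to a large \<open>N\<^sub>n \<in> \<A>\<close>, such that t fixes the image of \<open>N\<^sub>n\<close> under \<open>f\<^sub>n\<close> pointwise. The sequence \<open>h f\<^sub>n\<close>
  is left Cauchy, hence convergent, while \<open>h (f\<^sub>n\<^sup>-\<^sup>1 t f\<^sub>n)\<close> tends to 1; therefore \<open>h t = 1\<close>. Generic
  elements are dense in G, so h is trivial on G.
\<close>

section \<open>Baire category in a countable approximation\<close>

text \<open>Genericity needs exact agreement on finitely generated substructures, a topology finer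
  than pointwise convergence in the metric. On all of Aut(X) it need not be second countable, as
  there may be uncountably many such substructures, whereas the category arguments enumerate basic
  open sets. Hence a separate skeleton around each automorphism: only triviality of h at that
  automorphism is wanted from it. Members of \<A> may be uncountable sets; what is countable is the
  family \<A> and the group K, and these index the basic open sets of G.

  The target group enters the abstract part only through L g = d (h g) 1. Left invariance makes L
  symmetric and subadditive, separability covers G by countably many translates of each ball of L,
  and completeness is used only in the last argument, for one convergent sequence. No regularity of
  L is given at the start. The difficulty is that a limit conjugating two generic sequences cannot
  be steered into a prescribed translate of a ball; the construction therefore serves all translates
  at once, one coordinate for each.\<close>

text \<open>The bare notation \<open>inv\<close> clashes with the group inverse of HOL-Algebra.\<close>

abbreviation inv_fun :: "('a \<Rightarrow> 'a) \<Rightarrow> 'a \<Rightarrow> 'a" where "inv_fun \<equiv> inv_into UNIV"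

text \<open>G is the closure of K in the topology of pointwise agreement on members of \<open>\<A>\<close>; \<open>E0\<close> is the least
  member, the substructure generated by the empty set.\<close>

locale skeleton =
  fixes G K :: "('a \<Rightarrow> 'a) set" and \<A> :: "'a set set" and E0 :: "'a set"
  assumes G_id: "id \<in> G"
    and G_comp: "\<And>f g. f \<in> G \<Longrightarrow> g \<in> G \<Longrightarrow> f \<circ> g \<in> G"
    and G_inv: "\<And>g. g \<in> G \<Longrightarrow> inv_fun g \<in> G"
    and G_bij: "\<And>g. g \<in> G \<Longrightarrow> bij g"
    and K_sub: "K \<subseteq> G"
    and K_id: "id \<in> K"
    and K_comp: "\<And>f g. f \<in> K \<Longrightarrow> g \<in> K \<Longrightarrow> f \<circ> g \<in> K"
    and K_inv: "\<And>g. g \<in> K \<Longrightarrow> inv_fun g \<in> K"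
    and K_countable: "countable K"
    and \<A>_countable: "countable \<A>"
    and K_dense: "\<And>g N. g \<in> G \<Longrightarrow> N \<in> \<A> \<Longrightarrow> \<exists>k\<in>K. \<forall>x\<in>N. g x = k x"
    and K_image: "\<And>k N. k \<in> K \<Longrightarrow> N \<in> \<A> \<Longrightarrow> k ` N \<in> \<A>"
    and directed: "\<And>M N. M \<in> \<A> \<Longrightarrow> N \<in> \<A> \<Longrightarrow> \<exists>L\<in>\<A>. M \<union> N \<subseteq> L"
    and E0: "E0 \<in> \<A>" "\<And>N. N \<in> \<A> \<Longrightarrow> E0 \<subseteq> N" "\<And>k x. k \<in> K \<Longrightarrow> x \<in> E0 \<Longrightarrow> k x = x"
    and complete: "\<And>\<theta> A. (\<And>n. \<theta> n \<in> G) \<Longrightarrow> (\<And>n. A n \<in> \<A>) \<Longrightarrow> (\<And>n. A n \<subseteq> A (Suc n)) \<Longrightarrow>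
        (\<And>n x. x \<in> A n \<Longrightarrow> \<theta> (Suc n) x = \<theta> n x) \<Longrightarrow>
        (\<And>N. N \<in> \<A> \<Longrightarrow> \<exists>n. N \<subseteq> A n) \<Longrightarrow> (\<And>N. N \<in> \<A> \<Longrightarrow> \<exists>n. N \<subseteq> \<theta> n ` A n) \<Longrightarrow>
        \<exists>g\<in>G. \<forall>n. \<forall>x\<in>A n. g x = \<theta> n x"
    and determined: "\<And>f g. f \<in> G \<Longrightarrow> g \<in> G \<Longrightarrow> (\<And>N x. N \<in> \<A> \<Longrightarrow> x \<in> N \<Longrightarrow> f x = g x) \<Longrightarrow> f = g"
    and locally_finite: "\<And>N g (n::nat). N \<in> \<A> \<Longrightarrow> (\<And>i. i < n \<Longrightarrow> g i \<in> K) \<Longrightarrow>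
        \<exists>N'\<in>\<A>. \<exists>g'. N \<subseteq> N' \<and> (\<forall>i<n. g' i \<in> K \<and> g' i ` N' = N' \<and> (\<forall>x\<in>N. g' i x = g i x))"
    and extension: "\<And>A B C. A \<in> \<A> \<Longrightarrow> B \<in> \<A> \<Longrightarrow> C \<in> \<A> \<Longrightarrow> A \<subseteq> B \<Longrightarrow> A \<subseteq> C \<Longrightarrow>
        \<exists>u\<in>K. (\<forall>x\<in>A. u x = x) \<and>
          (\<forall>f\<in>K. \<forall>g\<in>K. f ` B = B \<and> g ` u ` C = u ` C \<and> f ` A = A \<and> (\<forall>x\<in>A. f x = g x) \<longrightarrow>
             (\<exists>e\<in>K. (\<forall>x\<in>B. e x = f x) \<and> (\<forall>x\<in>u ` C. e x = g x)))"
begin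

lemma inv_o: "g \<in> G \<Longrightarrow> inv_fun g \<circ> g = id" "g \<in> G \<Longrightarrow> g \<circ> inv_fun g = id"
  using G_bij[of g] by (simp_all add: bij_is_inj bij_is_surj surj_iff[symmetric] inj_iff[symmetric])

lemma inv_app [simp]: "g \<in> G \<Longrightarrow> inv_fun g (g x) = x" "g \<in> G \<Longrightarrow> g (inv_fun g x) = x"
  using inv_o[of g] by (metis comp_apply id_apply)+

lemma KG: "k \<in> K \<Longrightarrow> k \<in> G"
  using K_sub by blast

lemma G_image: "g \<in> G \<Longrightarrow> N \<in> \<A> \<Longrightarrow> g ` N \<in> \<A>"
  by (metis K_dense K_image image_cong)

lemma \<A>_enum: obtains E :: "nat \<Rightarrow> 'a set" where "range E = \<A>" "\<And>n. E n \<in> \<A>"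
  using \<A>_countable E0(1) by (metis range_from_nat_into empty_iff from_nat_into)

definition open_dense :: "('a \<Rightarrow> 'a) set \<Rightarrow> bool" where
  "open_dense U \<longleftrightarrow> U \<subseteq> G \<and>
     (\<forall>g\<in>U. \<exists>N\<in>\<A>. \<forall>f\<in>G. (\<forall>x\<in>N. f x = g x) \<longrightarrow> f \<in> U) \<and>
     (\<forall>g\<in>G. \<forall>N\<in>\<A>. \<exists>f\<in>U. \<forall>x\<in>N. f x = g x)"

text \<open>Not meager in the basic open set of all s that agree with g on N. Testing against dense
  open subsets of the whole group is no restriction: a set that is meager in an open subset is
  meager in G.\<close>

definition nonmeager :: "('a \<Rightarrow> 'a) set \<Rightarrow> ('a \<Rightarrow> 'a) \<Rightarrow> 'a set \<Rightarrow> bool" where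
  "nonmeager S g N \<longleftrightarrow>
     (\<forall>\<U>. countable \<U> \<and> (\<forall>U\<in>\<U>. open_dense U) \<longrightarrow> (\<exists>s\<in>S. (\<forall>x\<in>N. s x = g x) \<and> (\<forall>U\<in>\<U>. s \<in> U)))"

definition everywhere_nonmeager :: "('a \<Rightarrow> 'a) set \<Rightarrow> ('a \<Rightarrow> 'a) \<Rightarrow> 'a set \<Rightarrow> bool" where
  "everywhere_nonmeager S g N \<longleftrightarrow>
     (\<forall>f\<in>G. \<forall>M\<in>\<A>. N \<subseteq> M \<and> (\<forall>x\<in>N. f x = g x) \<longrightarrow> nonmeager S f M)"

lemma nonmeager_cong: "nonmeager S g N \<Longrightarrow> (\<And>x. x \<in> N \<Longrightarrow> f x = g x) \<Longrightarrow> nonmeager S f N"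
  unfolding nonmeager_def by metis

lemma nonmeager_mono: "nonmeager S g N \<Longrightarrow> S \<subseteq> S' \<Longrightarrow> nonmeager S' g N"
  unfolding nonmeager_def by (meson subsetD)

text \<open>Two-sided translation is a homeomorphism: agreement of
  \<open>u \<circ> g \<circ> v\<close> on N is governed by agreement of g on the image of N under
  v.\<close>

lemma open_dense_translate:
  assumes "open_dense U" "u \<in> G" "v \<in> G"
  shows "open_dense {g\<in>G. u \<circ> g \<circ> v \<in> U}"
  unfolding open_dense_def
proof (intro conjI ballI)
  show "{g\<in>G. u \<circ> g \<circ> v \<in> U} \<subseteq> G" by auto
next
  fix g assume g: "g \<in> {g\<in>G. u \<circ> g \<circ> v \<in> U}"
  then obtain N where N: "N \<in> \<A>" "\<forall>f\<in>G. (\<forall>x\<in>N. f x = (u \<circ> g \<circ> v) x) \<longrightarrow> f \<in> U"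
    using assms(1) unfolding open_dense_def by blast
  show "\<exists>N\<in>\<A>. \<forall>f\<in>G. (\<forall>x\<in>N. f x = g x) \<longrightarrow> f \<in> {g\<in>G. u \<circ> g \<circ> v \<in> U}"
  proof (intro bexI ballI impI)
    show "v ` N \<in> \<A>" using G_image assms N by blast
    fix f assume "f \<in> G" "\<forall>x\<in>v ` N. f x = g x"
    then show "f \<in> {g\<in>G. u \<circ> g \<circ> v \<in> U}"
      using N(2)[rule_format, of "u \<circ> f \<circ> v"] assms by (simp add: G_comp)
  qed
next
  fix g N assume g: "g \<in> G" "N \<in> \<A>"
  then have "u \<circ> g \<circ> v \<in> G" "inv_fun v ` N \<in> \<A>"
    using assms by (simp_all add: G_comp G_inv G_image)
  then obtain f where f: "f \<in> U" "\<forall>x\<in>inv_fun v ` N. f x = (u \<circ> g \<circ> v) x"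
    using assms(1) unfolding open_dense_def by meson
  have fG: "f \<in> G" using f assms(1) unfolding open_dense_def by blast
  show "\<exists>f\<in>{g\<in>G. u \<circ> g \<circ> v \<in> U}. \<forall>x\<in>N. f x = g x"
  proof (intro bexI ballI)
    have "u \<circ> (inv_fun u \<circ> f \<circ> inv_fun v) \<circ> v = f"
      using assms by (auto simp: fun_eq_iff)
    then show "inv_fun u \<circ> f \<circ> inv_fun v \<in> {g\<in>G. u \<circ> g \<circ> v \<in> U}"
      using f assms fG by (simp add: G_comp G_inv)
    show "(inv_fun u \<circ> f \<circ> inv_fun v) x = g x" if "x \<in> N" for x
      using f(2) assms that by auto
  qed
qed

lemma nonmeager_translate:
  assumes "nonmeager S g N" "S \<subseteq> G" "u \<in> G" "v \<in> G"
  shows "nonmeager {u \<circ> s \<circ> v |s. s \<in> S} (u \<circ> g \<circ> v) (inv_fun v ` N)"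
  unfolding nonmeager_def
proof (intro allI impI, elim conjE)
  fix \<U> assume U: "countable \<U>" "\<forall>U\<in>\<U>. open_dense U"
  let ?V = "(\<lambda>U. {g\<in>G. u \<circ> g \<circ> v \<in> U}) ` \<U>"
  have "countable ?V" "\<forall>V\<in>?V. open_dense V"
    using U open_dense_translate assms by auto
  then obtain s where "s \<in> S" "\<forall>x\<in>N. s x = g x" "\<forall>V\<in>?V. s \<in> V"
    using assms(1) unfolding nonmeager_def by meson
  moreover from this have "\<forall>U\<in>\<U>. u \<circ> s \<circ> v \<in> U" by simp
  moreover have "(u \<circ> s \<circ> v) x = (u \<circ> g \<circ> v) x" if "x \<in> inv_fun v ` N" for x
    using that \<open>\<forall>x\<in>N. s x = g x\<close> assms(4) by auto
  ultimately show "\<exists>s\<in>{u \<circ> s \<circ> v |s. s \<in> S}. (\<forall>x\<in>inv_fun v ` N. s x = (u \<circ> g \<circ> v) x) \<and> (\<forall>U\<in>\<U>. s \<in> U)"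
    by (intro bexI[of _ "u \<circ> s \<circ> v"]) blast+
qed

text \<open>A nested sequence of basic open sets (\<theta>, A). Besides entering the n-th dense open
  set, each step absorbs the n-th member of \<A> both into A and into the image of A under \<theta>:
  \<open>complete\<close> asks for both, since the limit must again be invertible.\<close>

lemma baire:
  assumes "g \<in> G" "N \<in> \<A>"
  shows "nonmeager G g N"
  unfolding nonmeager_def
proof (intro allI impI, elim conjE)
  fix \<U> assume U: "countable \<U>" "\<forall>U\<in>\<U>. open_dense U"
  have Gd: "open_dense G"
    unfolding open_dense_def using E0(1) by blast
  \<comment> \<open>G is added so that the family can be enumerated even if \<U> is empty.\<close>
  obtain V :: "nat \<Rightarrow> ('a \<Rightarrow> 'a) set" where V: "range V = insert G \<U>"
    using U(1) range_from_nat_into[of "insert G \<U>"] by blast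
  have Vd: "open_dense (V n)" for n::nat
    using V U(2) Gd by (metis insert_iff rangeI)
  obtain E :: "nat \<Rightarrow> 'a set" where E: "range E = \<A>" "\<And>n. E n \<in> \<A>"
    using \<A>_enum by blast
  define P where "P = (\<lambda>(n::nat) (\<theta>, A). \<theta> \<in> G \<and> A \<in> \<A> \<and> N \<subseteq> A)"
  define R where "R = (\<lambda>n (\<theta>, A) (\<theta>', A'). A \<subseteq> A' \<and> (\<forall>x\<in>A. \<theta>' x = \<theta> x) \<and> E n \<subseteq> A' \<and> E n \<subseteq> \<theta>' ` A' \<and>
                 (\<forall>f\<in>G. (\<forall>x\<in>A'. f x = \<theta>' x) \<longrightarrow> f \<in> V n))"
  have step: "\<exists>y. P (Suc n) y \<and> R n x y" if "P n x" for x n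
  proof -
    obtain \<theta> A where x: "x = (\<theta>, A)" by force
    have \<theta>: "\<theta> \<in> G" "A \<in> \<A>" "N \<subseteq> A" using that by (auto simp: P_def x)
    obtain \<theta>' where \<theta>': "\<theta>' \<in> V n" "\<forall>x\<in>A. \<theta>' x = \<theta> x"
      using Vd[of n] \<theta> unfolding open_dense_def by blast
    then have G': "\<theta>' \<in> G" using Vd[of n] unfolding open_dense_def by blast
    obtain M where M: "M \<in> \<A>" "\<forall>f\<in>G. (\<forall>x\<in>M. f x = \<theta>' x) \<longrightarrow> f \<in> V n"
      using Vd[of n] \<theta>'(1) unfolding open_dense_def by blast
    obtain B where B: "B \<in> \<A>" "A \<union> M \<subseteq> B" using directed \<theta>(2) M(1) by blast
    \<comment> \<open>The preimage of E n goes into A', so that E n lies in the image of A'.\<close>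
    obtain B1 where B1: "B1 \<in> \<A>" "E n \<union> inv_fun \<theta>' ` E n \<subseteq> B1"
      using directed[of "E n" "inv_fun \<theta>' ` E n"] E(2) G_image G_inv G' by blast
    obtain A' where A': "A' \<in> \<A>" "B \<union> B1 \<subseteq> A'" using directed B(1) B1(1) by blast
    have "E n = \<theta>' ` inv_fun \<theta>' ` E n" using G' by (auto simp: image_image)
    also have "\<dots> \<subseteq> \<theta>' ` A'" using B1 A' by blast
    finally have "E n \<subseteq> \<theta>' ` A'" .
    moreover have "A \<subseteq> A'" "M \<subseteq> A'" "E n \<subseteq> A'" using A' B B1 by auto
    moreover have "\<forall>f\<in>G. (\<forall>x\<in>A'. f x = \<theta>' x) \<longrightarrow> f \<in> V n"
      using M(2) \<open>M \<subseteq> A'\<close> by (meson subsetD)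
    ultimately have "P (Suc n) (\<theta>', A') \<and> R n x (\<theta>', A')"
      unfolding P_def R_def x split using G' A'(1) \<theta>(3) \<theta>'(2) by blast
    then show ?thesis by blast
  qed
  have "P 0 (g, N)" using assms by (auto simp: P_def)
  \<comment> \<open>Dependent choice leaves the initial state open; it is pinned to (g, N) by adding
    a clause for n = 0 to the invariant.\<close>
  then obtain s where s: "s 0 = (g, N)" "\<And>n. P n (s n)" "\<And>n. R n (s n) (s (Suc n))"
    using dependent_nat_choice[of P R] step
    by (metis (no_types, lifting) dependent_nat_choice[of "\<lambda>n x. P n x \<and> (n = 0 \<longrightarrow> x = (g, N))" R] nat.simps(3))
  define \<theta> where "\<theta> n = fst (s n)" for n
  define A where "A n = snd (s n)" for n
  have sn: "s n = (\<theta> n, A n)" for n by (simp add: \<theta>_def A_def)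
  have P: "\<theta> n \<in> G" "A n \<in> \<A>" for n using s(2)[of n] by (auto simp: sn P_def)
  have R: "A n \<subseteq> A (Suc n)" "\<forall>x\<in>A n. \<theta> (Suc n) x = \<theta> n x" "E n \<subseteq> A (Suc n)" "E n \<subseteq> \<theta> (Suc n) ` A (Suc n)"
    "\<forall>f\<in>G. (\<forall>x\<in>A (Suc n). f x = \<theta> (Suc n) x) \<longrightarrow> f \<in> V n" for n
    using s(3)[of n] by (auto simp: sn R_def)
  have "\<exists>f\<in>G. \<forall>n. \<forall>x\<in>A n. f x = \<theta> n x"
  proof (rule complete)
    fix M assume "M \<in> \<A>"
    then obtain n where "M = E n" using E by blast
    then show "\<exists>n. M \<subseteq> A n" "\<exists>n. M \<subseteq> \<theta> n ` A n" using R by blast+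
  qed (use P R in auto)
  then obtain f where f: "f \<in> G" "\<forall>n. \<forall>x\<in>A n. f x = \<theta> n x" by blast
  have "f \<in> V n" for n using R(5)[of n] f by auto
  then have "\<forall>U\<in>\<U>. f \<in> U" using V by (metis insertCI rangeE)
  moreover have "\<forall>x\<in>N. f x = g x" using f(2) s(1) sn[of 0] by auto
  ultimately show "\<exists>s\<in>G. (\<forall>x\<in>N. s x = g x) \<and> (\<forall>U\<in>\<U>. s \<in> U)" using f(1) by blast
qed

text \<open>Otherwise the basic open sets in which S n is meager have a dense open union V n. Only
  countably many of them occur, as centres can be taken in K, so all their witnessing families can
  be intersected at once. A point g of the intersection lies in some S n and in V n, hence in a
  basic open set whose witnesses exclude g from S n.\<close>

lemma everywhere_nonmeager_cover:
  assumes "G \<subseteq> (\<Union>n::nat. S n)"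
  obtains n g N where "g \<in> G" "N \<in> \<A>" "everywhere_nonmeager (S n) g N"
proof (rule ccontr)
  assume "\<not> thesis"
  then have no: "\<not> everywhere_nonmeager (S n) g N" if "g \<in> G" "N \<in> \<A>" for n g N
    using that \<open>\<And>n g N. \<lbrakk>g \<in> G; N \<in> \<A>; everywhere_nonmeager (S n) g N\<rbrakk> \<Longrightarrow> thesis\<close> by blast
  define I where "I = {(n, k, N). k \<in> K \<and> N \<in> \<A> \<and> \<not> nonmeager (S n) k N}"
  have "\<forall>i\<in>I. \<exists>\<U>. countable \<U> \<and> (\<forall>U\<in>\<U>. open_dense U) \<and>
      \<not> (\<exists>s\<in>S (fst i). (\<forall>x\<in>snd (snd i). s x = fst (snd i) x) \<and> (\<forall>U\<in>\<U>. s \<in> U))"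
    unfolding I_def nonmeager_def by auto
  then obtain \<U> where U: "\<forall>i\<in>I. countable (\<U> i) \<and> (\<forall>U\<in>\<U> i. open_dense U) \<and>
      \<not> (\<exists>s\<in>S (fst i). (\<forall>x\<in>snd (snd i). s x = fst (snd i) x) \<and> (\<forall>U\<in>\<U> i. s \<in> U))"
    by (elim bchoice[THEN exE])
  define V where "V n = {g\<in>G. \<exists>k N. (n, k, N) \<in> I \<and> (\<forall>x\<in>N. g x = k x)}" for n
  have Vd: "open_dense (V n)" for n
    unfolding open_dense_def
  proof (intro conjI ballI)
    show "V n \<subseteq> G" by (auto simp: V_def)
  next
    fix g assume "g \<in> V n"
    then obtain k N where "(n, k, N) \<in> I" "\<forall>x\<in>N. g x = k x" by (auto simp: V_def)
    then show "\<exists>N\<in>\<A>. \<forall>f\<in>G. (\<forall>x\<in>N. f x = g x) \<longrightarrow> f \<in> V n"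
      by (intro bexI[of _ N]) (auto simp: V_def I_def)
  next
    fix g N assume "g \<in> G" "N \<in> \<A>"
    then obtain f M where f: "f \<in> G" "M \<in> \<A>" "N \<subseteq> M" "\<forall>x\<in>N. f x = g x" "\<not> nonmeager (S n) f M"
      using no[of g N n] unfolding everywhere_nonmeager_def by blast
    obtain k where k: "k \<in> K" "\<forall>x\<in>M. f x = k x" using K_dense f by blast
    then have "\<not> nonmeager (S n) k M" using f(5) nonmeager_cong by metis
    then have "f \<in> V n" using f k by (auto simp: V_def I_def)
    then show "\<exists>f\<in>V n. \<forall>x\<in>N. f x = g x" using f(4) by blast
  qed
  have "I \<subseteq> UNIV \<times> K \<times> \<A>" by (auto simp: I_def)
  then have Ic: "countable I"
    by (rule countable_subset) (use K_countable \<A>_countable in auto)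
  let ?W = "range V \<union> (\<Union>i\<in>I. \<U> i)"
  have "countable ?W"
    using Ic U by auto
  moreover have "\<forall>U\<in>?W. open_dense U" using Vd U by auto
  ultimately obtain g where g: "g \<in> G" "\<forall>U\<in>?W. g \<in> U"
    using baire[OF G_id E0(1)] unfolding nonmeager_def by meson
  obtain n where n: "g \<in> S n" using assms g(1) by blast
  have "g \<in> V n" using g by blast
  then obtain k N where kN: "(n, k, N) \<in> I" "\<forall>x\<in>N. g x = k x" by (auto simp: V_def)
  moreover have "\<forall>U\<in>\<U> (n, k, N). g \<in> U" using g(2) kN(1) by blast
  ultimately show False using U[rule_format, of "(n, k, N)"] n by auto
qed

section \<open>Generic tuples\<close>

lemma open_denseD: "open_dense U \<Longrightarrow> g \<in> G \<Longrightarrow> N \<in> \<A> \<Longrightarrow> \<exists>f\<in>U. \<forall>x\<in>N. f x = g x"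
  by (simp add: open_dense_def)

text \<open>The two nontrivial clauses: invariant members are cofinal, and every extension of a restriction
  of the tuple to a finitely generated system of automorphisms is realized inside the tuple.\<close>

definition generic :: "nat \<Rightarrow> (nat \<Rightarrow> 'a \<Rightarrow> 'a) \<Rightarrow> bool" where
  "generic n a \<longleftrightarrow> (\<forall>i<n. a i \<in> G) \<and>
     (\<forall>N\<in>\<A>. \<exists>M\<in>\<A>. N \<subseteq> M \<and> (\<forall>i<n. a i ` M = M)) \<and>
     (\<forall>N\<in>\<A>. \<forall>C\<in>\<A>. \<forall>b. N \<subseteq> C \<and> (\<forall>i<n. b i \<in> K \<and> b i ` C = C \<and> a i ` N = N \<and> (\<forall>x\<in>N. b i x = a i x)) \<longrightarrow>
        (\<exists>k\<in>K. (\<forall>x\<in>N. k x = x) \<and> (\<forall>i<n. \<forall>x\<in>C. a i (k x) = k (b i x))))"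

lemma generic_in_G: "generic n a \<Longrightarrow> i < n \<Longrightarrow> a i \<in> G"
  by (simp add: generic_def)

lemma generic_invariant:
  assumes "generic n a" "N \<in> \<A>"
  obtains M where "M \<in> \<A>" "N \<subseteq> M" "\<And>i. i < n \<Longrightarrow> a i ` M = M"
  using assms(1)[unfolded generic_def, THEN conjunct2, THEN conjunct1, rule_format, OF assms(2)] that by blast

lemma generic_saturated:
  assumes "generic n a" "N \<in> \<A>" "C \<in> \<A>" "N \<subseteq> C"
    and "\<And>i. i < n \<Longrightarrow> b i \<in> K" "\<And>i. i < n \<Longrightarrow> b i ` C = C" "\<And>i. i < n \<Longrightarrow> a i ` N = N"
    and "\<And>i x. i < n \<Longrightarrow> x \<in> N \<Longrightarrow> b i x = a i x"
  obtains k where "k \<in> K" "\<And>x. x \<in> N \<Longrightarrow> k x = x" "\<And>i x. i < n \<Longrightarrow> x \<in> C \<Longrightarrow> a i (k x) = k (b i x)"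
proof -
  have "N \<subseteq> C \<and> (\<forall>i<n. b i \<in> K \<and> b i ` C = C \<and> a i ` N = N \<and> (\<forall>x\<in>N. b i x = a i x))"
    using assms(4-) by simp
  from assms(1)[unfolded generic_def, THEN conjunct2, THEN conjunct2, THEN bspec, OF assms(2),
      THEN bspec, OF assms(3), THEN spec, THEN mp, OF this]
  have "\<exists>k\<in>K. (\<forall>x\<in>N. k x = x) \<and> (\<forall>i<n. \<forall>x\<in>C. a i (k x) = k (b i x))" .
  then show thesis using that by blast
qed

lemma generic_0: "generic 0 a"
  unfolding generic_def using K_id by (auto intro: bexI[of _ id])

lemma generic_cong: "generic n a \<Longrightarrow> (\<And>i. i < n \<Longrightarrow> b i = a i) \<Longrightarrow> generic n b"
  unfolding generic_def by (simp cong: conj_cong)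

section \<open>Genericity as countably many dense open conditions on the last entry\<close>

lemma conj_image:
  assumes "k \<in> K" "\<And>x. x \<in> C \<Longrightarrow> f (k x) = k (g x)" "g ` C = C"
  shows "f ` k ` C = k ` C"
  using assms(2,3) by (metis (no_types, lifting) image_cong image_image)

text \<open>Openness: only the values of g on M matter. Density: local finiteness extends the
  actions of a and g on an a-invariant M to automorphisms b' preserving some M'; saturation of a
  embeds (M', b') over M by some k, and the conjugate of b' n by k replaces g.\<close>

lemma open_dense_invariant:
  assumes "generic n a" "N \<in> \<A>"
  shows "open_dense {g\<in>G. \<exists>M\<in>\<A>. N \<subseteq> M \<and> (\<forall>i<Suc n. (a(n := g)) i ` M = M)}" (is "open_dense ?U")
  unfolding open_dense_def
proof (intro conjI ballI)
  show "?U \<subseteq> G" by auto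
next
  fix g assume "g \<in> ?U"
  then obtain M where "M \<in> \<A>" "N \<subseteq> M" "\<forall>i<Suc n. (a(n := g)) i ` M = M" by blast
  moreover have "f \<in> ?U" if "f \<in> G" "\<forall>x\<in>M. f x = g x" for f
  proof -
    have "f ` M = g ` M" using that(2) by force
    then have "\<forall>i<Suc n. (a(n := f)) i ` M = M" using calculation(3) by (metis fun_upd_apply)
    then show ?thesis using that(1) calculation(1,2) by (intro CollectI conjI bexI[of _ M])
  qed
  ultimately show "\<exists>M\<in>\<A>. \<forall>f\<in>G. (\<forall>x\<in>M. f x = g x) \<longrightarrow> f \<in> ?U"
    by (intro bexI[of _ M] ballI impI)
next
  fix g N1 assume g: "g \<in> G" "N1 \<in> \<A>"
  obtain N2 where N2: "N2 \<in> \<A>" "N \<union> N1 \<subseteq> N2" using directed[OF assms(2) g(2)] by blast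
  \<comment> \<open>The image of N2 under g is included so that k, which fixes M pointwise, fixes
    both x and g x for x in N1; conjugation by k then does not change the values of g on N1.\<close>
  obtain N3 where N3: "N3 \<in> \<A>" "N2 \<union> g ` N2 \<subseteq> N3" using directed N2 G_image g by blast
  obtain M where M: "M \<in> \<A>" "N3 \<subseteq> M" "\<And>i. i < n \<Longrightarrow> a i ` M = M"
    using generic_invariant[OF assms(1) N3(1)] by blast
  have "\<exists>k\<in>K. \<forall>x\<in>M. (a(n := g)) i x = k x" if "i < Suc n" for i
    using that K_dense[of "(a(n := g)) i" M] M g generic_in_G[OF assms(1)] by (auto simp: less_Suc_eq)
  then obtain b where b: "\<And>i. i < Suc n \<Longrightarrow> b i \<in> K \<and> (\<forall>x\<in>M. (a(n := g)) i x = b i x)"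
    by metis
  obtain M' b' where M': "M' \<in> \<A>" "M \<subseteq> M'"
    "\<And>i. i < Suc n \<Longrightarrow> b' i \<in> K \<and> b' i ` M' = M' \<and> (\<forall>x\<in>M. b' i x = b i x)"
    using locally_finite[of M "Suc n" b] M(1) b by blast
  obtain k where k: "k \<in> K" "\<And>x. x \<in> M \<Longrightarrow> k x = x" "\<And>i x. i < n \<Longrightarrow> x \<in> M' \<Longrightarrow> a i (k x) = k (b' i x)"
  proof (rule generic_saturated[OF assms(1) M(1) M'(1,2), of b'])
    fix i assume "i < n"
    then show "b' i \<in> K" "b' i ` M' = M'" "a i ` M = M" using M' M by auto
    show "b' i x = a i x" if "x \<in> M" for x
      using M'(3)[of i] b[of i] \<open>i < n\<close> that by auto
  qed blast
  let ?f = "k \<circ> b' n \<circ> inv_fun k"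
  have kG: "k \<in> G" using k KG by blast
  have "?f \<in> G" using k(1) M'(3)[of n] by (intro KG K_comp K_inv) auto
  moreover have "k ` M' \<in> \<A>" using k M' K_image by blast
  moreover have "N \<subseteq> k ` M'"
  proof
    fix x assume "x \<in> N"
    then have "x \<in> M" using N2 N3 M by auto
    then have "k x = x" using k(2) by blast
    then show "x \<in> k ` M'" using \<open>x \<in> M\<close> M'(2) by (metis image_eqI subsetD)
  qed
  moreover have "\<forall>i<Suc n. (a(n := ?f)) i ` k ` M' = k ` M'"
  proof (intro allI impI)
    fix i assume "i < Suc n"
    show "(a(n := ?f)) i ` k ` M' = k ` M'"
      by (rule conj_image[of k M' _ "b' i"]) (use k M'(3) kG \<open>i < Suc n\<close> in \<open>auto simp: less_Suc_eq\<close>)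
  qed
  ultimately have "?f \<in> ?U" by blast
  moreover have "\<forall>x\<in>N1. ?f x = g x"
  proof
    fix x assume "x \<in> N1"
    then have "x \<in> N2" using N2 by blast
    then have "x \<in> M" "g x \<in> M" using N3 M(2) by blast+
    then have "inv_fun k x = x" "k (g x) = g x" using k(2) kG by (metis inv_app(1))+
    moreover have "b' n x = g x" using M'(3)[of n] b[of n] \<open>x \<in> M\<close> by auto
    ultimately show "?f x = g x" by simp
  qed
  ultimately show "\<exists>f\<in>?U. \<forall>x\<in>N1. f x = g x" by blast
qed

text \<open>Amalgamation. Once B is invariant under the tuple, C is moved by u to a copy independent
  of B over N, so that the tuple on B and the transported b on the copy have common extensions e.
  Local finiteness lets these act on one E', and saturation of the old tuple embeds E' over B by v;
  the required k is \<open>v \<circ> u\<close>.\<close>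

lemma open_dense_saturated:
  assumes "generic n a" "N \<in> \<A>" "C \<in> \<A>" "N \<subseteq> C" and b: "\<And>i. i < Suc n \<Longrightarrow> b i \<in> K \<and> b i ` C = C"
    and bN: "\<And>i. i < n \<Longrightarrow> a i ` N = N \<and> (\<forall>x\<in>N. b i x = a i x)" "b n ` N = N"
  shows "open_dense {g\<in>G. (\<forall>x\<in>N. b n x = g x) \<longrightarrow>
     (\<exists>k\<in>K. (\<forall>x\<in>N. k x = x) \<and> (\<forall>i<Suc n. \<forall>x\<in>C. (a(n := g)) i (k x) = k (b i x)))}" (is "open_dense ?U")
  unfolding open_dense_def
proof (intro conjI ballI)
  show "?U \<subseteq> G" by auto
next
  fix g assume g: "g \<in> ?U"
  show "\<exists>M\<in>\<A>. \<forall>f\<in>G. (\<forall>x\<in>M. f x = g x) \<longrightarrow> f \<in> ?U"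
  proof (cases "\<forall>x\<in>N. b n x = g x")
    case True
    then obtain k where k: "k \<in> K" "\<forall>x\<in>N. k x = x" "\<forall>i<Suc n. \<forall>x\<in>C. (a(n := g)) i (k x) = k (b i x)"
      using g by blast
    have "f \<in> ?U" if "f \<in> G" "\<forall>x\<in>k ` C. f x = g x" for f
    proof -
      have "\<forall>i<Suc n. \<forall>x\<in>C. (a(n := f)) i (k x) = k (b i x)"
        using k(3) that(2) by (auto simp: less_Suc_eq)
      then show ?thesis using that(1) k(1,2) by blast
    qed
    moreover have "k ` C \<in> \<A>" using k K_image assms by blast
    ultimately show ?thesis by blast
  next
    case False
    \<comment> \<open>The condition is vacuous for every f that agrees with g on N.\<close>
    then show ?thesis using assms(2) by (intro bexI[of _ N]) auto
  qed
next
  fix g N0 assume g: "g \<in> G" "N0 \<in> \<A>"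
  obtain N1 where N1: "N1 \<in> \<A>" "N \<union> N0 \<subseteq> N1" using directed[OF assms(2) g(2)] by blast
  show "\<exists>f\<in>?U. \<forall>x\<in>N0. f x = g x"
  proof (cases "\<forall>x\<in>N. b n x = g x")
    case False
    then show ?thesis using g by blast
  next
    case True
    \<comment> \<open>Independence amalgamates automorphisms of B, so g is first perturbed outside
      N1 until some B above N1 is invariant under the whole tuple.\<close>
    obtain g' where g': "g' \<in> G" "\<exists>M\<in>\<A>. N1 \<subseteq> M \<and> (\<forall>i<Suc n. (a(n := g')) i ` M = M)" "\<forall>x\<in>N1. g' x = g x"
      using open_denseD[OF open_dense_invariant[OF assms(1) N1(1)] g(1) N1(1)] by blast
    then obtain B where B: "B \<in> \<A>" "N1 \<subseteq> B" "\<forall>i<Suc n. (a(n := g')) i ` B = B" by blast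
    let ?a = "a(n := g')"
    have aN: "?a i ` N = N \<and> (\<forall>x\<in>N. b i x = ?a i x)" if "i < Suc n" for i
    proof (cases "i = n")
      case i: True
      have "\<forall>x\<in>N. b n x = g' x" using True g'(3) N1 by (metis Un_subset_iff subsetD)
      then show ?thesis using bN(2) i by (metis fun_upd_same image_cong)
    next
      case False
      then show ?thesis using that bN(1) by auto
    qed
    have aG: "?a i \<in> G" if "i < Suc n" for i
      using generic_in_G[OF assms(1)] g' that by (auto simp: less_Suc_eq)
    have NB: "N \<subseteq> B" using N1 B by blast
    obtain u where u: "u \<in> K" "\<forall>x\<in>N. u x = x"
      and ext: "\<forall>f\<in>K. \<forall>g\<in>K. f ` B = B \<and> g ` u ` C = u ` C \<and> f ` N = N \<and> (\<forall>x\<in>N. f x = g x) \<longrightarrow>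
             (\<exists>e\<in>K. (\<forall>x\<in>B. e x = f x) \<and> (\<forall>x\<in>u ` C. e x = g x))"
      using extension[OF assms(2) B(1) assms(3) NB assms(4)] by (elim bexE conjE)
    have uG: "u \<in> G" using u KG by blast
    have "\<exists>e\<in>K. (\<forall>x\<in>B. e x = ?a i x) \<and> (\<forall>x\<in>C. e (u x) = u (b i x))" if i: "i < Suc n" for i
    proof -
      obtain f where f: "f \<in> K" "\<forall>x\<in>B. ?a i x = f x" using K_dense[OF aG[OF i] B(1)] by blast
      \<comment> \<open>The action of b i carried over to the copy of C; as u fixes N pointwise, it
        still agrees with the tuple on N.\<close>
      let ?h = "u \<circ> b i \<circ> inv_fun u"
      have uinv: "inv_fun u x = x" if "x \<in> N" for x using u(2) that uG by (metis inv_app(1))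
      have hK: "?h \<in> K" using u b[OF i] by (auto intro!: K_comp K_inv)
      have "f ` B = B \<and> ?h ` u ` C = u ` C \<and> f ` N = N \<and> (\<forall>x\<in>N. f x = ?h x)"
      proof (intro conjI ballI)
        show "f ` B = B" using f(2) B(3) i by (metis image_cong)
        show "?h ` u ` C = u ` C" using b[OF i] uG by (intro conj_image[of _ _ _ "b i"]) (auto simp: u)
        show "f ` N = N" using f(2) NB aN[OF i] by (metis image_cong subsetD)
        show "f x = ?h x" if "x \<in> N" for x
        proof -
          have "?a i x \<in> N" using aN[OF i] that by blast
          then show ?thesis using uinv[OF that] aN[OF i] that u(2) f(2) NB by auto
        qed
      qed
      from ext[THEN bspec, OF f(1), THEN bspec, OF hK, THEN mp, OF this] show ?thesis
        using f(2) uG by auto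
    qed
    then obtain e where e: "\<And>i. i < Suc n \<Longrightarrow> e i \<in> K \<and> (\<forall>x\<in>B. e i x = ?a i x) \<and> (\<forall>x\<in>C. e i (u x) = u (b i x))"
      by metis
    obtain E where E: "E \<in> \<A>" "B \<union> u ` C \<subseteq> E" using directed B(1) K_image u assms(3) by blast
    obtain E' e' where E': "E' \<in> \<A>" "E \<subseteq> E'"
      "\<And>i. i < Suc n \<Longrightarrow> e' i \<in> K \<and> e' i ` E' = E' \<and> (\<forall>x\<in>E. e' i x = e i x)"
      using locally_finite[of E "Suc n" e] E(1) e by blast
    have e'a: "e' i x = ?a i x" if "i < Suc n" "x \<in> B" for i x
      using E'(3)[OF that(1)] e[OF that(1)] that(2) E by auto
    obtain v where v: "v \<in> K" "\<And>x. x \<in> B \<Longrightarrow> v x = x" "\<And>i x. i < n \<Longrightarrow> x \<in> E' \<Longrightarrow> a i (v x) = v (e' i x)"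
    proof (rule generic_saturated[OF assms(1) B(1) E'(1), of e'])
      show "B \<subseteq> E'" using E E' by blast
      fix i assume i: "i < n"
      then show "e' i \<in> K" "e' i ` E' = E'" using E' by auto
      show "a i ` B = B" using B(3) i by (metis fun_upd_other less_SucI less_irrefl)
      show "e' i x = a i x" if "x \<in> B" for x using e'a[of i] that i by auto
    qed blast
    let ?f = "v \<circ> e' n \<circ> inv_fun v"
    have vG: "v \<in> G" using v KG by blast
    have fG: "?f \<in> G" using v(1) E'(3)[of n] by (intro KG K_comp K_inv) auto
    have fv: "(a(n := ?f)) i (v x) = v (e' i x)" if "i < Suc n" "x \<in> E'" for i x
      using that v(3) vG by (auto simp: less_Suc_eq)
    have "v \<circ> u \<in> K" using v u K_comp by blast
    moreover have "\<forall>x\<in>N. (v \<circ> u) x = x" using u(2) v(2) N1 B by auto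
    moreover have "\<forall>i<Suc n. \<forall>x\<in>C. (a(n := ?f)) i ((v \<circ> u) x) = (v \<circ> u) (b i x)"
    proof (intro allI impI ballI)
      fix i x assume i: "i < Suc n" and x: "x \<in> C"
      have "u x \<in> E" using x E by blast
      then have "(a(n := ?f)) i (v (u x)) = v (e' i (u x))" using fv i E' by blast
      also have "e' i (u x) = u (b i x)" using E'(3)[OF i] \<open>u x \<in> E\<close> e[OF i] x by auto
      finally show "(a(n := ?f)) i ((v \<circ> u) x) = (v \<circ> u) (b i x)" by (simp only: o_apply[of v u])
    qed
    ultimately have "?f \<in> ?U" using fG by blast
    moreover have "\<forall>x\<in>N0. ?f x = g x"
    proof
      fix x assume x: "x \<in> N0"
      then have xB: "x \<in> B" and gx: "g' x = g x" using N1 B g' by auto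
      have "g' x \<in> B" using xB B(3)[rule_format, of n] by auto
      moreover have "inv_fun v x = x" using v(2)[OF xB] vG by (metis inv_app(1))
      ultimately show "?f x = g x" using e'a[of n x] xB v(2) gx by auto
    qed
    ultimately show ?thesis by - (rule bexI[of _ ?f])
  qed
qed

text \<open>Each instance of the last two clauses of \<open>generic\<close> for the longer tuple is
  a dense open condition on its last entry, and there are countably many instances: the systems b
  are coded by lists over the countable K, of which only the first n + 1 entries matter.\<close>

lemma generic_extend:
  assumes "generic n a"
  obtains \<U> where "countable \<U>" "\<And>U. U \<in> \<U> \<Longrightarrow> open_dense U"
    "\<And>g. g \<in> G \<Longrightarrow> (\<And>U. U \<in> \<U> \<Longrightarrow> g \<in> U) \<Longrightarrow> generic (Suc n) (a(n := g))"
proof -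
  define U1 where "U1 N = {g\<in>G. \<exists>M\<in>\<A>. N \<subseteq> M \<and> (\<forall>i<Suc n. (a(n := g)) i ` M = M)}" for N
  define U2 where "U2 N C bs = {g\<in>G. (\<forall>x\<in>N. (bs ! n) x = g x) \<longrightarrow>
     (\<exists>k\<in>K. (\<forall>x\<in>N. k x = x) \<and> (\<forall>i<Suc n. \<forall>x\<in>C. (a(n := g)) i (k x) = k ((bs ! i) x)))}" for N C bs
  define I where "I = {(N, C, bs). N \<in> \<A> \<and> C \<in> \<A> \<and> N \<subseteq> C \<and> bs \<in> lists K \<and>
     (\<forall>i<Suc n. bs ! i \<in> K \<and> (bs ! i) ` C = C) \<and>
     (\<forall>i<n. a i ` N = N \<and> (\<forall>x\<in>N. (bs ! i) x = a i x)) \<and> (bs ! n) ` N = N}"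
  let ?\<U> = "U1 ` \<A> \<union> (\<lambda>(N, C, bs). U2 N C bs) ` I"
  show thesis
  proof (rule that)
    have "I \<subseteq> \<A> \<times> \<A> \<times> lists K" by (auto simp: I_def)
    then have "countable I"
      by (rule countable_subset) (use K_countable \<A>_countable in auto)
    then show "countable ?\<U>" using \<A>_countable by blast
    fix U assume "U \<in> ?\<U>"
    then consider N where "N \<in> \<A>" "U = U1 N" | N C bs where "(N, C, bs) \<in> I" "U = U2 N C bs" by auto
    then show "open_dense U"
    proof cases
      case 1
      then show ?thesis unfolding U1_def using open_dense_invariant[OF assms] by blast
    next
      case 2
      then show ?thesis unfolding 2(2) U2_def
        by (intro open_dense_saturated[OF assms, of N C "\<lambda>i. bs ! i"]) (auto simp: I_def)
    qed
  next
    fix g assume g: "g \<in> G" "\<And>U. U \<in> ?\<U> \<Longrightarrow> g \<in> U"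
    let ?a = "a(n := g)"
    show "generic (Suc n) ?a"
      unfolding generic_def
    proof (intro conjI ballI allI impI)
      show "?a i \<in> G" if "i < Suc n" for i
        using generic_in_G[OF assms] g that by (auto simp: less_Suc_eq)
    next
      fix N assume "N \<in> \<A>"
      then have "g \<in> U1 N" using g by blast
      then show "\<exists>M\<in>\<A>. N \<subseteq> M \<and> (\<forall>i<Suc n. ?a i ` M = M)" by (simp add: U1_def)
    next
      fix N C b assume N: "N \<in> \<A>" "C \<in> \<A>"
       and b: "N \<subseteq> C \<and> (\<forall>i<Suc n. b i \<in> K \<and> b i ` C = C \<and> ?a i ` N = N \<and> (\<forall>x\<in>N. b i x = ?a i x))"
      let ?bs = "map b [0..<Suc n]"
      have nth: "?bs ! i = b i" if "i < Suc n" for i using that by (simp del: upt_Suc)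
      have bi: "b i \<in> K" "b i ` C = C" if "i < Suc n" for i using b that by auto
      have bn: "\<forall>x\<in>N. b n x = g x" "g ` N = N" using b[THEN conjunct2, rule_format, of n] by auto
      then have "b n ` N = N" by (metis image_cong)
      moreover have "a i ` N = N \<and> (\<forall>x\<in>N. b i x = a i x)" if "i < n" for i
        using b that by (metis fun_upd_other less_SucI less_irrefl)
      moreover have "?bs \<in> lists K" using bi by auto
      ultimately have "(N, C, ?bs) \<in> I" unfolding I_def using N b bi nth by auto
      then have "g \<in> U2 N C ?bs" using g(2) by force
      then show "\<exists>k\<in>K. (\<forall>x\<in>N. k x = x) \<and> (\<forall>i<Suc n. \<forall>x\<in>C. ?a i (k x) = k (b i x))"
        unfolding U2_def using bn nth by auto
    qed
  qed
qed

lemma nonmeager_generic: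
  assumes "generic n a" "nonmeager S g N" "S \<subseteq> G"
  obtains s where "s \<in> S" "\<And>x. x \<in> N \<Longrightarrow> s x = g x" "generic (Suc n) (a(n := s))"
proof -
  obtain \<U> where \<U>: "countable \<U>" "\<And>U. U \<in> \<U> \<Longrightarrow> open_dense U"
    "\<And>g. g \<in> G \<Longrightarrow> (\<And>U. U \<in> \<U> \<Longrightarrow> g \<in> U) \<Longrightarrow> generic (Suc n) (a(n := g))"
    using generic_extend[OF assms(1)] by blast
  then obtain s where s: "s \<in> S" "\<forall>x\<in>N. s x = g x" "\<forall>U\<in>\<U>. s \<in> U"
    using assms(2) unfolding nonmeager_def by meson
  then show thesis using that[of s] \<U>(3)[of s] assms(3) by blast
qed

text \<open>The action of a on a larger invariant A' is transported by \<theta>; saturation of c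
  over the image of A then realizes it inside c by some k, and \<open>k \<circ> \<theta>\<close> is
  the extension.\<close>

lemma generic_forth:
  assumes "generic n a" "generic n c" "\<theta> \<in> K" "A \<in> \<A>" "E \<in> \<A>" and aA: "\<And>i. i < n \<Longrightarrow> a i ` A = A"
    and conj: "\<And>i x. i < n \<Longrightarrow> x \<in> A \<Longrightarrow> c i (\<theta> x) = \<theta> (a i x)"
  shows "\<exists>\<theta>'\<in>K. \<exists>A'\<in>\<A>. A \<subseteq> A' \<and> E \<subseteq> A' \<and> (\<forall>i<n. a i ` A' = A') \<and>
    (\<forall>x\<in>A. \<theta>' x = \<theta> x) \<and> (\<forall>i<n. \<forall>x\<in>A'. c i (\<theta>' x) = \<theta>' (a i x))"
proof -
  obtain L where L: "L \<in> \<A>" "A \<union> E \<subseteq> L" using directed[OF assms(4,5)] by blast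
  obtain A' where A': "A' \<in> \<A>" "L \<subseteq> A'" "\<And>i. i < n \<Longrightarrow> a i ` A' = A'"
    using generic_invariant[OF assms(1) L(1)] by blast
  have \<theta>G: "\<theta> \<in> G" using assms KG by blast
  have "\<exists>k\<in>K. \<forall>x\<in>A'. a i x = k x" if "i < n" for i
    using K_dense generic_in_G[OF assms(1) that] A' by blast
  then obtain b where b: "\<And>i. i < n \<Longrightarrow> b i \<in> K \<and> (\<forall>x\<in>A'. a i x = b i x)" by metis
  let ?b = "\<lambda>i. \<theta> \<circ> b i \<circ> inv_fun \<theta>"
  obtain k where k: "k \<in> K" "\<And>x. x \<in> \<theta> ` A \<Longrightarrow> k x = x"
    "\<And>i x. i < n \<Longrightarrow> x \<in> \<theta> ` A' \<Longrightarrow> c i (k x) = k (?b i x)"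
  proof (rule generic_saturated[OF assms(2), of "\<theta> ` A" "\<theta> ` A'" ?b])
    show "\<theta> ` A \<in> \<A>" "\<theta> ` A' \<in> \<A>" using assms A' K_image by auto
    show "\<theta> ` A \<subseteq> \<theta> ` A'" using L A' by blast
    fix i assume i: "i < n"
    show "?b i \<in> K" using b[OF i] assms by (auto intro!: K_comp K_inv)
    have "b i ` A' = A'" using A'(3)[OF i] b[OF i] by (metis image_cong)
    then show "?b i ` \<theta> ` A' = \<theta> ` A'"
      using \<theta>G assms(3) by (intro conj_image[of _ _ _ "b i"]) auto
    show "c i ` \<theta> ` A = \<theta> ` A" using conj aA i assms(3) by (intro conj_image[of _ _ _ "a i"]) auto
    show "?b i x = c i x" if "x \<in> \<theta> ` A" for x
      using that conj[OF i] \<theta>G b[OF i] L A' by auto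
  qed blast
  show ?thesis
  proof (intro bexI[of _ "k \<circ> \<theta>"] bexI[of _ A'] conjI allI ballI impI)
    show "k \<circ> \<theta> \<in> K" by (rule K_comp[OF k(1) assms(3)])
    fix i x assume "i < n" "x \<in> A'"
    then show "c i ((k \<circ> \<theta>) x) = (k \<circ> \<theta>) (a i x)"
      using k(3)[of i "\<theta> x"] \<theta>G b by auto
  qed (use A' L k in auto)
qed

text \<open>The second use of \<open>generic_forth\<close> exchanges a and c and extends the inverse
  of the first map; inverting its result brings E into the image as well.\<close>

lemma generic_back_and_forth:
  assumes "generic n a" "generic n c" "\<theta> \<in> K" "A \<in> \<A>" "E \<in> \<A>" and aA: "\<And>i. i < n \<Longrightarrow> a i ` A = A"
    and conj: "\<And>i x. i < n \<Longrightarrow> x \<in> A \<Longrightarrow> c i (\<theta> x) = \<theta> (a i x)"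
  shows "\<exists>\<theta>'\<in>K. \<exists>A'\<in>\<A>. A \<subseteq> A' \<and> E \<subseteq> A' \<and> E \<subseteq> \<theta>' ` A' \<and> (\<forall>i<n. a i ` A' = A') \<and>
    (\<forall>x\<in>A. \<theta>' x = \<theta> x) \<and> (\<forall>i<n. \<forall>x\<in>A'. c i (\<theta>' x) = \<theta>' (a i x))"
proof -
  obtain \<eta> B where B0: "\<eta> \<in> K" "B \<in> \<A>" "A \<subseteq> B \<and> E \<subseteq> B \<and> (\<forall>i<n. a i ` B = B) \<and>
    (\<forall>x\<in>A. \<eta> x = \<theta> x) \<and> (\<forall>i<n. \<forall>x\<in>B. c i (\<eta> x) = \<eta> (a i x))"
  proof -
    have "\<exists>\<theta>'\<in>K. \<exists>A'\<in>\<A>. A \<subseteq> A' \<and> E \<subseteq> A' \<and> (\<forall>i<n. a i ` A' = A') \<and>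
      (\<forall>x\<in>A. \<theta>' x = \<theta> x) \<and> (\<forall>i<n. \<forall>x\<in>A'. c i (\<theta>' x) = \<theta>' (a i x))"
      by (rule generic_forth[OF assms(1-5)]) (fact aA conj)+
    then show thesis using that by (elim bexE)
  qed
  have B: "A \<subseteq> B" "E \<subseteq> B" "\<And>i. i < n \<Longrightarrow> a i ` B = B"
    "\<And>x. x \<in> A \<Longrightarrow> \<eta> x = \<theta> x" "\<And>i x. i < n \<Longrightarrow> x \<in> B \<Longrightarrow> c i (\<eta> x) = \<eta> (a i x)"
    using B0(3) by simp_all
  have \<eta>G: "\<eta> \<in> G" by (rule KG[OF B0(1)])
  have c\<eta>: "c i ` \<eta> ` B = \<eta> ` B" if "i < n" for i
    using B B0 that by (intro conj_image[of _ _ _ "a i"]) auto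
  have a\<eta>: "a i (inv_fun \<eta> x) = inv_fun \<eta> (c i x)" if "i < n" "x \<in> \<eta> ` B" for i x
    using that B(5)[OF that(1)] \<eta>G by auto
  have "\<exists>\<xi>\<in>K. \<exists>C\<in>\<A>. \<eta> ` B \<subseteq> C \<and> E \<subseteq> C \<and> (\<forall>i<n. c i ` C = C) \<and>
    (\<forall>x\<in>\<eta> ` B. \<xi> x = inv_fun \<eta> x) \<and> (\<forall>i<n. \<forall>x\<in>C. a i (\<xi> x) = \<xi> (c i x))"
  proof (rule generic_forth[OF assms(2,1)])
    show "inv_fun \<eta> \<in> K" "\<eta> ` B \<in> \<A>" "E \<in> \<A>"
      using B0 K_inv K_image assms(5) by auto
  qed (fact c\<eta> a\<eta>)+
  then obtain \<xi> C where C0: "\<xi> \<in> K" "C \<in> \<A>" "\<eta> ` B \<subseteq> C \<and> E \<subseteq> C \<and> (\<forall>i<n. c i ` C = C) \<and>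
    (\<forall>x\<in>\<eta> ` B. \<xi> x = inv_fun \<eta> x) \<and> (\<forall>i<n. \<forall>x\<in>C. a i (\<xi> x) = \<xi> (c i x))"
    by (elim bexE)
  from C0(3) have C: "\<eta> ` B \<subseteq> C" "E \<subseteq> C" "\<forall>i<n. c i ` C = C"
    "\<forall>x\<in>\<eta> ` B. \<xi> x = inv_fun \<eta> x" "\<forall>i<n. \<forall>x\<in>C. a i (\<xi> x) = \<xi> (c i x)"
    by - (elim conjE, assumption)+
  have \<xi>G: "\<xi> \<in> G" by (rule KG[OF C0(1)])
  have \<xi>\<eta>: "\<xi> (\<eta> x) = x" if "x \<in> B" for x using C(4)[rule_format, of "\<eta> x"] that \<eta>G by auto
  have B\<xi>C: "B \<subseteq> \<xi> ` C"
  proof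
    fix x assume "x \<in> B"
    then show "x \<in> \<xi> ` C" using \<xi>\<eta>[of x] C(1) by (metis image_eqI imageI subsetD)
  qed
  note C0 = C0(1,2)
  show ?thesis
  proof (intro bexI[of _ "inv_fun \<xi>"] bexI[of _ "\<xi> ` C"] conjI allI ballI impI)
    show "inv_fun \<xi> \<in> K" "\<xi> ` C \<in> \<A>" using C0 K_inv K_image by auto
    show "A \<subseteq> \<xi> ` C" "E \<subseteq> \<xi> ` C" using B\<xi>C B by auto
    show "E \<subseteq> inv_fun \<xi> ` \<xi> ` C" using C(2) \<xi>G by (auto simp: image_image)
    show "inv_fun \<xi> x = \<theta> x" if "x \<in> A" for x
      using that \<xi>\<eta>[of x] B(1,4) \<xi>G by (metis inv_app(1) subsetD)
    fix i assume i: "i < n"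
    show "a i ` \<xi> ` C = \<xi> ` C" using C C0 i by (intro conj_image[of _ _ _ "c i"]) auto
    show "c i (inv_fun \<xi> x) = inv_fun \<xi> (a i x)" if "x \<in> \<xi> ` C" for x
      using that C(5)[rule_format, OF i] \<xi>G by auto
  qed
qed

section \<open>Continuity and triviality of length functions\<close>

text \<open>L stands for the distance of h g from 1 and \<open>cover\<close> for separability of the
  target. Nothing ties L to the topology of G, so this is an automatic continuity statement.\<close>

lemma small_stabilizer:
  fixes L :: "('a \<Rightarrow> 'a) \<Rightarrow> real"
  assumes L_comp: "\<And>f g. f \<in> G \<Longrightarrow> g \<in> G \<Longrightarrow> L (f \<circ> g) \<le> L f + L g"
    and L_inv: "\<And>g. g \<in> G \<Longrightarrow> L (inv_fun g) = L g"
    and cover: "\<And>e. e > 0 \<Longrightarrow> \<exists>k::nat \<Rightarrow> _. (\<forall>n. k n \<in> G) \<and> (\<forall>g\<in>G. \<exists>n. L (inv_fun (k n) \<circ> g) < e)"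
    and "e > 0"
  shows "\<exists>N\<in>\<A>. \<forall>g\<in>G. (\<forall>x\<in>N. g x = x) \<longrightarrow> L g < e"
proof -
  \<comment> \<open>The final decomposition is g = w a w^-1 s^-1 with L w < \<delta> and both L a
    and L s below 2\<delta>, in total 6\<delta>.\<close>
  define \<delta> where "\<delta> = e / 6"
  have "\<delta> > 0" using \<open>e > 0\<close> by (simp add: \<delta>_def)
  obtain k :: "nat \<Rightarrow> 'a \<Rightarrow> 'a" where k: "\<And>n. k n \<in> G" "\<And>g. g \<in> G \<Longrightarrow> \<exists>n. L (inv_fun (k n) \<circ> g) < \<delta>"
    using cover[OF \<open>\<delta> > 0\<close>] by blast
  define M where "M = {g\<in>G. L g < 2 * \<delta>}"
  let ?S = "\<lambda>n. {g\<in>G. L (inv_fun (k n) \<circ> g) < \<delta>}"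
  have "G \<subseteq> (\<Union>n. ?S n)" using k(2) by blast
  then obtain m g0 N0 where m: "g0 \<in> G" "N0 \<in> \<A>" "everywhere_nonmeager (?S m) g0 N0"
    by (rule everywhere_nonmeager_cover)
  then have "nonmeager (?S m) g0 N0" unfolding everywhere_nonmeager_def by blast
  then have "\<exists>s\<in>?S m. (\<forall>x\<in>N0. s x = g0 x) \<and> (\<forall>U\<in>{}. s \<in> U)"
    unfolding nonmeager_def by blast
  then obtain w where w: "w \<in> G" "L (inv_fun (k m) \<circ> w) < \<delta>" "\<forall>x\<in>N0. w x = g0 x"
    by blast
  \<comment> \<open>Left translation by the inverse of one point w of the m-th set brings that set
    to the identity. The quotient of two of its elements has length below 2\<delta>, hence the
    radius in M.\<close>
  have M_nonmeager: "nonmeager M f N" if "f \<in> G" "N \<in> \<A>" "N0 \<subseteq> N" "\<forall>x\<in>N0. f x = x" for f N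
  proof -
    have "nonmeager (?S m) (w \<circ> f) N"
      using m(3) that w G_comp[OF w(1) that(1)] unfolding everywhere_nonmeager_def by simp
    then have "nonmeager {inv_fun w \<circ> s \<circ> id |s. s \<in> ?S m} (inv_fun w \<circ> (w \<circ> f) \<circ> id) (inv_fun id ` N)"
      by (rule nonmeager_translate) (use w G_inv G_id in auto)
    moreover have "inv_fun w \<circ> (w \<circ> f) \<circ> id = f" "inv_fun id ` N = N"
      using w by (auto simp: fun_eq_iff inv_id)
    moreover have "{inv_fun w \<circ> s \<circ> id |s. s \<in> ?S m} \<subseteq> M"
    proof safe
      fix s assume s: "s \<in> G" "L (inv_fun (k m) \<circ> s) < \<delta>"
      have eq: "inv_fun w \<circ> s \<circ> id = inv_fun (inv_fun (k m) \<circ> w) \<circ> (inv_fun (k m) \<circ> s)"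
        using k(1)[of m] w by (simp add: o_inv_distrib G_bij G_inv inv_inv_eq fun_eq_iff)
      have "inv_fun (k m) \<circ> w \<in> G" "inv_fun (k m) \<circ> s \<in> G" using k w s by (auto intro: G_comp G_inv)
      then have "L (inv_fun w \<circ> s \<circ> id) \<le> L (inv_fun (k m) \<circ> w) + L (inv_fun (k m) \<circ> s)"
        unfolding eq using L_comp[OF G_inv, of "inv_fun (k m) \<circ> w" "inv_fun (k m) \<circ> s"] L_inv by metis
      moreover have "inv_fun w \<circ> s \<circ> id \<in> G" using s w by (auto intro: G_comp G_inv)
      ultimately show "inv_fun w \<circ> s \<circ> id \<in> M" unfolding M_def using s(2) w(2) by auto
    qed
    ultimately show ?thesis using nonmeager_mono[of "{inv_fun w \<circ> s \<circ> id |s. s \<in> ?S m}" f N M] by simp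
  qed
  have "L g < e" if g: "g \<in> G" "\<forall>x\<in>N0. g x = x" for g
  proof -
    obtain E :: "nat \<Rightarrow> 'a set" where E: "range E = \<A>" "\<And>n. E n \<in> \<A>"
      using \<A>_enum by blast
    \<comment> \<open>Shaped for the end: if the limit conjugates a_n to c_n = k_n g s k_n^-1 and
      has the form k_n w, then w a_n w^-1 = g s. Which n will occur is unknown during the
      construction, so the n-th coordinate is prepared for the n-th translate.\<close>
    define S where "S n = {k n \<circ> g \<circ> s \<circ> inv_fun (k n) |s. s \<in> M}" for n
    \<comment> \<open>With g also its inverse fixes N0 pointwise; M is therefore nonmeager around
      the inverse of g, and the translation moves this to the identity.\<close>
    have S_nonmeager: "nonmeager (S n) id N" if "N \<in> \<A>" "k n ` N0 \<subseteq> N" for n N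
    proof -
      have g': "inv_fun g x = x" if "x \<in> N0" for x
        using that g by (metis inv_app(1))
      have "N0 \<subseteq> inv_fun (k n) ` N"
      proof
        fix x assume "x \<in> N0"
        then have "k n x \<in> N" using that by blast
        then show "x \<in> inv_fun (k n) ` N" using k(1)[of n] by (metis image_eqI inv_app(1))
      qed
      then have "nonmeager M (inv_fun g) (inv_fun (k n) ` N)"
        using g' that(1) by (intro M_nonmeager G_inv[OF g(1)] G_image[OF G_inv[OF k(1)]]) auto
      then have "nonmeager {(k n \<circ> g) \<circ> s \<circ> inv_fun (k n) |s. s \<in> M} ((k n \<circ> g) \<circ> inv_fun g \<circ> inv_fun (k n))
          (inv_fun (inv_fun (k n)) ` inv_fun (k n) ` N)"
        by (rule nonmeager_translate) (use k g G_comp G_inv in \<open>auto simp: M_def\<close>)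
      moreover have "(k n \<circ> g) \<circ> inv_fun g \<circ> inv_fun (k n) = id"
        using k g by (auto simp: fun_eq_iff)
      moreover have "inv_fun (inv_fun (k n)) ` inv_fun (k n) ` N = N"
        using k(1)[of n] by (simp add: inv_inv_eq G_bij image_image)
      ultimately show ?thesis by (simp add: S_def)
    qed
    have SG: "S n \<subseteq> G" for n unfolding S_def using k g by (auto simp: M_def intro!: G_comp G_inv)
    define P where "P = (\<lambda>n (a, c, \<theta>, A). generic n a \<and> generic n c \<and> \<theta> \<in> K \<and> A \<in> \<A> \<and> N0 \<subseteq> A \<and>
       (\<forall>i<n. a i ` A = A \<and> a i \<in> M \<and> c i \<in> S i \<and> (\<forall>x\<in>A. c i (\<theta> x) = \<theta> (a i x))))"
    define R where "R = (\<lambda>n (a, c, \<theta>, A) (a', c', \<theta>', A'). A \<subseteq> A' \<and> E n \<subseteq> A' \<and> E n \<subseteq> \<theta>' ` A' \<and>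
       (\<forall>x\<in>A. \<theta>' (x :: 'a) = (\<theta> x :: 'a)) \<and> (\<forall>i<n. a' i = (a i :: 'a \<Rightarrow> 'a) \<and> c' i = (c i :: 'a \<Rightarrow> 'a)))"
    have step: "\<exists>y. P (Suc n) y \<and> R n x y" if Px: "P n x" for x n
    proof -
      obtain a c \<theta> A where x: "x = (a, c, \<theta>, A)" by (metis prod_cases4)
      have a: "generic n a" and c: "generic n c" and \<theta>: "\<theta> \<in> K" and A: "A \<in> \<A>" "N0 \<subseteq> A"
        and inv: "\<And>i. i < n \<Longrightarrow> a i ` A = A \<and> a i \<in> M \<and> c i \<in> S i \<and> (\<forall>x\<in>A. c i (\<theta> x) = \<theta> (a i x))"
        using Px by (auto simp: x P_def)
      have MG: "M \<subseteq> G" by (auto simp: M_def)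
      \<comment> \<open>Both new entries start as the identity, s on A and t on a set B containing
        the image of A, so \<theta> remains a partial conjugacy for the longer tuples.\<close>
      obtain s where s: "s \<in> M" "\<And>x. x \<in> A \<Longrightarrow> s x = id x" "generic (Suc n) (a(n := s))"
        using nonmeager_generic[OF a M_nonmeager[OF G_id A] MG] by auto
      obtain B where B: "B \<in> \<A>" "\<theta> ` A \<union> k n ` N0 \<subseteq> B"
        using directed[OF K_image[OF \<theta> A(1)] G_image[OF k(1) m(2)]] by blast
      obtain t where t: "t \<in> S n" "\<And>x. x \<in> B \<Longrightarrow> t x = id x" "generic (Suc n) (c(n := t))"
        using nonmeager_generic[OF c S_nonmeager[OF B(1)] SG] B by auto
      have inv': "(a(n := s)) i ` A = A" "\<And>x. x \<in> A \<Longrightarrow> (c(n := t)) i (\<theta> x) = \<theta> ((a(n := s)) i x)"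
        if "i < Suc n" for i
      proof -
        have "s ` A = A" using s(2) by force
        then show "(a(n := s)) i ` A = A" using inv[of i] that by (auto simp: less_Suc_eq)
        show "(c(n := t)) i (\<theta> x) = \<theta> ((a(n := s)) i x)" if "x \<in> A" for x
          using inv[of i] that \<open>i < Suc n\<close> s(2)[OF that] t(2)[of "\<theta> x"] B by (auto simp: less_Suc_eq)
      qed
      have "\<exists>\<theta>'\<in>K. \<exists>A'\<in>\<A>. A \<subseteq> A' \<and> E n \<subseteq> A' \<and> E n \<subseteq> \<theta>' ` A' \<and> (\<forall>i<Suc n. (a(n := s)) i ` A' = A') \<and>
          (\<forall>x\<in>A. \<theta>' x = \<theta> x) \<and> (\<forall>i<Suc n. \<forall>x\<in>A'. (c(n := t)) i (\<theta>' x) = \<theta>' ((a(n := s)) i x))"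
        by (rule generic_back_and_forth[OF s(3) t(3) \<theta> A(1) E(2)]) (fact inv')+
      then obtain \<theta>' A' where \<theta>': "\<theta>' \<in> K" "A' \<in> \<A>"
        "A \<subseteq> A' \<and> E n \<subseteq> A' \<and> E n \<subseteq> \<theta>' ` A' \<and> (\<forall>i<Suc n. (a(n := s)) i ` A' = A') \<and>
          (\<forall>x\<in>A. \<theta>' x = \<theta> x) \<and> (\<forall>i<Suc n. \<forall>x\<in>A'. (c(n := t)) i (\<theta>' x) = \<theta>' ((a(n := s)) i x))"
        by (elim bexE)
      have "(a(n := s)) i \<in> M \<and> (c(n := t)) i \<in> S i" if "i < Suc n" for i
        using inv[of i] that s(1) t(1) by (auto simp: less_Suc_eq)
      then have "P (Suc n) (a(n := s), c(n := t), \<theta>', A')"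
        unfolding P_def split using s(3) t(3) \<theta>' A(2) by (meson order_trans)
      moreover have "R n x (a(n := s), c(n := t), \<theta>', A')"
        unfolding R_def x split using \<theta>'(3) by simp
      ultimately show ?thesis by blast
    qed
    have "P 0 ((\<lambda>_. id), (\<lambda>_. id), id, N0)"
      using m K_id by (auto simp: P_def generic_0)
    then obtain st where st: "\<And>n. P n (st n)" "\<And>n. R n (st n) (st (Suc n))"
      using dependent_nat_choice[of P R] step by metis
    define a where "a n = fst (st n)" for n
    define c where "c n = fst (snd (st n))" for n
    define \<theta> where "\<theta> n = fst (snd (snd (st n)))" for n
    define A where "A n = snd (snd (snd (st n)))" for n
    have stn: "st n = (a n, c n, \<theta> n, A n)" for n by (simp add: a_def c_def \<theta>_def A_def)
    have P: "\<theta> n \<in> K" "A n \<in> \<A>"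
       "\<And>i. i < n \<Longrightarrow> a n i ` A n = A n \<and> a n i \<in> M \<and> c n i \<in> S i \<and> (\<forall>x\<in>A n. c n i (\<theta> n x) = \<theta> n (a n i x))" for n
      using st(1)[of n] by (auto simp: stn P_def)
    have R: "A n \<subseteq> A (Suc n)" "\<And>x. x \<in> A n \<Longrightarrow> \<theta> (Suc n) x = \<theta> n x" "E n \<subseteq> A (Suc n)" "E n \<subseteq> \<theta> (Suc n) ` A (Suc n)"
       "\<And>i. i < n \<Longrightarrow> a (Suc n) i = a n i \<and> c (Suc n) i = c n i" for n
      using st(2)[of n] by (auto simp: stn R_def)
    have stable: "a n i = a (Suc i) i \<and> c n i = c (Suc i) i" if "i < n" for n i
      using that
    proof (induction n)
      case (Suc n)
      then show ?case using R(5)[of i n] by (cases "i = n") auto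
    qed auto
    have "\<exists>h\<in>G. \<forall>n. \<forall>x\<in>A n. h x = \<theta> n x"
    proof (rule complete)
      fix N assume "N \<in> \<A>"
      then obtain n where "N = E n" using E by blast
      then show "\<exists>n. N \<subseteq> A n" "\<exists>n. N \<subseteq> \<theta> n ` A n" using R(3,4) by blast+
    qed (use P R KG in auto)
    then obtain h where h: "h \<in> G" "\<And>n x. x \<in> A n \<Longrightarrow> h x = \<theta> n x" by blast
    have A_mono: "mono A" using R(1) by (rule mono_iff_le_Suc[THEN iffD2, rule_format])
    \<comment> \<open>Only now is a translate known that contains h; its index selects the
      coordinate to be used.\<close>
    obtain n where n: "L (inv_fun (k n) \<circ> h) < \<delta>" using k(2)[OF h(1)] by blast
    let ?a = "a (Suc n) n" and ?c = "c (Suc n) n" and ?w = "inv_fun (k n) \<circ> h"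
    have aM: "?a \<in> M" and cS: "?c \<in> S n" using P(3)[of n "Suc n"] by auto
    have aG: "?a \<in> G" and cG: "?c \<in> G" using aM cS SG by (auto simp: M_def)
    have "?c \<circ> h = h \<circ> ?a"
    proof (rule determined)
      show "?c \<circ> h \<in> G" "h \<circ> ?a \<in> G" using aG cG h G_comp by auto
      fix N x assume N: "N \<in> \<A>" "x \<in> N"
      then obtain j where "x \<in> A j" using E R(3) by blast
      define l where "l = max j (Suc n)"
      have x: "x \<in> A l" using \<open>x \<in> A j\<close> monoD[OF A_mono, of j l] by (auto simp: l_def)
      have "n < l" by (simp add: l_def)
      have "a l n x \<in> A l" using P(3)[OF \<open>n < l\<close>] x by blast
      then have "c l n (h x) = h (a l n x)" using P(3)[OF \<open>n < l\<close>] h(2)[of _ l] x by simp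
      then show "(?c \<circ> h) x = (h \<circ> ?a) x" using stable[OF \<open>n < l\<close>] by simp
    qed
    moreover obtain s where s: "s \<in> M" "?c = k n \<circ> g \<circ> s \<circ> inv_fun (k n)"
      using cS by (auto simp: S_def)
    ultimately have eq: "k n \<circ> g \<circ> s \<circ> inv_fun (k n) \<circ> h = h \<circ> ?a" by simp
    have wG: "?w \<in> G" and sG: "s \<in> G" using k h s by (auto simp: M_def intro: G_comp G_inv)
    have "g = ?w \<circ> ?a \<circ> inv_fun ?w \<circ> inv_fun s"
    proof
      fix y
      obtain x where y: "y = s (?w x)" using inv_app(2)[OF sG] inv_app(2)[OF wG] by metis
      have "k n (g y) = h (?a x)" using fun_cong[OF eq, of x] by (simp add: y)
      then have "g y = ?w (?a x)" using inv_app(1)[OF k(1)] by (metis comp_apply)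
      then show "g y = (?w \<circ> ?a \<circ> inv_fun ?w \<circ> inv_fun s) y"
        unfolding y o_apply[of "?w \<circ> ?a \<circ> inv_fun ?w"] o_apply[of "?w \<circ> ?a"] inv_app(1)[OF sG] inv_app(1)[OF wG]
        by simp
    qed
    then have "L g \<le> L (?w \<circ> ?a \<circ> inv_fun ?w) + L (inv_fun s)"
      using L_comp[of "?w \<circ> ?a \<circ> inv_fun ?w" "inv_fun s"] wG aG sG G_comp G_inv by metis
    also have "L (?w \<circ> ?a \<circ> inv_fun ?w) \<le> L (?w \<circ> ?a) + L (inv_fun ?w)"
      by (rule L_comp[OF G_comp[OF wG aG] G_inv[OF wG]])
    also have "L (?w \<circ> ?a) \<le> L ?w + L ?a" by (rule L_comp[OF wG aG])
    finally have "L g \<le> L ?w + L ?a + L ?w + L s"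
      unfolding L_inv[OF wG] L_inv[OF sG] by simp
    moreover have "L ?a < 2 * \<delta>" "L s < 2 * \<delta>" "e = 6 * \<delta>" using aM s(1) by (simp_all add: M_def \<delta>_def)
    ultimately show ?thesis using n by linarith
  qed
  then show ?thesis using m(2) by blast
qed

section \<open>Vanishing of the length function\<close>

lemma generic_dense:
  assumes "g \<in> G" "N \<in> \<A>"
  obtains t where "t \<in> G" "\<And>x. x \<in> N \<Longrightarrow> t x = g x" "generic 1 (\<lambda>_. t)"
proof -
  obtain t where "t \<in> G" "\<And>x. x \<in> N \<Longrightarrow> t x = g x" "generic (Suc 0) ((\<lambda>_. id)(0 := t))"
    using nonmeager_generic[OF generic_0 baire[OF assms]] by blast
  moreover have "generic 1 (\<lambda>_. t)" using generic_cong[OF calculation(3), of "\<lambda>_. t"] by simp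
  ultimately show thesis using that by blast
qed

text \<open>The hypothesis \<open>cli\<close> is what a complete left-invariant metric gives: \<open>f\<close> is left Cauchy, so its
  image converges, and the conjugates of t tend to 1.\<close>

lemma length_trivial:
  fixes L :: "('a \<Rightarrow> 'a) \<Rightarrow> real"
  assumes L_comp: "\<And>f g. f \<in> G \<Longrightarrow> g \<in> G \<Longrightarrow> L (f \<circ> g) \<le> L f + L g"
    and L_inv: "\<And>g. g \<in> G \<Longrightarrow> L (inv_fun g) = L g"
    and cover: "\<And>e. e > 0 \<Longrightarrow> \<exists>k::nat \<Rightarrow> _. (\<forall>n. k n \<in> G) \<and> (\<forall>g\<in>G. \<exists>n. L (inv_fun (k n) \<circ> g) < e)"
    and cli: "\<And>f t. (\<And>n. f n \<in> G) \<Longrightarrow> t \<in> G \<Longrightarrow> (\<And>n. L (inv_fun (f n) \<circ> f (Suc n)) < (1/2) ^ n) \<Longrightarrow>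
        (\<And>n. L (inv_fun (f n) \<circ> t \<circ> f n) < (1/2) ^ n) \<Longrightarrow> L t \<le> 0"
    and "g \<in> G"
  shows "L g \<le> 0"
proof -
  note small = small_stabilizer[OF L_comp L_inv cover]
  have generic_trivial: "L t \<le> 0" if t: "generic 1 (\<lambda>_. t)" for t
  proof -
    have tG: "t \<in> G" using generic_in_G[OF t] by simp
    \<comment> \<open>The identity on C is one of the systems that saturation realizes, so t fixes
      some copy of C over N pointwise.\<close>
    have sat: "\<exists>k\<in>K. (\<forall>x\<in>N. k x = x) \<and> (\<forall>x\<in>C. t (k x) = k x)"
      if N: "N \<in> \<A>" "C \<in> \<A>" "N \<subseteq> C" "\<forall>x\<in>N. t x = x" for N C
    proof -
      obtain k where "k \<in> K" "\<And>x. x \<in> N \<Longrightarrow> k x = x"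
          "\<And>i x. i < (1::nat) \<Longrightarrow> x \<in> C \<Longrightarrow> t (k x) = k (id x)"
      proof (rule generic_saturated[OF t N(1-3), of "\<lambda>_. id"])
        show "t ` N = N" using N(4) by force
      qed (use N(4) K_id in auto)
      then show ?thesis by auto
    qed
    have "\<exists>N\<in>\<A>. \<forall>g\<in>G. (\<forall>x\<in>N. g x = x) \<longrightarrow> L g < (1/2) ^ n" for n
      by (rule small) auto
    then obtain M where M: "\<And>n. M n \<in> \<A>" "\<And>n g. g \<in> G \<Longrightarrow> \<forall>x\<in>M n. g x = x \<Longrightarrow> L g < (1/2) ^ n"
      by metis
    \<comment> \<open>f carries N into the fixed points of t, and the next pair leaves f unchanged
      on N. As N contains M n, both products that \<open>cli\<close> forms with f n fix M n
      pointwise, so their lengths are below (1/2)^n.\<close>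
    define P where "P = (\<lambda>n (f, N). f \<in> K \<and> N \<in> \<A> \<and> M n \<subseteq> N \<and> (\<forall>x\<in>N. t (f x) = f x))"
    define R where "R = (\<lambda>(n::nat) (f, N) (f', N'). N \<subseteq> N' \<and> (\<forall>x\<in>N. f' (x :: 'a) = (f x :: 'a)))"
    have "\<exists>x. P 0 x"
    proof -
      \<comment> \<open>The first use of \<open>sat\<close> needs a base fixed pointwise by t; E0 is
        fixed by K, hence by t, which agrees on E0 with an element of K.\<close>
      have tE: "\<forall>x\<in>E0. t x = x" using K_dense[OF tG E0(1)] E0(3) by metis
      obtain k where "k \<in> K" "\<forall>x\<in>M 0. t (k x) = k x"
        using sat[OF E0(1) M(1)[of 0] E0(2)[OF M(1)] tE] by blast
      then show ?thesis using M by (auto simp: P_def intro!: exI[of _ k])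
    qed
    moreover have "\<exists>y. P (Suc n) y \<and> R n x y" if "P n x" for n x
    proof -
      obtain f N where x: "x = (f, N)" by force
      have f: "f \<in> K" "N \<in> \<A>" "\<forall>x\<in>N. t (f x) = f x" using that by (auto simp: P_def x)
      obtain N' where N': "N' \<in> \<A>" "N \<union> M (Suc n) \<subseteq> N'" using directed[OF f(2) M(1)] by blast
      have "f ` N \<subseteq> f ` N'" "\<forall>y\<in>f ` N. t y = y" using f N' by auto
      then obtain k where k: "k \<in> K" "\<forall>y\<in>f ` N. k y = y" "\<forall>y\<in>f ` N'. t (k y) = k y"
        using sat[OF K_image[OF f(1,2)] K_image[OF f(1) N'(1)]] by blast
      have "P (Suc n) (k \<circ> f, N') \<and> R n x (k \<circ> f, N')"
        unfolding P_def R_def x split using K_comp[OF k(1) f(1)] N' k(2,3) by auto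
      then show ?thesis by blast
    qed
    ultimately obtain st where st: "\<And>n. P n (st n)" "\<And>n. R n (st n) (st (Suc n))"
      using dependent_nat_choice[of P R] by metis
    define f where "f n = fst (st n)" for n
    define N where "N n = snd (st n)" for n
    have stn: "st n = (f n, N n)" for n by (simp add: f_def N_def)
    have P: "f n \<in> K" "N n \<in> \<A>" "M n \<subseteq> N n" "\<forall>x\<in>N n. t (f n x) = f n x" for n
      using st(1)[of n] by (auto simp: stn P_def)
    have R: "\<forall>x\<in>N n. f (Suc n) x = f n x" for n
      using st(2)[of n] by (auto simp: stn R_def)
    have fG: "f n \<in> G" for n using P(1) KG by blast
    show ?thesis
    proof (rule cli[of f])
      show "L (inv_fun (f n) \<circ> f (Suc n)) < (1/2) ^ n" for n
      proof (rule M(2))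
        show "\<forall>x\<in>M n. (inv_fun (f n) \<circ> f (Suc n)) x = x"
          using R[of n] P(3)[of n] fG[of n] by auto
      qed (use fG G_comp G_inv in blast)
      show "L (inv_fun (f n) \<circ> t \<circ> f n) < (1/2) ^ n" for n
      proof (rule M(2))
        show "\<forall>x\<in>M n. (inv_fun (f n) \<circ> t \<circ> f n) x = x"
          using P(3,4)[of n] fG[of n] by auto
      qed (use fG tG G_comp G_inv in blast)
    qed (use fG tG in auto)
  qed
  show ?thesis
  proof (rule field_le_epsilon)
    fix e :: real assume "e > 0"
    then obtain N where N: "N \<in> \<A>" "\<forall>g\<in>G. (\<forall>x\<in>N. g x = x) \<longrightarrow> L g < e" using small by blast
    \<comment> \<open>g and a generic t agreeing with g on N differ by an element of the stabilizer
      of N, whose length is below e.\<close>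
    obtain t where t: "t \<in> G" "\<And>x. x \<in> N \<Longrightarrow> t x = g x" "generic 1 (\<lambda>_. t)"
      using generic_dense[OF \<open>g \<in> G\<close> N(1)] by blast
    have "inv_fun t \<circ> g \<in> G" "\<forall>x\<in>N. (inv_fun t \<circ> g) x = x"
      using t \<open>g \<in> G\<close> by (auto intro: G_comp G_inv) (metis inv_app(1))
    then have "L (inv_fun t \<circ> g) < e" using N by blast
    moreover have "t \<circ> (inv_fun t \<circ> g) = g" using t by (auto simp: fun_eq_iff)
    ultimately show "L g \<le> 0 + e"
      using L_comp[OF t(1) \<open>inv_fun t \<circ> g \<in> G\<close>] generic_trivial[OF t(3)] by simp
  qed
qed

end

section \<open>Isomorphisms and generated substructures\<close>

lemma topspace_tuples [simp]: "topspace (tuples n) = {xs. length xs = n}"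
  by (auto simp: tuples_def topspace_pullback_topology)

lemma limitin_tuplesI:
  assumes "length x = n" "\<And>j. length (X j) = n" "\<And>i. i < n \<Longrightarrow> ((\<lambda>j. X j ! i) \<longlongrightarrow> x ! i) F"
  shows "limitin (tuples n) X x F"
proof -
  let ?f = "\<lambda>xs. \<lambda>i\<in>{..<n}. xs ! i"
  have lim: "limitin (product_topology (\<lambda>_. euclidean) {..<n}) (\<lambda>j. ?f (X j)) (?f x) F"
    using assms by (simp add: limitin_componentwise)
  show ?thesis
    unfolding limitin_def
  proof (intro conjI allI impI)
    fix U assume "openin (tuples n) U \<and> x \<in> U"
    then obtain V where V: "openin (product_topology (\<lambda>_. euclidean) {..<n}) V" "U = ?f -` V \<inter> {xs. length xs = n}"
      "?f x \<in> V"
      unfolding tuples_def openin_pullback_topology by blast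
    have "\<forall>\<^sub>F j in F. ?f (X j) \<in> V" using lim V unfolding limitin_def by blast
    then show "\<forall>\<^sub>F j in F. X j \<in> U" using assms(2) V(2) by simp
  qed (simp add: assms(1))
qed

lemma limitin_tuplesD:
  assumes "limitin (tuples n) X x F" "i < n"
  shows "((\<lambda>j. X j ! i) \<longlongrightarrow> x ! i) F"
proof -
  let ?f = "\<lambda>xs. \<lambda>i\<in>{..<n}. xs ! i"
  have "continuous_map (tuples n) (product_topology (\<lambda>_. euclidean) {..<n}) (id \<circ> ?f)"
    unfolding tuples_def by (intro continuous_map_pullback) simp
  then have "limitin (product_topology (\<lambda>_. euclidean) {..<n}) ((id \<circ> ?f) \<circ> X) ((id \<circ> ?f) x) F"
    using assms(1) by (rule continuous_map_limit)
  then show ?thesis using assms(2) by (auto simp: limitin_componentwise o_def)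
qed

lemma limitin_prod_topologyI:
  assumes "limitin S f x F" "limitin T g y F"
  shows "limitin (prod_topology S T) (\<lambda>j. (f j, g j)) (x, y) F"
  unfolding limitin_def
proof (intro conjI allI impI)
  show "(x, y) \<in> topspace (prod_topology S T)" using assms by (auto dest: limitin_topspace)
  fix W assume W: "openin (prod_topology S T) W \<and> (x, y) \<in> W"
  then obtain U V where UV: "openin S U" "openin T V" "x \<in> U" "y \<in> V" "U \<times> V \<subseteq> W"
    unfolding openin_prod_topology_alt by blast
  have "\<forall>\<^sub>F j in F. f j \<in> U" "\<forall>\<^sub>F j in F. g j \<in> V" using assms UV unfolding limitin_def by blast+
  then show "\<forall>\<^sub>F j in F. (f j, g j) \<in> W" by eventually_elim (use UV in blast)
qed

section \<open>Composition, inversion and restriction of isomorphisms\<close>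

lemma isomorphismD:
  assumes "isomorphism F \<phi> A B"
  shows "bij_betw \<phi> A B" "\<phi> ` A = B" "inj_on \<phi> A" "\<And>x y. x \<in> A \<Longrightarrow> y \<in> A \<Longrightarrow> dist (\<phi> x) (\<phi> y) = dist x y"
    "preserves_symbol (F i) \<phi> A"
  using assms by (auto simp: isomorphism_def bij_betw_def)

lemma isomorphism_Rel:
  "isomorphism F \<phi> A B \<Longrightarrow> F i = Rel n m R \<Longrightarrow> set xs \<subseteq> A \<Longrightarrow> length xs = n \<Longrightarrow> length rs = m \<Longrightarrow>
     (map \<phi> xs, rs) \<in> R \<longleftrightarrow> (xs, rs) \<in> R"
  using isomorphismD(5)[of F \<phi> A B i] by simp

lemma isomorphism_Fun:
  "isomorphism F \<phi> A B \<Longrightarrow> F i = Fun n m k l f \<Longrightarrow> set xs \<subseteq> A \<Longrightarrow> length xs = n \<Longrightarrow> length rs = m \<Longrightarrow>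
     f (map \<phi> xs, rs) = (map \<phi> (fst (f (xs, rs))), snd (f (xs, rs)))"
  using isomorphismD(5)[of F \<phi> A B i] by simp

lemma substructure_Fun:
  "substructure F A \<Longrightarrow> F i = Fun n m k l f \<Longrightarrow> set xs \<subseteq> A \<Longrightarrow> length xs = n \<Longrightarrow> length rs = m \<Longrightarrow>
     set (fst (f (xs, rs))) \<subseteq> A"
  unfolding substructure_def by (metis closed_under_symbol.simps(2))

text \<open>The map is also applied to function values, so changing it off A is harmless because A
  is closed under the functions.\<close>

lemma isomorphism_cong:
  assumes "isomorphism F \<phi> A B" "substructure F A" "\<And>x. x \<in> A \<Longrightarrow> \<psi> x = \<phi> x"
  shows "isomorphism F \<psi> A B"
proof -
  have m: "map \<psi> xs = map \<phi> xs" if "set xs \<subseteq> A" for xs using assms(3) that by auto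
  have "preserves_symbol (F i) \<psi> A" for i
  proof (cases "F i")
    case (Rel n k R)
    show ?thesis unfolding Rel preserves_symbol.simps
    proof (intro allI impI)
      fix xs and rs :: "real list" assume xs: "set xs \<subseteq> A \<and> length xs = n \<and> length rs = k"
      then show "(map \<psi> xs, rs) \<in> R \<longleftrightarrow> (xs, rs) \<in> R"
        using isomorphism_Rel[OF assms(1) Rel, of xs rs] m[of xs] by metis
    qed
  next
    case (Fun n k k' l f)
    show ?thesis unfolding Fun preserves_symbol.simps
    proof (intro allI impI)
      fix xs and rs :: "real list" assume xs: "set xs \<subseteq> A \<and> length xs = n \<and> length rs = k"
      then have "set (fst (f (xs, rs))) \<subseteq> A"
        using assms(2)[unfolded substructure_def, rule_format, of i] by (simp add: Fun)
      then show "f (map \<psi> xs, rs) = (map \<psi> (fst (f (xs, rs))), snd (f (xs, rs)))"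
        using isomorphism_Fun[OF assms(1) Fun, of xs rs] xs m[of xs] m[of "fst (f (xs, rs))"] by metis
    qed
  qed
  moreover have "bij_betw \<psi> A B"
    using isomorphismD(1)[OF assms(1)] assms(3) by (metis bij_betw_cong)
  ultimately show ?thesis
    using isomorphismD(4)[OF assms(1)] assms(3) by (simp add: isomorphism_def)
qed

lemma isomorphism_restrict:
  assumes "isomorphism F \<phi> A B" "A' \<subseteq> A"
  shows "isomorphism F \<phi> A' (\<phi> ` A')"
proof -
  have "preserves_symbol (F i) \<phi> A'" for i
    using isomorphismD(5)[OF assms(1), of i] assms(2) by (cases "F i") auto
  then show ?thesis
    using assms(2) inj_on_subset[OF isomorphismD(3)[OF assms(1)]] isomorphismD(4)[OF assms(1)]
    by (simp add: isomorphism_def bij_betw_def subset_iff)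
qed

lemma isomorphism_comp:
  assumes "isomorphism F \<phi> A B" "isomorphism F \<psi> B C" "substructure F A"
  shows "isomorphism F (\<psi> \<circ> \<phi>) A C"
proof -
  have im: "set (map \<phi> xs) \<subseteq> B" if "set xs \<subseteq> A" for xs using isomorphismD(2)[OF assms(1)] that by auto
  have "preserves_symbol (F i) (\<psi> \<circ> \<phi>) A" for i
  proof (cases "F i")
    case (Rel n m R)
    show ?thesis unfolding Rel preserves_symbol.simps
    proof (intro allI impI)
      fix xs and rs :: "real list" assume xs: "set xs \<subseteq> A \<and> length xs = n \<and> length rs = m"
      have "(map \<phi> xs, rs) \<in> R \<longleftrightarrow> (xs, rs) \<in> R"
        using isomorphismD(5)[OF assms(1), of i] xs by (simp add: Rel)
      moreover have "(map \<psi> (map \<phi> xs), rs) \<in> R \<longleftrightarrow> (map \<phi> xs, rs) \<in> R"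
        using isomorphismD(5)[OF assms(2), of i] xs im[of xs] by (simp add: Rel del: map_map)
      ultimately show "(map (\<psi> \<circ> \<phi>) xs, rs) \<in> R \<longleftrightarrow> (xs, rs) \<in> R" by simp
    qed
  next
    case (Fun n m k l f)
    show ?thesis unfolding Fun preserves_symbol.simps
    proof (intro allI impI)
      fix xs and rs :: "real list" assume xs: "set xs \<subseteq> A \<and> length xs = n \<and> length rs = m"
      then have 1: "f (map \<phi> xs, rs) = (map \<phi> (fst (f (xs, rs))), snd (f (xs, rs)))"
        using isomorphismD(5)[OF assms(1), of i] Fun by simp
      have "f (map \<psi> (map \<phi> xs), rs) = (map \<psi> (fst (f (map \<phi> xs, rs))), snd (f (map \<phi> xs, rs)))"
        using isomorphism_Fun[OF assms(2) Fun, of "map \<phi> xs" rs] im[of xs] xs by (simp del: map_map)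
      then show "f (map (\<psi> \<circ> \<phi>) xs, rs) = (map (\<psi> \<circ> \<phi>) (fst (f (xs, rs))), snd (f (xs, rs)))"
        by (simp add: 1)
    qed
  qed
  moreover have "bij_betw (\<psi> \<circ> \<phi>) A C"
    using isomorphismD(1)[OF assms(1)] isomorphismD(1)[OF assms(2)] by (rule bij_betw_trans)
  moreover have "dist ((\<psi> \<circ> \<phi>) x) ((\<psi> \<circ> \<phi>) y) = dist x y" if "x \<in> A" "y \<in> A" for x y
    using that isomorphismD[OF assms(1)] isomorphismD(4)[OF assms(2)] by auto
  ultimately show ?thesis by (simp add: isomorphism_def)
qed

lemma isomorphism_inverse:
  assumes "isomorphism F \<phi> A B" "substructure F A"
  shows "isomorphism F (inv_into A \<phi>) B A"
proof -
  note \<phi> = isomorphismD[OF assms(1)]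
  let ?\<psi> = "inv_into A \<phi>"
  have \<psi>: "?\<psi> y \<in> A" "\<phi> (?\<psi> y) = y" if "y \<in> B" for y
    using that \<phi>(2) by (auto intro: inv_into_into f_inv_into_f)
  have lift: "set (map ?\<psi> ys) \<subseteq> A" "map \<phi> (map ?\<psi> ys) = ys" if "set ys \<subseteq> B" for ys
    using \<psi> that by (auto simp: map_idI subset_iff)
  have "preserves_symbol (F i) ?\<psi> B" for i
  proof (cases "F i")
    case (Rel n m R)
    show ?thesis unfolding Rel preserves_symbol.simps
    proof (intro allI impI)
      fix ys and rs :: "real list" assume ys: "set ys \<subseteq> B \<and> length ys = n \<and> length rs = m"
      then have "(map \<phi> (map ?\<psi> ys), rs) \<in> R \<longleftrightarrow> (map ?\<psi> ys, rs) \<in> R"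
        using \<phi>(5)[of i] lift(1)[of ys] by (simp add: Rel del: map_map)
      then show "(map ?\<psi> ys, rs) \<in> R \<longleftrightarrow> (ys, rs) \<in> R" using lift(2)[of ys] ys by simp
    qed
  next
    case (Fun n m k l f)
    show ?thesis unfolding Fun preserves_symbol.simps
    proof (intro allI impI)
      fix ys and rs :: "real list" assume ys: "set ys \<subseteq> B \<and> length ys = n \<and> length rs = m"
      let ?xs = "map ?\<psi> ys"
      have eq: "f (ys, rs) = (map \<phi> (fst (f (?xs, rs))), snd (f (?xs, rs)))"
      proof -
        have "f (map \<phi> ?xs, rs) = (map \<phi> (fst (f (?xs, rs))), snd (f (?xs, rs)))"
          using \<phi>(5)[of i] lift(1)[of ys] ys by (simp add: Fun del: map_map)
        then show ?thesis using lift(2)[of ys] ys by simp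
      qed
      have "set (fst (f (?xs, rs))) \<subseteq> A"
        using assms(2)[unfolded substructure_def, rule_format, of i] lift(1)[of ys] ys by (simp add: Fun)
      then have "map ?\<psi> (map \<phi> (fst (f (?xs, rs)))) = fst (f (?xs, rs))"
        using \<phi>(3) by (auto simp: map_idI subset_iff)
      then show "f (?xs, rs) = (map ?\<psi> (fst (f (ys, rs))), snd (f (ys, rs)))"
        by (simp add: eq)
    qed
  qed
  moreover have "bij_betw ?\<psi> B A" using \<phi>(1) by (rule bij_betw_inv_into)
  moreover have "dist (?\<psi> x) (?\<psi> y) = dist x y" if "x \<in> B" "y \<in> B" for x y
    using \<phi>(4)[of "?\<psi> x" "?\<psi> y"] \<psi> that by simp
  ultimately show ?thesis by (simp add: isomorphism_def)
qed

lemma isomorphism_id: "isomorphism F id A A"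
proof -
  have "preserves_symbol (F i) id A" for i by (cases "F i") auto
  then show ?thesis by (simp add: isomorphism_def)
qed

section \<open>Substructures and their generators\<close>

lemma substructure_UNIV: "substructure F UNIV"
  unfolding substructure_def
proof
  fix i show "closed_under_symbol (F i) UNIV" by (cases "F i") auto
qed

lemma substructure_Inter:
  assumes "\<And>A. A \<in> \<B> \<Longrightarrow> substructure F A" shows "substructure F (\<Inter>\<B>)"
  unfolding substructure_def
proof
  fix i
  show "closed_under_symbol (F i) (\<Inter>\<B>)"
  proof (cases "F i")
    case (Fun n m k l f)
    have "set (fst (f (xs, rs))) \<subseteq> A" if "A \<in> \<B>" "set xs \<subseteq> \<Inter>\<B>" "length xs = n" "length rs = m" for A xs rs
    proof -
      have "closed_under_symbol (F i) A" using assms[OF that(1)] by (simp add: substructure_def)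
      moreover have "set xs \<subseteq> A" using that by blast
      ultimately show ?thesis using that by (simp add: Fun)
    qed
    then show ?thesis unfolding Fun closed_under_symbol.simps by blast
  qed simp
qed

lemma substructure_gen: "substructure F (gen F A)"
  unfolding gen_def by (rule hull_in) (auto intro: substructure_Inter)

lemma gen_superset: "A \<subseteq> gen F A"
  unfolding gen_def by (rule hull_subset)

lemma gen_minimal: "A \<subseteq> B \<Longrightarrow> substructure F B \<Longrightarrow> gen F A \<subseteq> B"
  unfolding gen_def by (rule hull_minimal)

lemma gen_mono: "A \<subseteq> B \<Longrightarrow> gen F A \<subseteq> gen F B"
  unfolding gen_def by (rule hull_mono)

lemma substructure_image:
  assumes "isomorphism F \<phi> A B" "substructure F A"
  shows "substructure F B"
  unfolding substructure_def
proof
  fix i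
  note \<phi> = isomorphismD[OF assms(1)]
  show "closed_under_symbol (F i) B"
  proof (cases "F i")
    case (Fun n m k l f)
    show ?thesis unfolding Fun closed_under_symbol.simps
    proof (intro allI impI)
      fix ys and rs :: "real list" assume ys: "set ys \<subseteq> B \<and> length ys = n \<and> length rs = m"
      then have "ys \<in> lists (\<phi> ` A)" using \<phi>(2) by auto
      then obtain xs where xs: "xs \<in> lists A" "ys = map \<phi> xs" unfolding lists_image by blast
      have "f (ys, rs) = (map \<phi> (fst (f (xs, rs))), snd (f (xs, rs)))"
        using isomorphism_Fun[OF assms(1) Fun, of xs rs] xs ys by auto
      moreover have "set (fst (f (xs, rs))) \<subseteq> A"
        using assms(2)[unfolded substructure_def, rule_format, of i] Fun xs ys by auto
      ultimately show "set (fst (f (ys, rs))) \<subseteq> B" using \<phi>(2) by auto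
    qed
  qed simp
qed

text \<open>Images of substructures are substructures, so minimality gives one inclusion for \<phi>
  and the other one for its inverse.\<close>

lemma isomorphism_image_gen:
  assumes "isomorphism F \<phi> A B" "substructure F A" "S \<subseteq> A"
  shows "\<phi> ` gen F S = gen F (\<phi> ` S)"
proof
  have SA: "gen F S \<subseteq> A" using assms by (intro gen_minimal)
  have sub: "isomorphism F \<phi> (gen F S) (\<phi> ` gen F S)" by (rule isomorphism_restrict[OF assms(1) SA])
  show "gen F (\<phi> ` S) \<subseteq> \<phi> ` gen F S"
    using gen_superset[of S F] by (intro gen_minimal substructure_image[OF sub substructure_gen] image_mono)
  let ?\<psi> = "inv_into A \<phi>"
  note \<phi> = isomorphismD[OF assms(1)]
  have inv: "isomorphism F ?\<psi> B A" by (rule isomorphism_inverse[OF assms(1,2)])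
  have SB: "gen F (\<phi> ` S) \<subseteq> B"
    using \<phi>(2) assms(3) by (intro gen_minimal substructure_image[OF assms(1,2)]) auto
  have "isomorphism F ?\<psi> (gen F (\<phi> ` S)) (?\<psi> ` gen F (\<phi> ` S))" by (rule isomorphism_restrict[OF inv SB])
  then have "substructure F (?\<psi> ` gen F (\<phi> ` S))" by (rule substructure_image) (rule substructure_gen)
  moreover have "S \<subseteq> ?\<psi> ` gen F (\<phi> ` S)"
  proof
    fix x assume "x \<in> S"
    then have "?\<psi> (\<phi> x) = x" using \<phi>(3) assms(3) by (simp add: subset_iff)
    moreover have "\<phi> x \<in> gen F (\<phi> ` S)" by (rule subsetD[OF gen_superset imageI[OF \<open>x \<in> S\<close>]])
    ultimately show "x \<in> ?\<psi> ` gen F (\<phi> ` S)" by (intro image_eqI[of x ?\<psi> "\<phi> x"]) simp_all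
  qed
  ultimately have "gen F S \<subseteq> ?\<psi> ` gen F (\<phi> ` S)" by (intro gen_minimal)
  then have "\<phi> ` gen F S \<subseteq> \<phi> ` ?\<psi> ` gen F (\<phi> ` S)" by (rule image_mono)
  also have "\<dots> = gen F (\<phi> ` S)" by (rule image_inv_into_cancel[OF \<phi>(2) SB])
  finally show "\<phi> ` gen F S \<subseteq> gen F (\<phi> ` S)" .
qed

text \<open>The set on which both maps agree is closed under the functions, since both commute with
  them.\<close>

lemma isomorphism_eq_on_gen:
  assumes "isomorphism F \<phi> A B" "isomorphism F \<psi> A C" "substructure F A" "S \<subseteq> A"
    and eq: "\<And>x. x \<in> S \<Longrightarrow> \<phi> x = \<psi> x" and "x \<in> gen F S"
  shows "\<phi> x = \<psi> x"
proof -
  let ?E = "{x\<in>A. \<phi> x = \<psi> x}"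
  have "substructure F ?E" unfolding substructure_def
  proof
    fix i
    show "closed_under_symbol (F i) ?E"
    proof (cases "F i")
      case (Fun n m k l f)
      show ?thesis unfolding Fun closed_under_symbol.simps
      proof (intro allI impI)
        fix xs and rs :: "real list" assume xs: "set xs \<subseteq> ?E \<and> length xs = n \<and> length rs = m"
        then have A: "set (fst (f (xs, rs))) \<subseteq> A"
          using substructure_Fun[OF assms(3) Fun, of xs rs] xs by blast
        have "map \<phi> xs = map \<psi> xs" using xs by auto
        moreover have "f (map \<phi> xs, rs) = (map \<phi> (fst (f (xs, rs))), snd (f (xs, rs)))"
          "f (map \<psi> xs, rs) = (map \<psi> (fst (f (xs, rs))), snd (f (xs, rs)))"
          using isomorphism_Fun[OF assms(1) Fun, of xs rs] isomorphism_Fun[OF assms(2) Fun, of xs rs] xs by auto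
        ultimately have "map \<phi> (fst (f (xs, rs))) = map \<psi> (fst (f (xs, rs)))"
          by (metis Pair_inject)
        then show "set (fst (f (xs, rs))) \<subseteq> ?E" using A by auto
      qed
    qed simp
  qed
  then have "gen F S \<subseteq> ?E" using assms(4) eq by (intro gen_minimal) auto
  then show ?thesis using assms(6) by blast
qed

section \<open>Extension of dense partial automorphisms\<close>

lemma isometry_continuous:
  fixes g :: "'a::metric_space \<Rightarrow> 'b::metric_space"
  assumes "\<And>x y. dist (g x) (g y) = dist x y"
  shows "continuous_on S g"
  unfolding continuous_on_iff using assms by metis

lemma isometries_eq_on_dense:
  fixes f g :: "'a::metric_space \<Rightarrow> 'b::metric_space"
  assumes "\<And>x y. dist (f x) (f y) = dist x y" "\<And>x y. dist (g x) (g y) = dist x y"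
    and "closure D = UNIV" "\<And>x. x \<in> D \<Longrightarrow> f x = g x"
  shows "f = g"
proof
  fix x
  have "closed {x. f x = g x}"
    using isometry_continuous[of f UNIV] isometry_continuous[of g UNIV] assms(1,2)
    by (intro closed_Collect_eq) auto
  then have "closure D \<subseteq> {x. f x = g x}" using assms(4) by (intro closure_minimal) auto
  then show "f x = g x" using assms(3) by auto
qed

lemma isometry_extends_from_dense:
  fixes \<phi> :: "'a::metric_space \<Rightarrow> 'a"
  assumes "complete (UNIV :: 'a set)" "closure U = UNIV"
    and iso: "\<And>x y. x \<in> U \<Longrightarrow> y \<in> U \<Longrightarrow> dist (\<phi> x) (\<phi> y) = dist x y"
  obtains g where "\<And>x. x \<in> U \<Longrightarrow> g x = \<phi> x" "\<And>x y. dist (g x) (g y) = dist x y"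
proof -
  have "\<exists>u. (\<forall>n. u n \<in> U) \<and> u \<longlonglongrightarrow> x" for x
    using closure_sequential[of x U] assms(2) by auto
  then obtain u where u: "\<And>x n. u x n \<in> U" "\<And>x. u x \<longlonglongrightarrow> x" by metis
  have "\<exists>l. (\<lambda>n. \<phi> (u x n)) \<longlonglongrightarrow> l" for x
  proof -
    have "Cauchy (u x)" using u(2) by (rule LIMSEQ_imp_Cauchy)
    then have "Cauchy (\<lambda>n. \<phi> (u x n))" unfolding Cauchy_def by (simp add: iso u(1))
    then show ?thesis using assms(1) unfolding complete_def by blast
  qed
  then obtain g where g: "\<And>x. (\<lambda>n. \<phi> (u x n)) \<longlonglongrightarrow> g x" by metis
  show thesis
  proof (rule that)
    fix x y
    have "(\<lambda>n. dist (\<phi> (u x n)) (\<phi> (u y n))) \<longlonglongrightarrow> dist (g x) (g y)" by (intro tendsto_dist g)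
    moreover have "(\<lambda>n. dist (\<phi> (u x n)) (\<phi> (u y n))) \<longlonglongrightarrow> dist x y"
      using tendsto_dist[OF u(2)[of x] u(2)[of y]] by (simp add: iso u(1))
    ultimately show "dist (g x) (g y) = dist x y" by (rule LIMSEQ_unique)
  next
    fix x assume "x \<in> U"
    have "(\<lambda>n. dist (\<phi> (u x n)) (\<phi> x)) \<longlonglongrightarrow> 0"
      using tendsto_dist[OF u(2)[of x] tendsto_const[of x]] \<open>x \<in> U\<close> by (simp add: iso u(1))
    then have "(\<lambda>n. \<phi> (u x n)) \<longlonglongrightarrow> \<phi> x" by (rule tendsto_dist_iff[THEN iffD2])
    with g show "g x = \<phi> x" by (rule LIMSEQ_unique)
  qed
qed

locale complete_structure =
  fixes F :: "'a::metric_space mstruct"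
  assumes complete_structure: "complete_metric_structure F"
begin

lemma complete_UNIV: "complete (UNIV :: 'a set)"
  using complete_structure by (simp add: complete_metric_structure_def)

lemma wf: "wf_symbol (F i)"
  using complete_structure by (simp add: complete_metric_structure_def metric_structure_def)

text \<open>\<open>wf_symbol\<close> states the output arities only through the codomain of a
  continuous map.\<close>

lemma Fun_length:
  assumes "F i = Fun n m k l f" "length xs = n" "length rs = m"
  shows "length (fst (f (xs, rs))) = k" "length (snd (f (xs, rs))) = l"
proof -
  have "continuous_map (tuples n) (prod_topology (tuples k) (tuples l)) (\<lambda>xs. f (xs, rs))"
    using wf[of i] assms by simp
  from continuous_map_image_subset_topspace[OF this] assms(2)
  have "f (xs, rs) \<in> topspace (prod_topology (tuples k) (tuples l) :: ('a list \<times> real list) topology)" by auto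
  then show "length (fst (f (xs, rs))) = k" "length (snd (f (xs, rs))) = l"
    by (auto simp: mem_Times_iff)
qed

lemma Fun_limit:
  assumes "F i = Fun n m k l f" "\<And>j. length (X j) = n" "length xs = n" "length rs = m"
    and "\<And>p. p < n \<Longrightarrow> (\<lambda>j. X j ! p) \<longlonglongrightarrow> xs ! p"
  shows "p < k \<Longrightarrow> (\<lambda>j. fst (f (X j, rs)) ! p) \<longlonglongrightarrow> fst (f (xs, rs)) ! p"
    and "p < l \<Longrightarrow> (\<lambda>j. snd (f (X j, rs)) ! p) \<longlonglongrightarrow> snd (f (xs, rs)) ! p"
proof -
  have "continuous_map (tuples n) (prod_topology (tuples k) (tuples l)) (\<lambda>xs. f (xs, rs))"
    using wf[of i] assms by simp
  then have "continuous_map (tuples n) (tuples k) (fst \<circ> (\<lambda>xs. f (xs, rs)))"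
     "continuous_map (tuples n) (tuples l) (snd \<circ> (\<lambda>xs. f (xs, rs)))"
    by (auto simp: continuous_map_pairwise)
  moreover have "limitin (tuples n) X xs sequentially" by (rule limitin_tuplesI) (use assms in auto)
  ultimately have "limitin (tuples k) ((fst \<circ> (\<lambda>xs. f (xs, rs))) \<circ> X) ((fst \<circ> (\<lambda>xs. f (xs, rs))) xs) sequentially"
     "limitin (tuples l) ((snd \<circ> (\<lambda>xs. f (xs, rs))) \<circ> X) ((snd \<circ> (\<lambda>xs. f (xs, rs))) xs) sequentially"
    by (blast intro: continuous_map_limit)+
  from limitin_tuplesD[OF this(1)] limitin_tuplesD[OF this(2)]
  show "p < k \<Longrightarrow> (\<lambda>j. fst (f (X j, rs)) ! p) \<longlonglongrightarrow> fst (f (xs, rs)) ! p"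
    "p < l \<Longrightarrow> (\<lambda>j. snd (f (X j, rs)) ! p) \<longlonglongrightarrow> snd (f (xs, rs)) ! p"
    by auto
qed

lemma Rel_length:
  assumes "F i = Rel n m R" "(xs, rs) \<in> R"
  shows "length xs = n" "length rs = m"
proof -
  have "closedin (prod_topology (tuples n) (tuples m)) R" using wf[of i] assms by simp
  then have "(xs, rs) \<in> topspace (prod_topology (tuples n) (tuples m))" using closedin_subset assms(2) by blast
  then show "length xs = n" "length rs = m" by auto
qed

lemma Rel_limit:
  assumes "F i = Rel n m R" "\<And>j. (X j, Y j) \<in> R" "length xs = n" "length rs = m"
    and "\<And>p. p < n \<Longrightarrow> (\<lambda>j. X j ! p) \<longlonglongrightarrow> xs ! p"
    and "\<And>p. p < m \<Longrightarrow> (\<lambda>j. Y j ! p) \<longlonglongrightarrow> rs ! p"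
  shows "(xs, rs) \<in> R"
proof (rule limitin_closedin)
  show "closedin (prod_topology (tuples n) (tuples m)) R" using wf[of i] assms by simp
  show "limitin (prod_topology (tuples n) (tuples m)) (\<lambda>j. (X j, Y j)) (xs, rs) sequentially"
    using Rel_length[OF assms(1,2)] assms(3-) by (intro limitin_prod_topologyI limitin_tuplesI)
qed (use assms(2) in auto)

text \<open>Closed relations survive the passage from a dense substructure to X only if each relation has a
  dense set of tuples inside the substructure.\<close>

definition witnessing :: "'a set \<Rightarrow> bool" where
  "witnessing D \<longleftrightarrow> closure D = UNIV \<and>
     (\<forall>i n m R xs rs e. F i = Rel n m R \<and> (xs, rs) \<in> R \<and> e > 0 \<longrightarrow>
        (\<exists>ys us. (ys, us) \<in> R \<and> set ys \<subseteq> D \<and> (\<forall>p<n. dist (ys ! p) (xs ! p) < e) \<and> (\<forall>p<m. dist (us ! p) (rs ! p) < e)))"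

lemma witnessing_mono: "witnessing D \<Longrightarrow> D \<subseteq> D' \<Longrightarrow> witnessing D'"
  unfolding witnessing_def
proof (elim conjE, intro conjI)
  assume "closure D = UNIV" "D \<subseteq> D'"
  then show "closure D' = UNIV" using closure_mono[of D D'] by auto
next
  assume "D \<subseteq> D'" and wit: "\<forall>i n m R xs rs e. F i = Rel n m R \<and> (xs, rs) \<in> R \<and> e > 0 \<longrightarrow>
        (\<exists>ys us. (ys, us) \<in> R \<and> set ys \<subseteq> D \<and> (\<forall>p<n. dist (ys ! p) (xs ! p) < e) \<and> (\<forall>p<m. dist (us ! p) (rs ! p) < e))"
  show "\<forall>i n m R xs rs e. F i = Rel n m R \<and> (xs, rs) \<in> R \<and> e > 0 \<longrightarrow>
        (\<exists>ys us. (ys, us) \<in> R \<and> set ys \<subseteq> D' \<and> (\<forall>p<n. dist (ys ! p) (xs ! p) < e) \<and> (\<forall>p<m. dist (us ! p) (rs ! p) < e))"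
  proof (intro allI impI)
    fix i n m R xs rs and e :: real assume "F i = Rel n m R \<and> (xs, rs) \<in> R \<and> e > 0"
    from wit[rule_format, OF this] obtain ys us where "(ys, us) \<in> R" "set ys \<subseteq> D"
      "\<forall>p<n. dist (ys ! p) (xs ! p) < e" "\<forall>p<m. dist (us ! p) (rs ! p) < e" by auto
    moreover have "set ys \<subseteq> D'" using calculation(2) \<open>D \<subseteq> D'\<close> by (rule order_trans)
    ultimately show "\<exists>ys us. (ys, us) \<in> R \<and> set ys \<subseteq> D' \<and> (\<forall>p<n. dist (ys ! p) (xs ! p) < e) \<and> (\<forall>p<m. dist (us ! p) (rs ! p) < e)"
      by (intro exI conjI)
  qed
qed

text \<open>For each relation, each pair of tuples from countable dense sets and each radius
  1/(j+1), one point of the relation within that radius is selected whenever there is one. Every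
  point of the relation is then approximated by selected ones.\<close>

lemma witnessing_exists: "\<exists>D. countable D \<and> witnessing D"
proof -
  have "separable_space (euclidean :: 'a topology)"
    using complete_structure by (simp add: complete_metric_structure_def metric_structure_def)
  then obtain D0 :: "'a set" where D0: "countable D0" "closure D0 = UNIV"
    by (auto simp: separable_space_def)
  define Q where "Q = (\<rat> :: real set)"
  have Q: "countable Q" "closure Q = UNIV"
    by (auto simp: Q_def countable_rat Rats_closure_real)
  define near where "near R ds qs e z \<longleftrightarrow> z \<in> R \<and> (\<forall>p<length ds. dist (fst z ! p) (ds ! p) < e) \<and>
      (\<forall>p<length qs. dist (snd z ! p) (qs ! p) < e)"
    for R and ds :: "'a list" and qs :: "real list" and e :: real and z
  \<comment> \<open>Arbitrary when R has no point near the given data; such extra points do no harm,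
    since W only has to be countable.\<close>
  define wit where "wit R ds qs e = (SOME z. near R ds qs e z)" for R ds qs e
  define W where "W = (\<Union>i. \<Union>ds\<in>lists D0. \<Union>qs\<in>lists Q. \<Union>j. case F i of
      Rel n m R \<Rightarrow> set (fst (wit R ds qs (1 / real (Suc j)))) | _ \<Rightarrow> {})"
  have "countable W"
    unfolding W_def using D0 Q by (intro countable_UN countable_lists) (auto split: msymbol.split intro: countable_finite)
  moreover have "witnessing (D0 \<union> W)"
    unfolding witnessing_def
  proof (intro conjI allI impI, goal_cases)
    case 1
    show ?case using D0(2) closure_mono[of D0 "D0 \<union> W"] by auto
  next
    case (2 i n m R xs rs e)
    then have F: "F i = Rel n m R" and R: "(xs, rs) \<in> R" and "e > 0" by auto
    note len = Rel_length[OF F R]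
    \<comment> \<open>One half of e is spent on approximating the coordinates by D0 and the
      rationals, the other on the selected point of R.\<close>
    obtain j where j: "1 / real (Suc j) < e / 2"
      using \<open>e > 0\<close> nat_approx_posE[of "e / 2"] by (auto simp: inverse_eq_divide)
    let ?d = "1 / real (Suc j)"
    have "\<exists>d\<in>D0. dist d x < ?d" for x
      using D0(2) closure_approachable[of x D0] by auto
    then obtain ad where ad: "\<And>x. ad x \<in> D0 \<and> dist (ad x) x < ?d" by metis
    have "\<exists>d\<in>Q. dist d x < ?d" for x
      using Q(2) closure_approachable[of x Q] by auto
    then obtain aq where aq: "\<And>x. aq x \<in> Q \<and> dist (aq x) x < ?d" by metis
    let ?ds = "map ad xs" and ?qs = "map aq rs"
    have "near R ?ds ?qs ?d (xs, rs)"
      using R ad aq by (auto simp: near_def dist_commute)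
    then have near: "near R ?ds ?qs ?d (wit R ?ds ?qs ?d)"
      unfolding wit_def by (rule someI)
    have "set (fst (wit R ?ds ?qs ?d)) \<subseteq> W"
    proof
      fix y assume "y \<in> set (fst (wit R ?ds ?qs ?d))"
      then have "y \<in> (case F i of Rel n m R \<Rightarrow> set (fst (wit R ?ds ?qs ?d)) | _ \<Rightarrow> {})" by (simp add: F)
      moreover have "?ds \<in> lists D0" "?qs \<in> lists Q" using ad aq by auto
      ultimately show "y \<in> W" unfolding W_def by blast
    qed
    moreover have "dist (fst (wit R ?ds ?qs ?d) ! p) (xs ! p) < e" if "p < n" for p
    proof -
      have "dist (fst (wit R ?ds ?qs ?d) ! p) (ad (xs ! p)) < ?d" "dist (ad (xs ! p)) (xs ! p) < ?d"
        using near ad that len by (auto simp: near_def)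
      then show ?thesis using j dist_triangle[of "fst (wit R ?ds ?qs ?d) ! p" "xs ! p" "ad (xs ! p)"] by linarith
    qed
    moreover have "dist (snd (wit R ?ds ?qs ?d) ! p) (rs ! p) < e" if "p < m" for p
    proof -
      have "dist (snd (wit R ?ds ?qs ?d) ! p) (aq (rs ! p)) < ?d" "dist (aq (rs ! p)) (rs ! p) < ?d"
        using near aq that len by (auto simp: near_def)
      then show ?thesis using j dist_triangle[of "snd (wit R ?ds ?qs ?d) ! p" "rs ! p" "aq (rs ! p)"] by linarith
    qed
    moreover have "(fst (wit R ?ds ?qs ?d), snd (wit R ?ds ?qs ?d)) \<in> R" using near by (simp add: near_def)
    ultimately show ?case by blast
  qed
  ultimately show ?thesis using D0(1) by (meson countable_Un)
qed

lemma witnessing_sequence: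
  assumes "witnessing D" "F i = Rel n m R" "(xs, rs) \<in> R"
  obtains X Y where "\<And>j. (X j, Y j) \<in> R" "\<And>j. set (X j) \<subseteq> D"
    "\<And>p. p < n \<Longrightarrow> (\<lambda>j. X j ! p) \<longlonglongrightarrow> xs ! p" "\<And>p. p < m \<Longrightarrow> (\<lambda>j. Y j ! p) \<longlonglongrightarrow> rs ! p"
proof -
  have "\<exists>ys us. (ys, us) \<in> R \<and> set ys \<subseteq> D \<and> (\<forall>p<n. dist (ys ! p) (xs ! p) < inverse (real (Suc j))) \<and>
      (\<forall>p<m. dist (us ! p) (rs ! p) < inverse (real (Suc j)))" for j
    using assms(1)[unfolded witnessing_def, THEN conjunct2, rule_format, of i n m R xs rs "inverse (real (Suc j))"] assms(2,3)
    by (simp del: of_nat_Suc)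
  then obtain X Y where XY: "\<And>j. (X j, Y j) \<in> R" "\<And>j. set (X j) \<subseteq> D"
    "\<And>j p. p < n \<Longrightarrow> dist (X j ! p) (xs ! p) < inverse (real (Suc j))"
    "\<And>j p. p < m \<Longrightarrow> dist (Y j ! p) (rs ! p) < inverse (real (Suc j))" by metis
  show thesis
  proof (rule that[of X Y])
    show "(\<lambda>j. X j ! p) \<longlonglongrightarrow> xs ! p" if "p < n" for p
      by (rule tendsto_dist_iff[THEN iffD2], rule tendsto_sandwich[OF _ _ tendsto_const LIMSEQ_inverse_real_of_nat];
          intro always_eventually allI)
        (auto intro: less_imp_le XY(3)[OF that] simp del: of_nat_Suc)
    show "(\<lambda>j. Y j ! p) \<longlonglongrightarrow> rs ! p" if "p < m" for p
      by (rule tendsto_dist_iff[THEN iffD2], rule tendsto_sandwich[OF _ _ tendsto_const LIMSEQ_inverse_real_of_nat];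
          intro always_eventually allI)
        (auto intro: less_imp_le XY(4)[OF that] simp del: of_nat_Suc)
  qed (use XY in auto)
qed

text \<open>A point of R is a limit of points of R whose X-part lies in U; \<phi> keeps these in R,
  and R is closed.\<close>

lemma Rel_extends:
  assumes "witnessing U" "isomorphism F \<phi> U V" "F i = Rel n m R" "(xs, rs) \<in> R"
    and "\<And>x. x \<in> U \<Longrightarrow> g x = \<phi> x" "\<And>x y. dist (g x) (g y) = dist x y"
  shows "(map g xs, rs) \<in> R"
proof -
  obtain X Y where X: "\<And>j. (X j, Y j) \<in> R" "\<And>j. set (X j) \<subseteq> U"
    "\<And>p. p < n \<Longrightarrow> (\<lambda>j. X j ! p) \<longlonglongrightarrow> xs ! p" "\<And>p. p < m \<Longrightarrow> (\<lambda>j. Y j ! p) \<longlonglongrightarrow> rs ! p"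
    using witnessing_sequence[OF assms(1,3,4)] by blast
  note lenX = Rel_length[OF assms(3) X(1)] and len = Rel_length[OF assms(3,4)]
  have "map g (X j) = map \<phi> (X j)" for j using X(2)[of j] assms(5) by auto
  then have "(map g (X j), Y j) \<in> R" for j
    using isomorphism_Rel[OF assms(2,3) X(2)[of j] lenX] X(1)[of j] by metis
  moreover have "(\<lambda>j. map g (X j) ! p) \<longlonglongrightarrow> map g xs ! p" if "p < n" for p
  proof -
    have "isCont g (xs ! p)" using isometry_continuous[OF assms(6), of UNIV]
      by (simp add: continuous_on_eq_continuous_at)
    then show ?thesis using isCont_tendsto_compose[OF _ X(3)[OF that]] that lenX(1) len(1) by simp
  qed
  ultimately show ?thesis using X(4) len(1)
    by (intro Rel_limit[OF assms(3), of "\<lambda>j. map g (X j)" Y _ rs, OF _ _ len(2)]) simp_all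
qed

text \<open>Relations are preserved because U is witnessing, and reflected because the extended
  inverse preserves them, for which V must be witnessing. Functions pass to the limit by continuity:
  approximating tuples can be taken in U, and their values stay in the substructure U.\<close>

lemma isomorphism_extends_to_automorphism:
  assumes "witnessing U" "witnessing V" "isomorphism F \<phi> U V" "substructure F U"
  obtains g where "isomorphism F g UNIV UNIV" "\<And>x. x \<in> U \<Longrightarrow> g x = \<phi> x"
proof -
  note \<phi> = isomorphismD[OF assms(3)]
  let ?\<psi> = "inv_into U \<phi>"
  have \<psi>: "isomorphism F ?\<psi> V U" by (rule isomorphism_inverse[OF assms(3,4)])
  have dense: "closure U = UNIV" "closure V = UNIV" using assms(1,2) by (auto simp: witnessing_def)
  obtain g where g: "\<And>x. x \<in> U \<Longrightarrow> g x = \<phi> x" "\<And>x y. dist (g x) (g y) = dist x y"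
    using isometry_extends_from_dense[OF complete_UNIV dense(1) \<phi>(4)] by blast
  obtain g' where g': "\<And>x. x \<in> V \<Longrightarrow> g' x = ?\<psi> x" "\<And>x y. dist (g' x) (g' y) = dist x y"
    using isometry_extends_from_dense[OF complete_UNIV dense(2) isomorphismD(4)[OF \<psi>]] by blast
  have "g' \<circ> g = id"
    by (rule isometries_eq_on_dense[OF _ _ dense(1)]) (use g g' \<phi>(2,3) in auto)
  moreover have "g \<circ> g' = id"
    by (rule isometries_eq_on_dense[OF _ _ dense(2)])
      (use g g' \<phi>(2) in \<open>auto simp: inv_into_into f_inv_into_f\<close>)
  ultimately have "bij g" by (rule o_bij)
  moreover have "preserves_symbol (F i) g UNIV" for i
  proof (cases "F i")
    case (Rel n m R)
    have "(map g xs, rs) \<in> R \<longleftrightarrow> (xs, rs) \<in> R" for xs rs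
    proof
      assume "(xs, rs) \<in> R"
      then show "(map g xs, rs) \<in> R" using Rel_extends[OF assms(1,3) Rel _ g] by blast
    next
      assume "(map g xs, rs) \<in> R"
      then have "(map g' (map g xs), rs) \<in> R" using Rel_extends[OF assms(2) \<psi> Rel _ g'] by blast
      then show "(xs, rs) \<in> R" using \<open>g' \<circ> g = id\<close> by simp
    qed
    then show ?thesis by (simp add: Rel)
  next
    case (Fun n m k l f)
    have "f (map g xs, rs) = (map g (fst (f (xs, rs))), snd (f (xs, rs)))"
      if len: "length xs = n" "length rs = m" for xs rs
    proof -
      have "\<exists>u. (\<forall>n. u n \<in> U) \<and> u \<longlonglongrightarrow> x" for x
        using closure_sequential[of x U] dense by auto
      then obtain u where u: "\<And>x j. u x j \<in> U" "\<And>x. u x \<longlonglongrightarrow> x" by metis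
      define X where "X j = map (\<lambda>x. u x j) xs" for j
      have X: "length (X j) = n" "set (X j) \<subseteq> U" "map g (X j) = map \<phi> (X j)" for j
        using u(1) len g(1) by (auto simp: X_def)
      have cont: "(\<lambda>j. g (Z j)) \<longlonglongrightarrow> g z" if "Z \<longlonglongrightarrow> z" for Z z
        using isometry_continuous[OF g(2), of UNIV] that
        by (intro isCont_tendsto_compose[of z g]) (simp_all add: continuous_on_eq_continuous_at)
      have lim: "(\<lambda>j. X j ! p) \<longlonglongrightarrow> xs ! p" if "p < n" for p
        using u(2) that len by (simp add: X_def)
      then have limg: "(\<lambda>j. map g (X j) ! p) \<longlonglongrightarrow> map g xs ! p" if "p < n" for p
        using cont[OF lim[OF that]] that len X(1) by simp
      have fX: "f (map g (X j), rs) = (map g (fst (f (X j, rs))), snd (f (X j, rs)))" for j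
      proof -
        have "set (fst (f (X j, rs))) \<subseteq> U" using substructure_Fun[OF assms(4) Fun X(2,1) len(2)] .
        then have "map g (fst (f (X j, rs))) = map \<phi> (fst (f (X j, rs)))" using g(1) by auto
        then show ?thesis using isomorphism_Fun[OF assms(3) Fun X(2,1) len(2), of j] X(3)[of j] by metis
      qed
      note l1 = Fun_limit[OF Fun X(1) len lim]
      have gX: "length (map g (X j)) = n" "length (map g xs) = n" for j using X(1) len by simp_all
      note l2 = Fun_limit[OF Fun gX len(2) limg]
      note lenf = Fun_length[OF Fun _ len(2)]
      show ?thesis
      proof (rule prod_eqI; rule nth_equalityI)
        show "length (fst (f (map g xs, rs))) = length (fst (map g (fst (f (xs, rs))), snd (f (xs, rs))))"
          "length (snd (f (map g xs, rs))) = length (snd (map g (fst (f (xs, rs))), snd (f (xs, rs))))"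
          using lenf len by simp_all
        fix p assume "p < length (fst (f (map g xs, rs)))"
        then have p: "p < k" using lenf len by simp
        have "(\<lambda>j. fst (f (map g (X j), rs)) ! p) \<longlonglongrightarrow> fst (f (map g xs, rs)) ! p"
          using l2(1)[of p] p by simp
        moreover have "fst (f (map g (X j), rs)) ! p = g (fst (f (X j, rs)) ! p)" for j
          using fX lenf(1)[OF X(1)] p by simp
        ultimately have "(\<lambda>j. g (fst (f (X j, rs)) ! p)) \<longlonglongrightarrow> fst (f (map g xs, rs)) ! p" by simp
        with cont[OF l1(1)[OF _ p]] have "g (fst (f (xs, rs)) ! p) = fst (f (map g xs, rs)) ! p"
          by (rule LIMSEQ_unique)
        then show "fst (f (map g xs, rs)) ! p = fst (map g (fst (f (xs, rs))), snd (f (xs, rs))) ! p"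
          using lenf(1)[OF len(1)] p by simp
      next
        fix p assume "p < length (snd (f (map g xs, rs)))"
        then have p: "p < l" using lenf len by simp
        have "(\<lambda>j. snd (f (map g (X j), rs)) ! p) \<longlonglongrightarrow> snd (f (map g xs, rs)) ! p"
          using l2(2)[of p] p by simp
        then have "(\<lambda>j. snd (f (X j, rs)) ! p) \<longlonglongrightarrow> snd (f (map g xs, rs)) ! p" by (simp add: fX)
        with l1(2)[OF _ p] have "snd (f (xs, rs)) ! p = snd (f (map g xs, rs)) ! p"
          by (rule LIMSEQ_unique)
        then show "snd (f (map g xs, rs)) ! p = snd (map g (fst (f (xs, rs))), snd (f (xs, rs))) ! p"
          by simp
      qed
    qed
    then show ?thesis by (simp add: Fun)
  qed
  ultimately have "isomorphism F g UNIV UNIV" using g(2) by (simp add: isomorphism_def)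
  then show thesis using that g(1) by blast
qed

text \<open>The union of the chain is an isomorphism between two sets that contain D and hence are
  witnessing; this is why the ranges, and not only the domains, must exhaust D.\<close>

lemma chain_limit:
  assumes D: "witnessing D" and \<theta>: "\<And>n. isomorphism F (\<theta> n) (A n) (B n)" and A: "\<And>n. substructure F (A n)"
    and A_mono: "\<And>n. A n \<subseteq> A (Suc n)" and coh: "\<And>n x. x \<in> A n \<Longrightarrow> \<theta> (Suc n) x = \<theta> n x"
    and cover: "D \<subseteq> (\<Union>n. A n)" "D \<subseteq> (\<Union>n. B n)"
  obtains g where "isomorphism F g UNIV UNIV" "\<And>n x. x \<in> A n \<Longrightarrow> g x = \<theta> n x"
proof -
  let ?U = "\<Union>n. A n" and ?V = "\<Union>n. B n"
  have mono: "A n \<subseteq> A k" if "n \<le> k" for n k using that A_mono by (rule lift_Suc_mono_le[rotated])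
  have coh': "\<theta> k x = \<theta> n x" if "n \<le> k" "x \<in> A n" for n k x
    using that
  proof (induction k)
    case (Suc k)
    then show ?case using coh[of x k] mono[of n k] by (cases "n = Suc k") auto
  qed simp
  \<comment> \<open>By coherence every stage containing x gives the same value.\<close>
  define \<phi> where "\<phi> x = \<theta> (LEAST n. x \<in> A n) x" for x
  have \<phi>: "\<phi> x = \<theta> n x" if "x \<in> A n" for n x
    using coh'[of "LEAST n. x \<in> A n" n x] LeastI[of "\<lambda>n. x \<in> A n" n] Least_le[of "\<lambda>n. x \<in> A n" n] that
    by (simp add: \<phi>_def)
  have \<phi>_iso: "isomorphism F \<phi> (A n) (B n)" for n
    by (rule isomorphism_cong[OF \<theta> A \<phi>])
  have fin: "\<exists>n. S \<subseteq> A n" if "finite S" "S \<subseteq> ?U" for S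
    using that
  proof (induction S)
    case (insert x S)
    then obtain n k where "S \<subseteq> A n" "x \<in> A k" by auto
    then have "insert x S \<subseteq> A (max n k)" using mono[of n "max n k"] mono[of k "max n k"] by auto
    then show ?case by blast
  qed simp
  have "isomorphism F \<phi> ?U ?V"
    unfolding isomorphism_def
  proof (intro conjI ballI allI)
    have dist: "dist (\<phi> x) (\<phi> y) = dist x y" if xy: "x \<in> ?U" "y \<in> ?U" for x y
    proof -
      obtain n where "{x, y} \<subseteq> A n" using fin[of "{x, y}"] xy by auto
      then show ?thesis using isomorphismD(4)[OF \<phi>_iso[of n]] by auto
    qed
    then show "dist (\<phi> x) (\<phi> y) = dist x y" if "x \<in> ?U" "y \<in> ?U" for x y using that by blast
    have "inj_on \<phi> ?U"
    proof (rule inj_onI)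
      fix x y assume "x \<in> ?U" "y \<in> ?U" "\<phi> x = \<phi> y"
      then show "x = y" using dist[of x y] by simp
    qed
    moreover have "\<phi> ` ?U = ?V" using isomorphismD(2)[OF \<phi>_iso] by (simp add: image_UN)
    ultimately show "bij_betw \<phi> ?U ?V" by (simp add: bij_betw_def)
    show "preserves_symbol (F i) \<phi> ?U" for i
    proof (cases "F i")
      case (Rel n m R)
      show ?thesis unfolding Rel preserves_symbol.simps
      proof (intro allI impI)
        fix xs and rs :: "real list" assume xs: "set xs \<subseteq> ?U \<and> length xs = n \<and> length rs = m"
        then obtain j where "set xs \<subseteq> A j" using fin[of "set xs"] by auto
        then show "(map \<phi> xs, rs) \<in> R \<longleftrightarrow> (xs, rs) \<in> R" using isomorphism_Rel[OF \<phi>_iso Rel] xs by blast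
      qed
    next
      case (Fun n m k l f)
      show ?thesis unfolding Fun preserves_symbol.simps
      proof (intro allI impI)
        fix xs and rs :: "real list" assume xs: "set xs \<subseteq> ?U \<and> length xs = n \<and> length rs = m"
        then obtain j where "set xs \<subseteq> A j" using fin[of "set xs"] by auto
        then show "f (map \<phi> xs, rs) = (map \<phi> (fst (f (xs, rs))), snd (f (xs, rs)))"
          using isomorphism_Fun[OF \<phi>_iso Fun] xs by blast
      qed
    qed
  qed
  moreover have "substructure F ?U"
    unfolding substructure_def
  proof
    fix i show "closed_under_symbol (F i) ?U"
    proof (cases "F i")
      case (Fun n m k l f)
      show ?thesis unfolding Fun closed_under_symbol.simps
      proof (intro allI impI)
        fix xs and rs :: "real list" assume xs: "set xs \<subseteq> ?U \<and> length xs = n \<and> length rs = m"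
        then obtain j where "set xs \<subseteq> A j" using fin[of "set xs"] by auto
        then show "set (fst (f (xs, rs))) \<subseteq> ?U" using substructure_Fun[OF A Fun, of xs j rs] xs by blast
      qed
    qed simp
  qed
  ultimately obtain g where "isomorphism F g UNIV UNIV" "\<And>x. x \<in> ?U \<Longrightarrow> g x = \<phi> x"
    using isomorphism_extends_to_automorphism[OF witnessing_mono[OF D cover(1)] witnessing_mono[OF D cover(2)]] by blast
  then show thesis using that \<phi> by (metis UN_I UNIV_I)
qed

end

section \<open>Homogeneity\<close>

context complete_structure begin

section \<open>Terms and quantifier-free types\<close>

definition term_values :: "'a list \<Rightarrow> 'a set \<Rightarrow> 'a set" where
  "term_values c A = {xval F c t |t. wf_xterm F (length c) A t}"

lemma xval_in_substructure:
  assumes "substructure F N" "set c \<subseteq> N" "A \<subseteq> N" "wf_xterm F (length c) A t"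
  shows "xval F c t \<in> N"
proof -
  \<comment> \<open>The induction runs over both sorts of terms; nothing has to be known about real
    values, hence the trivial claim for u.\<close>
  have "wf_xterm F (length c) A t \<Longrightarrow> xval F c t \<in> N" and "u = u" for t and u :: "'a rterm"
  proof (induction t and u)
    case (Var i)
    then show ?case using assms(2) by auto
  next
    case (Par a)
    then show ?case using assms(3) by auto
  next
    case (XApp i j ts us)
    obtain k l f where F: "F i = Fun (length ts) (length us) k l f" and "j < k" using XApp.prems by auto
    let ?xs = "map (xval F c) ts" and ?rs = "map (rval F c) us"
    have "set ?xs \<subseteq> N" using XApp by (auto simp: list_all_iff)
    then have "set (fst (f (?xs, ?rs))) \<subseteq> N"
      by (rule substructure_Fun[OF assms(1) F]) simp_all
    moreover have "length (fst (f (?xs, ?rs))) = k" using Fun_length[OF F] by simp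
    ultimately have "fst (f (?xs, ?rs)) ! j \<in> N" using \<open>j < k\<close> by (metis nth_mem subsetD)
    then show ?case using F by simp
  qed auto
  then show ?thesis using assms(4) by blast
qed

lemma term_tuple:
  assumes "set xs \<subseteq> term_values c A"
  obtains ts where "xs = map (xval F c) ts" "list_all (wf_xterm F (length c) A) ts"
proof -
  have "xs \<in> lists (xval F c ` Collect (wf_xterm F (length c) A))"
    using assms by (auto simp: term_values_def)
  then obtain ts where "xs = map (xval F c) ts" "ts \<in> lists (Collect (wf_xterm F (length c) A))"
    unfolding lists_image by blast
  then show thesis using that by (auto simp: list_all_iff)
qed

lemma const_tuple: "map (rval F c) (map Const rs) = rs" "list_all (wf_rterm F n A) (map Const rs)"
  by (simp_all add: o_def list_all_iff)

text \<open>Closure under the functions rests on \<open>Const\<close>: arbitrary real arguments can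
  be written into a term.\<close>

lemma term_values_eq_gen: "term_values c A = gen F (set c \<union> A)"
proof
  show "term_values c A \<subseteq> gen F (set c \<union> A)"
  proof
    fix x assume "x \<in> term_values c A"
    then obtain t where t: "x = xval F c t" "wf_xterm F (length c) A t" by (auto simp: term_values_def)
    have "set c \<union> A \<subseteq> gen F (set c \<union> A)" by (rule gen_superset)
    then show "x \<in> gen F (set c \<union> A)"
      unfolding t(1) by (intro xval_in_substructure[OF substructure_gen _ _ t(2)]) auto
  qed
  show "gen F (set c \<union> A) \<subseteq> term_values c A"
  proof (rule gen_minimal)
    show "set c \<union> A \<subseteq> term_values c A"
    proof
      fix x assume "x \<in> set c \<union> A"
      then consider i where "i < length c" "x = c ! i" | "x \<in> A" by (auto simp: in_set_conv_nth)
      then show "x \<in> term_values c A"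
      proof cases
        case 1
        then show ?thesis by (auto simp: term_values_def intro!: exI[of _ "Var i"])
      next
        case 2
        then show ?thesis by (auto simp: term_values_def intro!: exI[of _ "Par x"])
      qed
    qed
    show "substructure F (term_values c A)"
      unfolding substructure_def
    proof
      fix i show "closed_under_symbol (F i) (term_values c A)"
      proof (cases "F i")
        case (Fun n m k l f)
        show ?thesis unfolding Fun closed_under_symbol.simps
        proof (intro allI impI subsetI)
          fix xs and rs :: "real list" and y
          assume xs: "set xs \<subseteq> term_values c A \<and> length xs = n \<and> length rs = m" and y: "y \<in> set (fst (f (xs, rs)))"
          obtain ts where ts: "xs = map (xval F c) ts" "list_all (wf_xterm F (length c) A) ts"
            using term_tuple xs by blast
          obtain j where j: "j < k" "y = fst (f (xs, rs)) ! j"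
            using y Fun_length[OF Fun, of xs rs] xs by (auto simp: in_set_conv_nth)
          let ?t = "XApp i j ts (map Const rs)"
          have "wf_xterm F (length c) A ?t" using ts xs j Fun const_tuple(2) by auto
          moreover have "xval F c ?t = y" using ts j Fun by (simp add: o_def)
          ultimately show "y \<in> term_values c A" by (auto simp: term_values_def intro!: exI[of _ ?t])
        qed
      qed simp
    qed
  qed
qed

lemma qftp_eq_length:
  assumes "qftp F c' a = qftp F c a"
  shows "length c' = length c"
proof (rule ccontr)
  have iff: "EqX (Var i) (Var i) \<in> qftp F d a \<longleftrightarrow> i < length d" for i d by (simp add: qftp_def)
  assume "length c' \<noteq> length c"
  then show False using iff[of "length c" c] iff[of "length c" c'] iff[of "length c'" c] iff[of "length c'" c'] assms
    by simp
qed

text \<open>Terms name the elements of \<open>gen F (set c)\<close>, and the map re-evaluates a name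
  at c'. Equality of types makes the result independent of the name; formulas comparing a real term
  with a constant transfer distances and real-valued outputs.\<close>

lemma qftp_eq_isomorphism:
  assumes eq: "qftp F c' a = qftp F c a" and a: "set a \<subseteq> gen F (set c)"
  obtains \<phi> where "isomorphism F \<phi> (gen F (set c)) (gen F (set c'))" "\<And>x. x \<in> gen F (set a) \<Longrightarrow> \<phi> x = x"
proof -
  note len = qftp_eq_length[OF eq]
  let ?wf = "wf_xterm F (length c) (set a)"
  have tr: "sat F c' p \<longleftrightarrow> sat F c p" if "wf_qf F (length c) (set a) p" for p
  proof -
    have "p \<in> qftp F c' a \<longleftrightarrow> p \<in> qftp F c a" using eq by simp
    then show ?thesis using that len by (simp add: qftp_def)
  qed
  define \<phi> where "\<phi> x = xval F c' (SOME t. ?wf t \<and> xval F c t = x)" for x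
  have \<phi>: "\<phi> (xval F c t) = xval F c' t" if "?wf t" for t
  proof -
    let ?s = "SOME s. ?wf s \<and> xval F c s = xval F c t"
    have "?wf ?s \<and> xval F c ?s = xval F c t" by (rule someI[of _ t]) (simp add: that)
    then show ?thesis using tr[of "EqX ?s t"] that by (simp add: \<phi>_def)
  qed
  let ?A = "term_values c (set a)" and ?B = "term_values c' (set a)"
  have map\<phi>: "map \<phi> (map (xval F c) ts) = map (xval F c') ts" if "list_all ?wf ts" for ts
    using that \<phi> by (auto simp: list_all_iff)
  have dist: "dist (\<phi> x) (\<phi> y) = dist x y" if "x \<in> ?A" "y \<in> ?A" for x y
  proof -
    obtain s t where "x = xval F c s" "?wf s" "y = xval F c t" "?wf t" using \<open>x \<in> ?A\<close> \<open>y \<in> ?A\<close> by (auto simp: term_values_def)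
    then show ?thesis using tr[of "EqR (Dist s t) (Const (dist x y))"] \<phi> by simp
  qed
  have "isomorphism F \<phi> ?A ?B"
    unfolding isomorphism_def
  proof (intro conjI ballI allI)
    have "inj_on \<phi> ?A"
    proof (rule inj_onI)
      fix x y assume "x \<in> ?A" "y \<in> ?A" "\<phi> x = \<phi> y"
      then show "x = y" using dist[of x y] by simp
    qed
    moreover have "\<phi> ` ?A = ?B"
    proof -
      have "?A = xval F c ` Collect ?wf" "?B = xval F c' ` Collect ?wf"
        by (auto simp: term_values_def len)
      moreover have "\<phi> ` xval F c ` Collect ?wf = xval F c' ` Collect ?wf"
        unfolding image_image by (rule image_cong) (simp_all add: \<phi>)
      ultimately show ?thesis by simp
    qed
    ultimately show "bij_betw \<phi> ?A ?B" by (simp add: bij_betw_def)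
    show "dist (\<phi> x) (\<phi> y) = dist x y" if "x \<in> ?A" "y \<in> ?A" for x y using dist that .
    show "preserves_symbol (F i) \<phi> ?A" for i
    proof (cases "F i")
      case (Rel n m R)
      show ?thesis unfolding Rel preserves_symbol.simps
      proof (intro allI impI)
        fix xs and rs :: "real list" assume xs: "set xs \<subseteq> ?A \<and> length xs = n \<and> length rs = m"
        obtain ts where ts: "xs = map (xval F c) ts" "list_all ?wf ts" using term_tuple xs by blast
        have "(map (xval F c') ts, rs) \<in> R \<longleftrightarrow> (map (xval F c) ts, rs) \<in> R"
          using tr[of "Atom i ts (map Const rs)"] ts xs Rel const_tuple(2) by (simp add: o_def)
        then show "(map \<phi> xs, rs) \<in> R \<longleftrightarrow> (xs, rs) \<in> R"
          using map\<phi>[OF ts(2)] ts(1) by metis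
      qed
    next
      case (Fun n m k l f)
      show ?thesis unfolding Fun preserves_symbol.simps
      proof (intro allI impI)
        fix xs and rs :: "real list" assume xs: "set xs \<subseteq> ?A \<and> length xs = n \<and> length rs = m"
        obtain ts where ts: "xs = map (xval F c) ts" "list_all ?wf ts" using term_tuple xs by blast
        let ?us = "map Const rs :: 'a rterm list"
        have F: "F i = Fun (length ts) (length ?us) k l f" using Fun xs ts by simp
        have \<phi>xs: "map \<phi> xs = map (xval F c') ts" using map\<phi>[OF ts(2)] ts(1) by simp
        note lenf = Fun_length[OF Fun, of xs rs] Fun_length[OF Fun, of "map \<phi> xs" rs]
        have "fst (f (map \<phi> xs, rs)) ! j = \<phi> (fst (f (xs, rs)) ! j)" if "j < k" for j
        proof -
          have "?wf (XApp i j ts ?us)" using ts F that const_tuple(2) by auto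
          from \<phi>[OF this] show ?thesis unfolding \<phi>xs using F ts(1) by (simp add: o_def)
        qed
        moreover have "snd (f (map \<phi> xs, rs)) ! j = snd (f (xs, rs)) ! j" if "j < l" for j
        proof -
          have "wf_rterm F (length c) (set a) (RApp i j ts ?us)" using ts F that const_tuple(2) by auto
          then show ?thesis
            unfolding \<phi>xs using tr[of "EqR (RApp i j ts ?us) (Const (snd (f (xs, rs)) ! j))"] F ts(1)
            by (simp add: o_def)
        qed
        ultimately show "f (map \<phi> xs, rs) = (map \<phi> (fst (f (xs, rs))), snd (f (xs, rs)))"
          using lenf xs by (intro prod_eqI nth_equalityI) auto
      qed
    qed
  qed
  moreover have A: "?A = gen F (set c)"
    unfolding term_values_eq_gen
    by (intro subset_antisym gen_minimal gen_mono substructure_gen) (use a gen_superset[of "set c" F] in auto)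
  moreover have "?B = gen F (set c')"
  proof -
    \<comment> \<open>A parameter x is the value at c of a parameter-free term t; the formula
      \<open>EqX (Par x) t\<close> is in the type over a and passes to c'.\<close>
    have "set a \<subseteq> gen F (set c')"
    proof
      fix x assume x: "x \<in> set a"
      then have "x \<in> term_values c {}" using a term_values_eq_gen[of c "{}"] by auto
      then obtain t where t: "x = xval F c t" "wf_xterm F (length c) {} t" by (auto simp: term_values_def)
      have mono: "wf_xterm F v A t \<Longrightarrow> A \<subseteq> A' \<Longrightarrow> wf_xterm F v A' t"
        "wf_rterm F v A u \<Longrightarrow> A \<subseteq> A' \<Longrightarrow> wf_rterm F v A' u" for v A A' t u
        by (induction t and u) (auto simp: list_all_iff)
      have "?wf t" using mono(1)[OF t(2), of "set a"] by simp
      then have "xval F c' t = x" using tr[of "EqX (Par x) t"] x t(1) by simp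
      then show "x \<in> gen F (set c')"
        using t(2) len term_values_eq_gen[of c' "{}"] by (auto simp: term_values_def)
    qed
    then show ?thesis unfolding term_values_eq_gen
      by (intro subset_antisym gen_minimal gen_mono substructure_gen) (use gen_superset[of "set c'" F] in auto)
  qed
  ultimately have iso: "isomorphism F \<phi> (gen F (set c)) (gen F (set c'))" by simp
  have "\<phi> x = x" if "x \<in> gen F (set a)" for x
  proof -
    have "\<phi> x = id x"
    proof (rule isomorphism_eq_on_gen[OF iso isomorphism_id substructure_gen a _ that])
      fix x assume "x \<in> set a"
      then show "\<phi> x = id x" using \<phi>[of "Par x"] by simp
    qed
    then show ?thesis by simp
  qed
  then show thesis using that iso by blast
qed

end

section \<open>Automorphisms extending isomorphisms of finitely generated substructures\<close>

locale homogeneous_structure = complete_structure +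
  assumes locally_finite: "locally_finite_automorphisms F"
    and extension: "extension_property F"
begin

definition automorphisms :: "('a \<Rightarrow> 'a) set" where
  "automorphisms = {g. isomorphism F g UNIV UNIV}"

lemma automorphism_restrict: "g \<in> automorphisms \<Longrightarrow> isomorphism F g A (g ` A)"
  unfolding automorphisms_def using isomorphism_restrict by blast

lemma finitely_generated_substructure: "finitely_generated F N \<Longrightarrow> substructure F N"
  unfolding finitely_generated_def using substructure_gen by blast

lemma finitely_generated_image:
  assumes "isomorphism F \<phi> N M" "finitely_generated F N"
  shows "finitely_generated F M"
proof -
  obtain as where N: "N = gen F (set as)" using assms(2) by (auto simp: finitely_generated_def)
  have "\<phi> ` N = gen F (\<phi> ` set as)"
    unfolding N by (rule isomorphism_image_gen[OF assms(1)[unfolded N] substructure_gen gen_superset])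
  then have "M = gen F (set (map \<phi> as))" using isomorphismD(2)[OF assms(1)] by simp
  then show ?thesis unfolding finitely_generated_def by blast
qed

lemma finitely_generated_join:
  assumes "finite \<N>" "\<And>N. N \<in> \<N> \<Longrightarrow> finitely_generated F N"
  shows "finitely_generated F (gen F (\<Union>\<N>))"
proof -
  have "\<forall>N\<in>\<N>. \<exists>as. N = gen F (set as)" using assms(2) by (simp add: finitely_generated_def)
  then obtain as where as: "\<And>N. N \<in> \<N> \<Longrightarrow> N = gen F (set (as N))" by metis
  obtain bs where bs: "set bs = (\<Union>N\<in>\<N>. set (as N))"
    using finite_list[of "\<Union>N\<in>\<N>. set (as N)"] assms(1) by auto
  have "gen F (\<Union>\<N>) = gen F (set bs)"
  proof (intro subset_antisym gen_minimal substructure_gen)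
    show "\<Union>\<N> \<subseteq> gen F (set bs)"
    proof
      fix x assume "x \<in> \<Union>\<N>"
      then obtain N where "N \<in> \<N>" "x \<in> gen F (set (as N))" using as by blast
      moreover have "gen F (set (as N)) \<subseteq> gen F (set bs)" using bs \<open>N \<in> \<N>\<close> by (intro gen_mono) auto
      ultimately show "x \<in> gen F (set bs)" by blast
    qed
    have "set (as N) \<subseteq> \<Union>\<N>" if "N \<in> \<N>" for N using as[OF that] that gen_superset[of "set (as N)" F] by blast
    then show "set bs \<subseteq> gen F (\<Union>\<N>)" using bs gen_superset[of "\<Union>\<N>" F] by blast
  qed
  then show ?thesis unfolding finitely_generated_def by blast
qed

text \<open>Local finiteness concerns partial automorphisms of a single finitely generated
  substructure, so N, M and all images of N are first joined into one.\<close>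

lemma extend_isomorphisms:
  assumes "finitely_generated F N" "finite \<Phi>"
    and "\<And>\<phi>. \<phi> \<in> \<Phi> \<Longrightarrow> isomorphism F \<phi> N (\<phi> ` N)" and M: "finitely_generated F M"
  shows "\<exists>N'. finitely_generated F N' \<and> N \<subseteq> N' \<and> M \<subseteq> N' \<and>
    (\<forall>\<phi>\<in>\<Phi>. \<exists>\<psi>. isomorphism F \<psi> N' N' \<and> (\<forall>x\<in>N. \<psi> x = \<phi> x))"
proof -
  let ?\<N> = "insert N (insert M ((\<lambda>\<phi>. \<phi> ` N) ` \<Phi>))"
  let ?N1 = "gen F (\<Union>?\<N>)"
  have fg: "finitely_generated F ?N1"
  proof (rule finitely_generated_join)
    show "finite ?\<N>" using assms(2) by simp
    fix N0 assume "N0 \<in> ?\<N>"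
    then show "finitely_generated F N0" using assms(1,3) M finitely_generated_image by blast
  qed
  have sub: "N0 \<subseteq> ?N1" if "N0 \<in> ?\<N>" for N0
    using gen_superset[of "\<Union>?\<N>" F] that by blast
  have sN: "substructure F N" using assms(1) by (rule finitely_generated_substructure)
  have part: "\<forall>(A, \<phi>)\<in>Pair N ` \<Phi>. substructure F A \<and> A \<subseteq> ?N1 \<and> substructure F (\<phi> ` A) \<and> \<phi> ` A \<subseteq> ?N1 \<and>
      isomorphism F \<phi> A (\<phi> ` A)"
  proof clarify
    fix \<phi> assume \<phi>: "\<phi> \<in> \<Phi>"
    have "substructure F (\<phi> ` N)" by (rule substructure_image[OF assms(3)[OF \<phi>] sN])
    then show "substructure F N \<and> N \<subseteq> ?N1 \<and> substructure F (\<phi> ` N) \<and> \<phi> ` N \<subseteq> ?N1 \<and> isomorphism F \<phi> N (\<phi> ` N)"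
      using sN assms(3)[OF \<phi>] sub[of N] sub[of "\<phi> ` N"] \<phi> by simp
  qed
  then obtain N' where N': "finitely_generated F N'" "?N1 \<subseteq> N'"
    "\<forall>(A, \<phi>)\<in>Pair N ` \<Phi>. \<exists>\<psi>. isomorphism F \<psi> N' N' \<and> (\<forall>x\<in>A. \<psi> x = \<phi> x)"
    using locally_finite[unfolded locally_finite_automorphisms_def, rule_format, of ?N1 "Pair N ` \<Phi>"] fg assms(2) by auto
  then have "\<forall>\<phi>\<in>\<Phi>. \<exists>\<psi>. isomorphism F \<psi> N' N' \<and> (\<forall>x\<in>N. \<psi> x = \<phi> x)" by auto
  moreover have "N \<subseteq> N'" "M \<subseteq> N'" using sub[of N] sub[of M] N'(2) by auto
  ultimately show ?thesis using N'(1) by (intro exI[of _ N'] conjI)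
qed

text \<open>After the first extension the map is an automorphism of a finitely generated A, and so
  are all later ones. Domain and range coincide at every stage and absorb the witnessing set
  together, which replaces a back-and-forth.\<close>

lemma homogeneous:
  assumes N: "finitely_generated F N" and \<phi>: "isomorphism F \<phi> N M"
  obtains g where "g \<in> automorphisms" "\<And>x. x \<in> N \<Longrightarrow> g x = \<phi> x"
proof -
  obtain D where D: "countable D" "witnessing D" using witnessing_exists by blast
  then have "D \<noteq> {}" by (auto simp: witnessing_def)
  then obtain d :: "nat \<Rightarrow> 'a" where d: "range d = D" using range_from_nat_into[OF _ D(1)] by blast
  define P where "P = (\<lambda>n::nat. \<lambda>(\<theta>, A). finitely_generated F A \<and> isomorphism F \<theta> A A \<and> N \<subseteq> A \<and> (\<forall>x\<in>N. \<theta> x = \<phi> x))"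
  define R where "R = (\<lambda>n (\<theta>, A) (\<theta>', A'). A \<subseteq> A' \<and> (\<forall>x\<in>A. \<theta>' (x :: 'a) = (\<theta> x :: 'a)) \<and> d n \<in> A')"
  have "isomorphism F \<phi> N (\<phi> ` N)" using isomorphismD(2)[OF \<phi>] \<phi> by simp
  then have "\<exists>N'. finitely_generated F N' \<and> N \<subseteq> N' \<and> N \<subseteq> N' \<and>
      (\<forall>\<phi>'\<in>{\<phi>}. \<exists>\<psi>. isomorphism F \<psi> N' N' \<and> (\<forall>x\<in>N. \<psi> x = \<phi>' x))"
    by (intro extend_isomorphisms N) auto
  then obtain A0 \<psi> where "finitely_generated F A0" "N \<subseteq> A0" "isomorphism F \<psi> A0 A0" "\<forall>x\<in>N. \<psi> x = \<phi> x"
    by auto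
  then have "P 0 (\<psi>, A0)" by (simp add: P_def)
  moreover have "\<exists>y. P (Suc n) y \<and> R n x y" if Px: "P n x" for x n
  proof -
    obtain \<theta> A where x: "x = (\<theta>, A)" by force
    have A: "finitely_generated F A" "isomorphism F \<theta> A A" "N \<subseteq> A" "\<forall>x\<in>N. \<theta> x = \<phi> x"
      using Px by (auto simp: x P_def)
    have "finitely_generated F (gen F {d n})" unfolding finitely_generated_def by (rule exI[of _ "[d n]"]) simp
    moreover have "isomorphism F \<theta> A (\<theta> ` A)" using isomorphismD(2)[OF A(2)] A(2) by simp
    ultimately have "\<exists>A'. finitely_generated F A' \<and> A \<subseteq> A' \<and> gen F {d n} \<subseteq> A' \<and>
      (\<forall>\<theta>'\<in>{\<theta>}. \<exists>\<psi>. isomorphism F \<psi> A' A' \<and> (\<forall>x\<in>A. \<psi> x = \<theta>' x))"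
      by (intro extend_isomorphisms A(1)) auto
    then obtain A' \<psi> where A': "finitely_generated F A'" "A \<subseteq> A'" "gen F {d n} \<subseteq> A'" "isomorphism F \<psi> A' A'"
      "\<forall>x\<in>A. \<psi> x = \<theta> x" by auto
    have "P (Suc n) (\<psi>, A')" "R n x (\<psi>, A')"
      using A A' gen_superset[of "{d n}" F] by (auto simp: P_def R_def x)
    then show ?thesis by blast
  qed
  ultimately obtain st where st: "\<And>n. P n (st n)" "\<And>n. R n (st n) (st (Suc n))"
    using dependent_nat_choice[of P R] by metis
  define \<theta> where "\<theta> n = fst (st n)" for n
  define A where "A n = snd (st n)" for n
  have stn: "st n = (\<theta> n, A n)" for n by (simp add: \<theta>_def A_def)
  have P: "finitely_generated F (A n)" "isomorphism F (\<theta> n) (A n) (A n)" "N \<subseteq> A n" "\<forall>x\<in>N. \<theta> n x = \<phi> x" for n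
    using st(1)[of n] by (auto simp: stn P_def)
  have R: "A n \<subseteq> A (Suc n)" "\<And>x. x \<in> A n \<Longrightarrow> \<theta> (Suc n) x = \<theta> n x" "d n \<in> A (Suc n)" for n
    using st(2)[of n] by (auto simp: stn R_def)
  have cover: "D \<subseteq> (\<Union>n. A n)" using d R(3) by auto
  obtain g where "isomorphism F g UNIV UNIV" "\<And>n x. x \<in> A n \<Longrightarrow> g x = \<theta> n x"
    using chain_limit[OF D(2) P(2) finitely_generated_substructure[OF P(1)] R(1,2) cover cover] by blast
  moreover have "g x = \<phi> x" if "x \<in> N" for x
    using calculation(2)[of x 0] P(3,4)[of 0] that by auto
  ultimately show thesis using that[of g] by (simp add: automorphisms_def)
qed

text \<open>Homogeneity turns the automorphisms of N' into automorphisms of X.\<close>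

lemma automorphisms_locally_finite:
  assumes "finitely_generated F N" "\<And>i. i < n \<Longrightarrow> g i \<in> automorphisms"
  shows "\<exists>N'. finitely_generated F N' \<and> N \<subseteq> N' \<and>
    (\<exists>g'. \<forall>i<n::nat. g' i \<in> automorphisms \<and> g' i ` N' = N' \<and> (\<forall>x\<in>N. g' i x = g i x))"
proof -
  have "\<exists>N'. finitely_generated F N' \<and> N \<subseteq> N' \<and> N \<subseteq> N' \<and>
      (\<forall>\<phi>\<in>g ` {..<n}. \<exists>\<psi>. isomorphism F \<psi> N' N' \<and> (\<forall>x\<in>N. \<psi> x = \<phi> x))"
    by (intro extend_isomorphisms assms(1)) (use assms(2) automorphism_restrict in auto)
  then obtain N' where N': "finitely_generated F N'" "N \<subseteq> N'"
    "\<forall>i<n. \<exists>\<psi>. isomorphism F \<psi> N' N' \<and> (\<forall>x\<in>N. \<psi> x = g i x)"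
    by auto
  have "\<exists>h\<in>automorphisms. h ` N' = N' \<and> (\<forall>x\<in>N. h x = g i x)" if "i < n" for i
  proof -
    obtain \<psi> where iso: "isomorphism F \<psi> N' N'" and \<psi>: "\<forall>x\<in>N. \<psi> x = g i x" using N'(3) \<open>i < n\<close> by blast
    obtain h where h: "h \<in> automorphisms" "\<And>x. x \<in> N' \<Longrightarrow> h x = \<psi> x"
      using homogeneous[OF N'(1) iso] by blast
    have "h ` N' = \<psi> ` N'" using h(2) by force
    then have "h ` N' = N'" using isomorphismD(2)[OF iso] by simp
    moreover have "h x = g i x" if "x \<in> N" for x
      using h(2)[of x] \<psi> N'(2) that by auto
    ultimately show ?thesis using h(1) by blast
  qed
  then obtain g' where "\<forall>i<n. g' i \<in> automorphisms \<and> g' i ` N' = N' \<and> (\<forall>x\<in>N. g' i x = g i x)"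
    by metis
  then show ?thesis using N'(1,2) by blast
qed

text \<open>Equality of types yields an isomorphism over A from C to its independent copy.
  Homogeneity extends it to u, and likewise extends every amalgam on the substructure generated by B
  and the copy to e.\<close>

lemma automorphisms_extension:
  assumes "finitely_generated F A" "finitely_generated F B" "finitely_generated F C" "A \<subseteq> B" "A \<subseteq> C"
  shows "\<exists>u\<in>automorphisms. (\<forall>x\<in>A. u x = x) \<and>
    (\<forall>f\<in>automorphisms. \<forall>g\<in>automorphisms. f ` B = B \<and> g ` u ` C = u ` C \<and> f ` A = A \<and> (\<forall>x\<in>A. f x = g x) \<longrightarrow>
       (\<exists>e\<in>automorphisms. (\<forall>x\<in>B. e x = f x) \<and> (\<forall>x\<in>u ` C. e x = g x)))"
proof -
  obtain a b c where A: "A = gen F (set a)" and B: "B = gen F (set b)" and C: "C = gen F (set c)"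
    using assms(1-3) by (auto simp: finitely_generated_def)
  obtain c' where c': "qftp F c' a = qftp F c a" "indep F B A (gen F (set c'))"
    using extension assms(4,5) unfolding extension_property_def A B C by blast
  have "set a \<subseteq> gen F (set c)" using assms(5) gen_superset[of "set a" F] unfolding A C by blast
  then obtain \<phi> where \<phi>: "isomorphism F \<phi> C (gen F (set c'))" "\<And>x. x \<in> A \<Longrightarrow> \<phi> x = x"
    using qftp_eq_isomorphism[OF c'(1)] unfolding A C by blast
  obtain u where u: "u \<in> automorphisms" "\<And>x. x \<in> C \<Longrightarrow> u x = \<phi> x"
    using homogeneous[OF assms(3) \<phi>(1)] by blast
  have "u ` C = \<phi> ` C" using u(2) by force
  then have uC: "u ` C = gen F (set c')" using isomorphismD(2)[OF \<phi>(1)] by simp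
  show ?thesis
  proof (rule bexI[OF _ u(1)], intro conjI ballI impI)
    show "u x = x" if "x \<in> A" for x using u(2)[of x] \<phi>(2)[of x] assms(5) that by auto
    fix f g assume f: "f \<in> automorphisms" and g: "g \<in> automorphisms"
      and fg: "f ` B = B \<and> g ` u ` C = u ` C \<and> f ` A = A \<and> (\<forall>x\<in>A. f x = g x)"
    have "isomorphism F f B B" using automorphism_restrict[OF f, of B] fg by simp
    moreover have "isomorphism F g (u ` C) (u ` C)" using automorphism_restrict[OF g, of "u ` C"] fg by simp
    moreover have "g ` A \<subseteq> A" using fg by force
    ultimately obtain \<theta> where \<theta>: "isomorphism F \<theta> (gen F (B \<union> u ` C)) (gen F (B \<union> u ` C))"
       "\<forall>x\<in>B. \<theta> x = f x" "\<forall>x\<in>u ` C. \<theta> x = g x"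
      using c'(2)[folded uC, unfolded indep_def, rule_format, of f g] fg by auto
    have "finitely_generated F (gen F (\<Union>{B, u ` C}))"
      by (rule finitely_generated_join)
        (use assms(2,3) finitely_generated_image[OF automorphism_restrict[OF u(1)]] in auto)
    then have "finitely_generated F (gen F (B \<union> u ` C))" by simp
    then obtain e where "e \<in> automorphisms" "\<And>x. x \<in> gen F (B \<union> u ` C) \<Longrightarrow> e x = \<theta> x"
      using homogeneous[OF _ \<theta>(1)] by blast
    then show "\<exists>e\<in>automorphisms. (\<forall>x\<in>B. e x = f x) \<and> (\<forall>x\<in>u ` C. e x = g x)"
      using \<theta>(2,3) gen_superset[of "B \<union> u ` C" F] by (intro bexI[of _ e]) auto
  qed
qed

end

section \<open>Countable approximations of the automorphism group\<close>

text \<open>Downward Loewenheim-Skolem: T is the structure, \<Q> a countable set of formulas with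
  finitely many parameters and one witness, and S is closed under chosen witnesses.\<close>

lemma countable_elementary_subset:
  fixes \<Q> :: "('x list \<Rightarrow> 'x \<Rightarrow> bool) set"
  assumes "countable S0" "S0 \<subseteq> T" "countable \<Q>"
  obtains S where "countable S" "S0 \<subseteq> S" "S \<subseteq> T"
    "\<And>Q zs w. Q \<in> \<Q> \<Longrightarrow> zs \<in> lists S \<Longrightarrow> w \<in> T \<Longrightarrow> Q zs w \<Longrightarrow> \<exists>w'\<in>S. Q zs w'"
proof -
  define wit where "wit Q zs = (SOME w. w \<in> T \<and> Q zs w)" for Q :: "'x list \<Rightarrow> 'x \<Rightarrow> bool" and zs
  have wit: "wit Q zs \<in> T \<and> Q zs (wit Q zs)" if "w \<in> T" "Q zs w" for Q zs w
    unfolding wit_def by (rule someI[of _ w]) (simp add: that)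
  \<comment> \<open>\<open>wit\<close> is arbitrary where no witness exists; intersecting with T
    discards values outside T.\<close>
  define step where "step S = S \<union> (T \<inter> (\<lambda>(Q, zs). wit Q zs) ` (\<Q> \<times> lists S))" for S
  define S where "S n = (step ^^ n) S0" for n
  have S_Suc: "S (Suc n) = step (S n)" for n by (simp add: S_def)
  have mono: "S m \<subseteq> S n" if "m \<le> n" for m n
    using that by (rule lift_Suc_mono_le[rotated]) (auto simp: S_Suc step_def)
  show thesis
  proof (rule that[of "\<Union>n. S n"])
    have "countable (S n)" for n
      by (induction n) (auto simp: S_def step_def assms)
    then show "countable (\<Union>n. S n)" by blast
    show "S0 \<subseteq> (\<Union>n. S n)" using UN_upper[of 0 UNIV S] by (simp add: S_def)
    have "S n \<subseteq> T" for n
      by (induction n) (use assms(2) in \<open>auto simp: S_def step_def\<close>)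
    then show "(\<Union>n. S n) \<subseteq> T" by blast
    fix Q zs w assume Q: "Q \<in> \<Q>" "zs \<in> lists (\<Union>n. S n)" "w \<in> T" "Q zs w"
    have "\<exists>n. zs \<in> lists (S n)"
      using Q(2)
    proof (induction zs)
      case (Cons z zs)
      then obtain m n where "z \<in> S m" "zs \<in> lists (S n)" by auto
      then have "z # zs \<in> lists (S (max m n))"
        using mono[of m "max m n"] lists_mono[OF mono[of n "max m n"]] by auto
      then show ?case ..
    qed simp
    then obtain n where "zs \<in> lists (S n)" ..
    then have "wit Q zs \<in> S (Suc n)" using wit[of w Q zs] Q(1,3,4) by (force simp: S_Suc step_def)
    then show "\<exists>w'\<in>(\<Union>n. S n). Q zs w'" using wit[of w Q zs] Q(3,4) by blast
  qed
qed

context homogeneous_structure begin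

lemma automorphismD:
  assumes "g \<in> automorphisms"
  shows "bij g" "dist (g x) (g y) = dist x y" "isomorphism F g UNIV UNIV"
  using assms isomorphismD[of F g UNIV UNIV] by (auto simp: automorphisms_def)

lemma automorphisms_id: "id \<in> automorphisms"
  by (simp add: automorphisms_def isomorphism_id)

lemma automorphisms_comp: "f \<in> automorphisms \<Longrightarrow> g \<in> automorphisms \<Longrightarrow> f \<circ> g \<in> automorphisms"
  unfolding automorphisms_def using isomorphism_comp[OF _ _ substructure_UNIV] by blast

lemma automorphisms_inv: "g \<in> automorphisms \<Longrightarrow> inv_fun g \<in> automorphisms"
  unfolding automorphisms_def using isomorphism_inverse[OF _ substructure_UNIV] by blast

lemma automorphism_fixes_gen_empty: "g \<in> automorphisms \<Longrightarrow> x \<in> gen F {} \<Longrightarrow> g x = x"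
  using isomorphism_eq_on_gen[OF automorphismD(3) isomorphism_id substructure_UNIV, of g "{}" x] by simp

lemma image_finitely_generated: "g \<in> automorphisms \<Longrightarrow> finitely_generated F N \<Longrightarrow> finitely_generated F (g ` N)"
  by (rule finitely_generated_image[OF automorphism_restrict])

text \<open>Automorphisms and finitely generated substructures are two sorts, joined in a sum type
  so that one closure treats both. K and \<A> are the two sorts of the resulting countable S; G
  consists of the automorphisms that, together with their inverses, agree with an element of K on
  each member of \<A>.\<close>

lemma skeleton_exists:
  assumes g0: "g0 \<in> automorphisms"
  obtains G K \<A> E0 where "skeleton G K \<A> E0" "G \<subseteq> automorphisms" "g0 \<in> G"
proof -
  obtain D where D: "countable D" "witnessing D" using witnessing_exists by blast
  have dense: "closure D = UNIV" using D(2) by (simp add: witnessing_def)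
  let ?fg = "Collect (finitely_generated F)"
  define T :: "(('a \<Rightarrow> 'a) + 'a set) set" where "T = Inl ` automorphisms \<union> Inr ` ?fg"
  define ext where "ext A B C u \<longleftrightarrow> (\<forall>x\<in>A. u x = x) \<and>
    (\<forall>f\<in>automorphisms. \<forall>g\<in>automorphisms. f ` B = B \<and> g ` u ` C = u ` C \<and> f ` A = A \<and> (\<forall>x\<in>A. f x = g x) \<longrightarrow>
       (\<exists>e\<in>automorphisms. (\<forall>x\<in>B. e x = f x) \<and> (\<forall>x\<in>u ` C. e x = g x)))" for A B C and u :: "'a \<Rightarrow> 'a"
  \<comment> \<open>\<open>Q5\<close> finds the common invariant substructure of local finiteness, \<open>Q6\<close> the automorphisms of it
    one at a time, so that every formula asks for a single witness.\<close>
  define Q0 where "Q0 = (\<lambda>(zs :: (('a \<Rightarrow> 'a) + 'a set) list) w. w = (Inl id :: ('a \<Rightarrow> 'a) + 'a set))"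
  define Q1 where "Q1 = (\<lambda>(zs :: (('a \<Rightarrow> 'a) + 'a set) list) w. \<exists>f g. zs = [Inl f, Inl g] \<and> w = (Inl (f \<circ> g) :: ('a \<Rightarrow> 'a) + 'a set))"
  define Q2 where "Q2 = (\<lambda>(zs :: (('a \<Rightarrow> 'a) + 'a set) list) w. \<exists>f. zs = [Inl f] \<and> w = (Inl (inv_fun f) :: ('a \<Rightarrow> 'a) + 'a set))"
  define Q3 where "Q3 = (\<lambda>(zs :: (('a \<Rightarrow> 'a) + 'a set) list) w. \<exists>f N. zs = [Inl f, Inr N] \<and> w = (Inr (f ` N) :: ('a \<Rightarrow> 'a) + 'a set))"
  define Q4 where "Q4 = (\<lambda>(zs :: (('a \<Rightarrow> 'a) + 'a set) list) w. \<exists>M N. zs = [Inr M, Inr N] \<and> w = (Inr (gen F (\<Union>{M, N})) :: ('a \<Rightarrow> 'a) + 'a set))"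
  define Q5 where "Q5 = (\<lambda>(zs :: (('a \<Rightarrow> 'a) + 'a set) list) w. \<exists>N gs N'. zs = Inr N # map Inl gs \<and> w = (Inr N' :: ('a \<Rightarrow> 'a) + 'a set) \<and> N \<subseteq> N' \<and>
      (\<forall>g\<in>set gs. \<exists>g'\<in>automorphisms. g' ` N' = N' \<and> (\<forall>x\<in>N. g' x = g x)))"
  define Q6 where "Q6 = (\<lambda>(zs :: (('a \<Rightarrow> 'a) + 'a set) list) w. \<exists>N N' g g'. zs = [Inr N, Inr N', Inl g] \<and> w = (Inl g' :: ('a \<Rightarrow> 'a) + 'a set) \<and>
      g' ` N' = N' \<and> (\<forall>x\<in>N. g' x = g x))"
  \<comment> \<open>\<open>ext\<close> keeps its quantifiers over all automorphisms, so that it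
    holds outright for the u found in S; \<open>Q8\<close> then brings each amalgam e into
    K.\<close>
  define Q7 where "Q7 = (\<lambda>(zs :: (('a \<Rightarrow> 'a) + 'a set) list) w. \<exists>A B C u. zs = [Inr A, Inr B, Inr C] \<and> w = (Inl u :: ('a \<Rightarrow> 'a) + 'a set) \<and> ext A B C u)"
  define Q8 where "Q8 = (\<lambda>(zs :: (('a \<Rightarrow> 'a) + 'a set) list) w. \<exists>B C f g e. zs = [Inr B, Inr C, Inl f, Inl g] \<and> w = (Inl e :: ('a \<Rightarrow> 'a) + 'a set) \<and>
      (\<forall>x\<in>B. e x = f x) \<and> (\<forall>x\<in>C. e x = g x))"
  have fg_gen: "finitely_generated F (gen F (set as))" for as by (auto simp: finitely_generated_def)
  \<comment> \<open>Substructures generated by single points of D are put in: agreement on \<A> then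
    forces agreement on a dense set, and a chain exhausting \<A> covers D, as
    \<open>chain_limit\<close> requires.\<close>
  let ?S0 = "{Inl g0, Inr (gen F {})} \<union> (\<lambda>d. Inr (gen F {d})) ` D"
  have "countable ?S0" using D(1) by simp
  moreover have "?S0 \<subseteq> T"
    using g0 fg_gen[of "[]"] fg_gen[of "[d]" for d] by (auto simp: T_def)
  ultimately obtain S where S: "countable S" "?S0 \<subseteq> S" "S \<subseteq> T"
    and elem: "\<And>Q zs w. Q \<in> {Q0, Q1, Q2, Q3, Q4, Q5, Q6, Q7, Q8} \<Longrightarrow> zs \<in> lists S \<Longrightarrow> w \<in> T \<Longrightarrow> Q zs w \<Longrightarrow> \<exists>w'\<in>S. Q zs w'"
    using countable_elementary_subset[of ?S0 T "{Q0, Q1, Q2, Q3, Q4, Q5, Q6, Q7, Q8}"] by auto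
  define K where "K = {k. Inl k \<in> S}"
  define \<A> where "\<A> = {N. Inr N \<in> S}"
  have KG: "k \<in> automorphisms" if "k \<in> K" for k using that S(3) by (auto simp: K_def T_def)
  have Afg: "finitely_generated F N" if "N \<in> \<A>" for N using that S(3) by (auto simp: \<A>_def T_def)
  have "K \<subseteq> projl ` S" "\<A> \<subseteq> projr ` S" unfolding K_def \<A>_def by force+
  then have K_countable: "countable K" and A_countable: "countable \<A>"
    using S(1) by (meson countable_image countable_subset)+
  have K_id: "id \<in> K"
    using elem[of Q0 "[]" "Inl id"] automorphisms_id by (auto simp: Q0_def T_def K_def)
  have K_comp: "f \<circ> g \<in> K" if "f \<in> K" "g \<in> K" for f g
    using elem[of Q1 "[Inl f, Inl g]" "Inl (f \<circ> g)"] automorphisms_comp[OF KG KG, OF that] that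
    by (auto simp: Q1_def T_def K_def)
  have K_inv: "inv_fun f \<in> K" if "f \<in> K" for f
    using elem[of Q2 "[Inl f]" "Inl (inv_fun f)"] automorphisms_inv[OF KG[OF that]] that
    by (auto simp: Q2_def T_def K_def)
  have K_image: "k ` N \<in> \<A>" if "k \<in> K" "N \<in> \<A>" for k N
    using elem[of Q3 "[Inl k, Inr N]" "Inr (k ` N)"] image_finitely_generated[OF KG[OF that(1)] Afg[OF that(2)]] that
    by (auto simp: Q3_def T_def K_def \<A>_def)
  have directed: "\<exists>L\<in>\<A>. M \<union> N \<subseteq> L" if "M \<in> \<A>" "N \<in> \<A>" for M N
  proof -
    have "finitely_generated F (gen F (\<Union>{M, N}))" using that Afg by (intro finitely_generated_join) auto
    then have "gen F (\<Union>{M, N}) \<in> \<A>"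
      using elem[of Q4 "[Inr M, Inr N]" "Inr (gen F (\<Union>{M, N}))"] that by (auto simp: Q4_def T_def \<A>_def)
    then show ?thesis using gen_superset[of "\<Union>{M, N}" F] by auto
  qed
  have finite: "\<exists>N'\<in>\<A>. \<exists>g'. N \<subseteq> N' \<and> (\<forall>i<n. g' i \<in> K \<and> g' i ` N' = N' \<and> (\<forall>x\<in>N. g' i x = g i x))"
    if N: "N \<in> \<A>" and g: "\<And>i. i < n \<Longrightarrow> g i \<in> K" for N g and n :: nat
  proof -
    obtain N' g' where N': "finitely_generated F N'" "N \<subseteq> N'"
      "\<forall>i<n. g' i \<in> automorphisms \<and> g' i ` N' = N' \<and> (\<forall>x\<in>N. g' i x = g i x)"
      using automorphisms_locally_finite[OF Afg[OF N], of n g] KG g by blast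
    let ?gs = "map g [0..<n]"
    have "Inr N # map Inl ?gs \<in> lists S" using N g by (auto simp: \<A>_def K_def)
    moreover have "Q5 (Inr N # map Inl ?gs) (Inr N')"
    proof -
      have "\<exists>h'\<in>automorphisms. h' ` N' = N' \<and> (\<forall>x\<in>N. h' x = h x)" if h: "h \<in> set ?gs" for h
      proof -
        obtain i where "i < n" "h = g i" using h by auto
        then show ?thesis using N'(3) by blast
      qed
      then show ?thesis unfolding Q5_def using N'(2) by blast
    qed
    ultimately obtain w where w: "w \<in> S" "Q5 (Inr N # map Inl ?gs) w"
      using elem[of Q5 "Inr N # map Inl ?gs" "Inr N'"] N'(1) by (auto simp: T_def)
    then obtain gs M where M: "map Inl ?gs = (map Inl gs :: (('a \<Rightarrow> 'a) + 'a set) list)" "w = Inr M" "N \<subseteq> M"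
      "\<forall>g\<in>set gs. \<exists>g'\<in>automorphisms. g' ` M = M \<and> (\<forall>x\<in>N. g' x = g x)"
      unfolding Q5_def by blast
    have "?gs = gs" using M(1) by (rule map_injective[OF _ inj_Inl])
    then have gs: "g i \<in> set gs" if "i < n" for i using that by auto
    have MA: "M \<in> \<A>" using w(1) M(2) by (simp add: \<A>_def)
    have "\<exists>h\<in>K. h ` M = M \<and> (\<forall>x\<in>N. h x = g i x)" if i: "i < n" for i
    proof -
      obtain h where h: "h \<in> automorphisms" "h ` M = M" "\<forall>x\<in>N. h x = g i x" using M(4) gs[OF i] by blast
      then have "Q6 [Inr N, Inr M, Inl (g i)] (Inl h)" unfolding Q6_def by blast
      moreover have "[Inr N, Inr M, Inl (g i)] \<in> lists S" using N MA g[OF i] by (simp add: K_def \<A>_def)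
      ultimately obtain w where "w \<in> S" "Q6 [Inr N, Inr M, Inl (g i)] w"
        using elem[of Q6 "[Inr N, Inr M, Inl (g i)]" "Inl h"] h(1) by (auto simp: T_def)
      then show ?thesis unfolding Q6_def K_def by auto
    qed
    then obtain h where "\<forall>i<n. h i \<in> K \<and> h i ` M = M \<and> (\<forall>x\<in>N. h i x = g i x)" by metis
    then show ?thesis using MA M(3) by blast
  qed
  have extension: "\<exists>u\<in>K. (\<forall>x\<in>A. u x = x) \<and>
          (\<forall>f\<in>K. \<forall>g\<in>K. f ` B = B \<and> g ` u ` C = u ` C \<and> f ` A = A \<and> (\<forall>x\<in>A. f x = g x) \<longrightarrow>
             (\<exists>e\<in>K. (\<forall>x\<in>B. e x = f x) \<and> (\<forall>x\<in>u ` C. e x = g x)))"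
    if A: "A \<in> \<A>" "B \<in> \<A>" "C \<in> \<A>" "A \<subseteq> B" "A \<subseteq> C" for A B C
  proof -
    obtain v where "v \<in> automorphisms" "ext A B C v"
      using automorphisms_extension[OF Afg Afg Afg, OF A] unfolding ext_def by blast
    moreover from this(2) have "Q7 [Inr A, Inr B, Inr C] (Inl v)" unfolding Q7_def by blast
    moreover have "[Inr A, Inr B, Inr C] \<in> lists S" using A by (simp add: \<A>_def)
    ultimately obtain w where "w \<in> S" "Q7 [Inr A, Inr B, Inr C] w"
      using elem[of Q7 "[Inr A, Inr B, Inr C]" "Inl v"] by (auto simp: T_def)
    then obtain u where u: "u \<in> K" "ext A B C u" unfolding Q7_def K_def by auto
    show ?thesis
    proof (rule bexI[OF _ u(1)], intro conjI ballI impI)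
      show "u x = x" if "x \<in> A" for x using u(2) that by (simp add: ext_def)
      fix f g assume fg: "f \<in> K" "g \<in> K"
        and inv: "f ` B = B \<and> g ` u ` C = u ` C \<and> f ` A = A \<and> (\<forall>x\<in>A. f x = g x)"
      obtain e where e: "e \<in> automorphisms" "\<forall>x\<in>B. e x = f x" "\<forall>x\<in>u ` C. e x = g x"
        using u(2)[unfolded ext_def, THEN conjunct2, THEN bspec, OF KG[OF fg(1)], THEN bspec, OF KG[OF fg(2)],
            THEN mp, OF inv] by blast
      have "Q8 [Inr B, Inr (u ` C), Inl f, Inl g] (Inl e)" unfolding Q8_def using e by blast
      moreover have "[Inr B, Inr (u ` C), Inl f, Inl g] \<in> lists S"
        using A(2) K_image[OF u(1) A(3)] fg by (simp add: K_def \<A>_def)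
      ultimately obtain w where "w \<in> S" "Q8 [Inr B, Inr (u ` C), Inl f, Inl g] w"
        using elem[of Q8 "[Inr B, Inr (u ` C), Inl f, Inl g]" "Inl e"] e(1) by (auto simp: T_def)
      then show "\<exists>e\<in>K. (\<forall>x\<in>B. e x = f x) \<and> (\<forall>x\<in>u ` C. e x = g x)"
        unfolding Q8_def K_def by auto
    qed
  qed
  have gen_d: "gen F {d} \<in> \<A>" if "d \<in> D" for d using S(2) that by (auto simp: \<A>_def)
  have E0: "gen F {} \<in> \<A>" using S(2) by (simp add: \<A>_def)
  define loc where "loc g \<longleftrightarrow> (\<forall>N\<in>\<A>. \<exists>k\<in>K. \<forall>x\<in>N. g x = k x)" for g :: "'a \<Rightarrow> 'a"
  \<comment> \<open>The condition on the inverse makes G closed under inverses; for limits it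
    follows because the images of the A n are cofinal too.\<close>
  define G where "G = {g\<in>automorphisms. loc g \<and> loc (inv_fun g)}"
  have loc_K: "loc k" if "k \<in> K" for k using that by (auto simp: loc_def)
  have loc_comp: "loc (f \<circ> g)" if "loc f" "loc g" for f g
    unfolding loc_def
  proof
    fix N assume N: "N \<in> \<A>"
    then obtain k where k: "k \<in> K" "\<forall>x\<in>N. g x = k x" using \<open>loc g\<close> unfolding loc_def by blast
    then obtain k' where k': "k' \<in> K" "\<forall>x\<in>k ` N. f x = k' x"
      using \<open>loc f\<close> K_image[OF k(1) N] unfolding loc_def by blast
    show "\<exists>k\<in>K. \<forall>x\<in>N. (f \<circ> g) x = k x"
      using K_comp[OF k'(1) k(1)] k(2) k'(2) by (intro bexI[of _ "k' \<circ> k"]) auto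
  qed
  have aut: "g \<in> automorphisms" if "g \<in> G" for g using that by (simp add: G_def)
  have app [simp]: "inv_fun g (g x) = x" "g (inv_fun g x) = x" if "g \<in> automorphisms" for g x
    using automorphismD(1)[OF that] by (simp_all add: bij_is_inj bij_is_surj surj_f_inv_f)
  have "skeleton G K \<A> (gen F {})"
  proof
    show "id \<in> G" using automorphisms_id loc_K[OF K_id] by (simp add: G_def)
    show "f \<circ> g \<in> G" if "f \<in> G" "g \<in> G" for f g
      using that automorphisms_comp[of f g] loc_comp[of f g] loc_comp[of "inv_fun g" "inv_fun f"]
        o_inv_distrib[OF automorphismD(1) automorphismD(1), of f g] by (simp add: G_def)
    show "inv_fun g \<in> G" if "g \<in> G" for g
      using that automorphisms_inv[of g] inv_inv_eq[OF automorphismD(1), of g] by (simp add: G_def)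
    show "bij g" if "g \<in> G" for g using automorphismD(1) aut that by blast
    show "K \<subseteq> G" using KG loc_K K_inv by (auto simp: G_def)
    show "\<exists>k\<in>K. \<forall>x\<in>N. g x = k x" if "g \<in> G" "N \<in> \<A>" for g N using that by (auto simp: G_def loc_def)
    show "gen F {} \<subseteq> N" if "N \<in> \<A>" for N
      using finitely_generated_substructure[OF Afg[OF that]] by (intro gen_minimal) auto
    show "k x = x" if "k \<in> K" "x \<in> gen F {}" for k x
      using automorphism_fixes_gen_empty KG that by blast
    show "f = g" if f: "f \<in> G" and g: "g \<in> G" and eq: "\<And>N x. N \<in> \<A> \<Longrightarrow> x \<in> N \<Longrightarrow> f x = g x" for f g
    proof (rule isometries_eq_on_dense[OF _ _ dense])
      fix x assume "x \<in> D"
      then show "f x = g x" using eq[OF gen_d, of x x] gen_superset[of "{x}" F] by auto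
    qed (use f g aut automorphismD(2) in auto)
    show "\<exists>g\<in>G. \<forall>n. \<forall>x\<in>A n. g x = \<theta> n x"
      if \<theta>: "\<And>n. \<theta> n \<in> G" and A: "\<And>n. A n \<in> \<A>" and mono: "\<And>n. A n \<subseteq> A (Suc n)"
        and coh: "\<And>n x. x \<in> A n \<Longrightarrow> \<theta> (Suc n) x = \<theta> n x"
        and cofinal: "\<And>N. N \<in> \<A> \<Longrightarrow> \<exists>n. N \<subseteq> A n" "\<And>N. N \<in> \<A> \<Longrightarrow> \<exists>n. N \<subseteq> \<theta> n ` A n"
      for \<theta> and A :: "nat \<Rightarrow> 'a set"
    proof -
      have inD: "d \<in> gen F {d}" for d using gen_superset[of "{d}" F] by simp
      have iso: "isomorphism F (\<theta> n) (A n) (\<theta> n ` A n)" for n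
        by (rule automorphism_restrict[OF aut[OF \<theta>]])
      have "\<exists>n. d \<in> A n" "\<exists>n. d \<in> \<theta> n ` A n" if "d \<in> D" for d
        using cofinal[OF gen_d[OF that]] subsetD[OF _ inD] by metis+
      then have cover: "D \<subseteq> (\<Union>n. A n)" "D \<subseteq> (\<Union>n. \<theta> n ` A n)"
        by (simp_all add: subset_iff)
      obtain g where g: "isomorphism F g UNIV UNIV" "\<And>n x. x \<in> A n \<Longrightarrow> g x = \<theta> n x"
        using chain_limit[OF D(2) iso finitely_generated_substructure[OF Afg[OF A]] mono coh cover] by blast
      have gA: "g \<in> automorphisms" using g(1) by (simp add: automorphisms_def)
      have "loc g" unfolding loc_def
      proof
        fix N assume "N \<in> \<A>"
        then obtain n where n: "N \<subseteq> A n" using cofinal(1) by blast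
        obtain k where "k \<in> K" "\<forall>x\<in>A n. \<theta> n x = k x" using \<theta>[of n] A[of n] unfolding G_def loc_def by blast
        then show "\<exists>k\<in>K. \<forall>x\<in>N. g x = k x" using n g(2) by (intro bexI[of _ k]) auto
      qed
      moreover have "loc (inv_fun g)" unfolding loc_def
      proof
        fix N assume N: "N \<in> \<A>"
        then obtain n where n: "N \<subseteq> \<theta> n ` A n" using cofinal(2) by blast
        obtain k where k: "k \<in> K" "\<forall>x\<in>N. inv_fun (\<theta> n) x = k x" using \<theta>[of n] N unfolding G_def loc_def by blast
        have "inv_fun g y = k y" if y: "y \<in> N" for y
        proof -
          obtain x where x: "x \<in> A n" "y = \<theta> n x" using n y by blast
          have "inv_fun g y = x" using g(2)[OF x(1)] x(2) app(1)[OF gA, of x] by simp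
          also have "x = inv_fun (\<theta> n) y" using x(2) app(1)[OF aut[OF \<theta>[of n]], of x] by simp
          finally show ?thesis using k(2) y by simp
        qed
        then show "\<exists>k\<in>K. \<forall>x\<in>N. inv_fun g x = k x" using k(1) by blast
      qed
      ultimately have "g \<in> G" using gA by (simp add: G_def)
      then show ?thesis using g(2) by blast
    qed
  qed (fact K_id K_comp K_inv K_countable A_countable K_image directed E0 finite extension)+
  moreover have "G \<subseteq> automorphisms" using aut by blast
  moreover have "g0 \<in> G"
  proof -
    have "g0 \<in> K" using S(2) by (simp add: K_def)
    then show ?thesis using g0 loc_K K_inv by (simp add: G_def)
  qed
  ultimately show thesis using that by blast
qed

end

section \<open>The target group\<close>

lemma (in Metric_space) MCauchy_geometric:
  assumes "range x \<subseteq> M" "\<And>n. d (x n) (x (Suc n)) < (1/2) ^ n"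
  shows "MCauchy x"
proof -
  have M: "x n \<in> M" for n using assms(1) by blast
  \<comment> \<open>The difference of two geometric terms, rather than the bound 2 (1/2)^m alone, is
    what the induction on k reproduces.\<close>
  have tail: "d (x m) (x (m + k)) \<le> 2 * (1/2) ^ m - 2 * (1/2) ^ (m + k)" for m k
  proof (induction k)
    case (Suc k)
    have "d (x m) (x (m + Suc k)) \<le> d (x m) (x (m + k)) + d (x (m + k)) (x (m + Suc k))"
      using triangle[OF M M M] .
    then show ?case using Suc assms(2)[of "m + k"] by simp
  qed (simp add: M)
  have bound: "d (x m) (x n) \<le> 2 * (1/2) ^ N" if "N \<le> m" "m \<le> n" for m n N
  proof -
    have "d (x m) (x n) \<le> 2 * (1/2) ^ m - 2 * (1/2) ^ n" using tail[of m "n - m"] that by simp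
    also have "\<dots> \<le> 2 * (1/2 :: real) ^ m" by simp
    also have "\<dots> \<le> 2 * (1/2) ^ N" using power_decreasing[OF that(1), of "1/2 :: real"] by simp
    finally show ?thesis .
  qed
  show ?thesis unfolding MCauchy_def
  proof (intro conjI allI impI assms(1))
    fix e :: real assume "e > 0"
    then obtain N where N: "(1/2 :: real) ^ N < e / 2" using real_arch_pow_inv[of "e / 2" "1/2"] by auto
    show "\<exists>N. \<forall>n n'. N \<le> n \<longrightarrow> N \<le> n' \<longrightarrow> d (x n) (x n') < e"
    proof (intro exI[of _ N] allI impI)
      fix n n' assume "N \<le> n" "N \<le> n'"
      then have "d (x n) (x n') \<le> 2 * (1/2) ^ N"
        using bound[of N n n'] bound[of N n' n] commute[of "x n" "x n'"] by (cases "n \<le> n'") auto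
      then show "d (x n) (x n') < e" using N by simp
    qed
  qed
qed

theorem theorem7p3:
  fixes F :: "'a::metric_space mstruct"
    and H :: "('h, 'm) monoid_scheme" and T :: "'h topology"
    and h :: "('a \<Rightarrow> 'a) \<Rightarrow> 'h"
  assumes "complete_metric_structure F"
    and "admits_independent_sequences F"
    and "locally_finite_automorphisms F"
    and "extension_property F"
    and "polish_group H T"
    and "admits_complete_left_invariant_metric H T"
    and "h \<in> hom (Aut F) H"
  shows "\<forall>\<phi>\<in>carrier (Aut F). h \<phi> = \<one>\<^bsub>H\<^esub>"
proof
  fix \<phi> assume "\<phi> \<in> carrier (Aut F)"
  interpret homogeneous_structure F
    by unfold_locales (fact assms)+
  have Aut: "carrier (Aut F) = automorphisms" by (simp add: Aut_def automorphisms_def)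
  \<comment> \<open>The skeleton is chosen for this single \<phi>; its group G need not be all of
    Aut(X).\<close>
  obtain G K \<A> E0 where skeleton: "skeleton G K \<A> E0" and GA: "G \<subseteq> automorphisms" and "\<phi> \<in> G"
    using skeleton_exists[of \<phi>] \<open>\<phi> \<in> carrier (Aut F)\<close> Aut by blast
  interpret S: skeleton G K \<A> E0 by (rule skeleton)
  obtain d where d: "Metric_space (carrier H) d" "Metric_space.mtopology (carrier H) d = T"
    "Metric_space.mcomplete (carrier H) d"
    and invariant: "\<And>g x y. g \<in> carrier H \<Longrightarrow> x \<in> carrier H \<Longrightarrow> y \<in> carrier H \<Longrightarrow> d (g \<otimes>\<^bsub>H\<^esub> x) (g \<otimes>\<^bsub>H\<^esub> y) = d x y"
    using assms(6) unfolding admits_complete_left_invariant_metric_def by blast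
  interpret H: Metric_space "carrier H" d by (rule d)
  have tg: "topological_group H T" and sep: "separable_space T"
    using assms(5) by (auto simp: polish_group_def)
  interpret group H using tg by (simp add: topological_group_def)
  have mult_cont: "continuous_map (prod_topology T T) T (\<lambda>(x, y). x \<otimes>\<^bsub>H\<^esub> y)"
    and inv_cont: "continuous_map T T (\<lambda>x. inv\<^bsub>H\<^esub> x)" and top: "topspace T = carrier H"
    using tg by (auto simp: topological_group_def)
  have hH: "h g \<in> carrier H" if "g \<in> G" for g using assms(7) that GA Aut by (auto simp: hom_def)
  have h_comp: "h (f \<circ> g) = h f \<otimes>\<^bsub>H\<^esub> h g" if "f \<in> G" "g \<in> G" for f g
    using hom_mult[OF assms(7), of f g] that GA Aut by (auto simp: Aut_def)
  have h_id: "h id = \<one>\<^bsub>H\<^esub>"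
    using h_comp[OF S.G_id S.G_id] hH[OF S.G_id] by (simp add: l_cancel_one')
  have h_inv: "h (inv_fun g) = inv\<^bsub>H\<^esub> (h g)" if "g \<in> G" for g
    using h_comp[OF S.G_inv[OF that] that] hH S.G_inv[OF that] that h_id S.inv_o(1)[OF that]
    by (intro inv_equality[symmetric]) auto
  define L where "L g = d (h g) \<one>\<^bsub>H\<^esub>" for g
  \<comment> \<open>By left invariance, translating by h f turns the length of a quotient into a
    distance of images; the translates in \<open>cover\<close> are thus preimages of balls of
    d.\<close>
  have L_diff: "L (inv_fun f \<circ> g) = d (h f) (h g)" if "f \<in> G" "g \<in> G" for f g
  proof -
    have "L (inv_fun f \<circ> g) = d (h f \<otimes>\<^bsub>H\<^esub> (inv\<^bsub>H\<^esub> (h f) \<otimes>\<^bsub>H\<^esub> h g)) (h f \<otimes>\<^bsub>H\<^esub> \<one>\<^bsub>H\<^esub>)"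
      unfolding L_def using that hH S.G_inv
      by (subst invariant) (simp_all add: h_comp h_inv)
    also have "\<dots> = d (h g) (h f)" using that hH by (simp add: m_assoc[symmetric])
    finally show ?thesis by (simp add: H.commute)
  qed
  have "L \<phi> \<le> 0"
  proof (rule S.length_trivial[OF _ _ _ _ \<open>\<phi> \<in> G\<close>])
    fix f g assume f: "f \<in> G" and g: "g \<in> G"
    have "L (f \<circ> g) \<le> d (h f \<otimes>\<^bsub>H\<^esub> h g) (h f) + L f"
      unfolding L_def h_comp[OF f g] by (rule H.triangle) (use hH f g in auto)
    also have "d (h f \<otimes>\<^bsub>H\<^esub> h g) (h f) = L g"
      using invariant[of "h f" "h g" "\<one>\<^bsub>H\<^esub>"] hH f g by (simp add: L_def)
    finally show "L (f \<circ> g) \<le> L f + L g" by (simp only: add.commute)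
  next
    fix g assume g: "g \<in> G"
    show "L (inv_fun g) = L g" using L_diff[OF g S.G_id] by (simp add: L_def h_id)
  next
    fix e :: real assume "e > 0"
    obtain C where C: "countable C" "C \<subseteq> carrier H" "T closure_of C = carrier H"
      using sep top by (auto simp: separable_space_def)
    have near: "\<exists>q\<in>C. d (h g) q < e / 2" if "g \<in> G" for g
    proof -
      have "h g \<in> H.mtopology closure_of C" using C(3) d(2) hH[OF that] by simp
      then obtain q where "q \<in> C" "q \<in> H.mball (h g) (e / 2)"
        using \<open>e > 0\<close> half_gt_zero[of e] unfolding H.metric_closure_of by blast
      then show ?thesis by auto
    qed
    \<comment> \<open>The dense points q need not lie in the image of h. Each is replaced by an
      element of G whose image is within e/2 of q, and two such halves add up to e; the value id is
      a mere default for q far from the image.\<close>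
    define k where "k q = (if \<exists>g\<in>G. d (h g) q < e / 2 then SOME g. g \<in> G \<and> d (h g) q < e / 2 else id)" for q
    have kG: "k q \<in> G" for q
      unfolding k_def using S.G_id someI_ex[of "\<lambda>g. g \<in> G \<and> d (h g) q < e / 2"] by auto
    have "C \<noteq> {}" using near[OF S.G_id] by blast
    then have enum: "range (from_nat_into C) = C" using C(1) by (simp add: range_from_nat_into)
    have "\<exists>n. L (inv_fun (k (from_nat_into C n)) \<circ> g) < e" if g: "g \<in> G" for g
    proof -
      obtain q where q: "q \<in> C" "d (h g) q < e / 2" using near[OF g] by blast
      then have "d (h (k q)) q < e / 2"
        unfolding k_def using g someI_ex[of "\<lambda>g. g \<in> G \<and> d (h g) q < e / 2"] by auto
      then have "L (inv_fun (k q) \<circ> g) < e"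
        using H.triangle[of "h (k q)" q "h g"] hH[OF kG[of q]] hH[OF g] q C(2) L_diff[OF kG[of q] g] H.commute[of "h g" q]
        by auto
      then show ?thesis using q(1) enum by (metis rangeE)
    qed
    then show "\<exists>k::nat \<Rightarrow> _. (\<forall>n. k n \<in> G) \<and> (\<forall>g\<in>G. \<exists>n. L (inv_fun (k n) \<circ> g) < e)"
      using kG by (intro exI[of _ "\<lambda>n. k (from_nat_into C n)"]) auto
  next
    fix f t assume f: "\<And>n. f n \<in> G" and t: "t \<in> G"
      and cauchy: "\<And>n. L (inv_fun (f n) \<circ> f (Suc n)) < (1/2) ^ n"
      and small: "\<And>n. L (inv_fun (f n) \<circ> t \<circ> f n) < (1/2) ^ n"
    have "H.MCauchy (\<lambda>n. h (f n))"
      by (rule H.MCauchy_geometric) (use hH f cauchy L_diff in auto)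
    then obtain q where q: "limitin T (\<lambda>n. h (f n)) q sequentially"
      using d(2,3) unfolding H.mcomplete_def by blast
    have qH: "q \<in> carrier H" using limitin_topspace[OF q] top by simp
    define y where "y n = h (inv_fun (f n) \<circ> t \<circ> f n)" for n
    have fG: "inv_fun (f n) \<circ> t \<circ> f n \<in> G" for n using f t by (intro S.G_comp S.G_inv)
    then have yH: "y n \<in> carrier H" for n unfolding y_def by (rule hH)
    have y: "limitin T y \<one>\<^bsub>H\<^esub> sequentially"
    proof -
      have "(\<lambda>n. d (y n) \<one>\<^bsub>H\<^esub>) \<longlonglongrightarrow> 0"
      proof (rule tendsto_sandwich[OF _ _ tendsto_const LIMSEQ_power_zero[of "1/2 :: real"]])
        show "\<forall>\<^sub>F n in sequentially. d (y n) \<one>\<^bsub>H\<^esub> \<le> (1/2) ^ n"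
          using small by (intro always_eventually allI less_imp_le) (simp add: L_def y_def)
      qed (simp_all)
      then show ?thesis using yH d(2)[symmetric] by (simp add: H.limitin_metric_dist_null)
    qed
    \<comment> \<open>The left side does not depend on n, while the right side tends to q 1 q^-1 =
      1.\<close>
    have conj: "h t = h (f n) \<otimes>\<^bsub>H\<^esub> y n \<otimes>\<^bsub>H\<^esub> inv\<^bsub>H\<^esub> (h (f n))" for n
    proof -
      have "t = f n \<circ> (inv_fun (f n) \<circ> t \<circ> f n) \<circ> inv_fun (f n)" using f by (simp add: fun_eq_iff)
      then have "h t = h (f n \<circ> (inv_fun (f n) \<circ> t \<circ> f n) \<circ> inv_fun (f n))" by simp
      also have "\<dots> = h (f n \<circ> (inv_fun (f n) \<circ> t \<circ> f n)) \<otimes>\<^bsub>H\<^esub> h (inv_fun (f n))"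
        by (rule h_comp[OF S.G_comp[OF f fG] S.G_inv[OF f]])
      also have "h (f n \<circ> (inv_fun (f n) \<circ> t \<circ> f n)) = h (f n) \<otimes>\<^bsub>H\<^esub> y n"
        unfolding y_def by (rule h_comp[OF f fG])
      finally show ?thesis by (simp add: h_inv f)
    qed
    have "limitin T (\<lambda>n. h (f n) \<otimes>\<^bsub>H\<^esub> y n) (q \<otimes>\<^bsub>H\<^esub> \<one>\<^bsub>H\<^esub>) sequentially"
      using continuous_map_limit[OF mult_cont limitin_prod_topologyI[OF q y]] by (simp add: o_def)
    moreover have "limitin T (\<lambda>n. inv\<^bsub>H\<^esub> (h (f n))) (inv\<^bsub>H\<^esub> q) sequentially"
      using continuous_map_limit[OF inv_cont q] by (simp add: o_def)
    ultimately have "limitin T (\<lambda>n. h (f n) \<otimes>\<^bsub>H\<^esub> y n \<otimes>\<^bsub>H\<^esub> inv\<^bsub>H\<^esub> (h (f n))) (q \<otimes>\<^bsub>H\<^esub> \<one>\<^bsub>H\<^esub> \<otimes>\<^bsub>H\<^esub> inv\<^bsub>H\<^esub> q) sequentially"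
      using continuous_map_limit[OF mult_cont limitin_prod_topologyI] by (fastforce simp: o_def)
    then have "limitin T (\<lambda>n::nat. h t) \<one>\<^bsub>H\<^esub> sequentially"
      unfolding conj[symmetric] using qH by simp
    moreover have "limitin T (\<lambda>n::nat. h t) (h t) sequentially" using hH[OF t] top by simp
    ultimately have "h t = \<one>\<^bsub>H\<^esub>"
      using d(2) H.limitin_metric_unique trivial_limit_sequentially by metis
    then show "L t \<le> 0" by (simp add: L_def)
  qed
  then have "d (h \<phi>) \<one>\<^bsub>H\<^esub> = 0" using H.nonneg[of "h \<phi>" "\<one>\<^bsub>H\<^esub>"] unfolding L_def by linarith
  then show "h \<phi> = \<one>\<^bsub>H\<^esub>" using hH[OF \<open>\<phi> \<in> G\<close>] by simp
qed

end
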